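(* Let $N\ge1$, $\beta>0$, $n\ge1$, let $x,y$ be two vertices of $\Lambda_n$, and let $\theta$ be the spin $O(N)$ model on $\Lambda_n$ at inverse temperature $\beta$ with free boundary conditions. Then $$\frac1N\,\mathbb{P}\big(x\overset{\tilde{\mathcal L}^1}{\longleftrightarrow}y\big)\le\mathbb{E}\big[\theta(x)\cdot\theta(y)\big]\le N\,\mathbb{P}\big(x\overset{\tilde{\mathcal L}^1}{\longleftrightarrow}y\big).$$
   Context: $\Lambda_n=[-n,n]^2\cap\mathbb{Z}^2$ with nearest-neighbour edges. The spin $O(N)$ model at inverse temperature $\beta$ with free boundary conditions is the measure on $(\mathbb{S}^{N-1})^{\Lambda_n}$ proportional to $\exp(\beta\sum_{i\sim j}\theta(i)\cdot\theta(j))\prod_i\lambda_{\mathbb{S}^{N-1}}(d\theta(i))$, with $\lambda_{\mathbb{S}^{N-1}}$ the uniform measure on the unit sphere of $\mathbb{R}^N$ ($\mathbb{S}^0=\{\pm1\}$). Extension to the metric (cable) graph $\tilde\Lambda_n$ (each edge replaced by a segment of unit length): let $\tilde\Phi=(\tilde\Phi^1,\dots,\tilde\Phi^N)$ be the $N$-vectorial free-boundary GFF on $\tilde\Lambda_n$ conditioned on $\|\tilde\Phi(v)\|=\sqrt\beta$ for all vertices $v\in\Lambda_n$. Concretely: $\tilde\Phi(v)=\sqrt\beta\,\theta(v)$ at the vertices, and conditionally on $\theta$ the values of $\tilde\Phi$ along the different edges $\{u,v\}$ are independent standard $N$-dimensional Brownian bridges of duration $1$ from $\sqrt\beta\,\theta(u)$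 to $\sqrt\beta\,\theta(v)$. Let $\tilde L^1=(\tilde\Phi^1)^2$; by the isomorphism theorem it has the law of the occupation time field of $\tilde{\mathcal L}^1$, the collection of loops with label $1$ in a metric-graph random walk loop soup of intensity $N/2$ whose loops carry i.i.d. uniform labels in $\{1,\dots,N\}$ and whose total occupation field is conditioned to be $\beta$ at every vertex. The event $x\overset{\tilde{\mathcal L}^1}{\longleftrightarrow}y$ is that $x$ and $y$ belong to the same connected component of $\{z\in\tilde\Lambda_n:\tilde L^1(z)>0\}$. *)

theory Defs
  imports "HOL-Probability.Probability"
begin

section \<open>The box and its cable graph\<close>

definition lattice_box :: "nat \<Rightarrow> (real \<times> real) set" where
  "lattice_box n = ({- real n..real n} \<inter> \<int>) \<times> ({- real n..real n} \<inter> \<int>)"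

text \<open>Every nearest-neighbour edge occurs exactly once, oriented to the right or upwards. The
  orientation only serves to parametrise the edge.\<close>

definition box_edges :: "nat \<Rightarrow> ((real \<times> real) \<times> (real \<times> real)) set" where
  "box_edges n = {(u, v). u \<in> lattice_box n \<and> v \<in> lattice_box n \<and>
                          (v = u + (1, 0) \<or> v = u + (0, 1))}"

text \<open>Since the edges are disjoint unit segments of the plane meeting only at common endpoints, the
  cable graph is this subset of the plane, with the induced topology. (For \<open>n \<ge> 1\<close> every vertex
  lies on an edge.)\<close>

definition cable_graph :: "nat \<Rightarrow> (real \<times> real) set" where
  "cable_graph n = (\<Union>(u, v)\<in>box_edges n. closed_segment u v)"


section \<open>The spin O(N) model\<close>

text \<open>The dimension \<open>N\<close> is \<open>CARD('N)\<close>. The uniform measure on the unit sphere is the law of the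
  direction of a uniform point of the unit ball; for \<open>N = 1\<close> it gives mass one half to each
  of the two unit vectors. It is regarded as a measure on the ambient space.\<close>

definition sphere_uniform :: "(real ^ 'N) measure" where
  "sphere_uniform = distr (uniform_measure lborel (ball 0 1)) borel (\<lambda>x. x /\<^sub>R norm x)"

definition spin_weight :: "real \<Rightarrow> nat \<Rightarrow> (real \<times> real \<Rightarrow> real ^ 'N) \<Rightarrow> real" where
  "spin_weight \<beta> n \<sigma> = exp (\<beta> * (\<Sum>(u, v)\<in>box_edges n. \<sigma> u \<bullet> \<sigma> v))"

definition spin_O_model :: "real \<Rightarrow> nat \<Rightarrow> (real \<times> real \<Rightarrow> real ^ 'N) measure" where
  "spin_O_model \<beta> n =
     (let R = Pi\<^sub>M (lattice_box n) (\<lambda>_. sphere_uniform)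
      in density R (\<lambda>\<sigma>. ennreal (spin_weight \<beta> n \<sigma> / (\<integral>\<tau>. spin_weight \<beta> n \<tau> \<partial>R))))"


section \<open>Brownian bridges\<close>

definition bm_transition :: "real \<Rightarrow> real ^ 'N \<Rightarrow> real ^ 'N \<Rightarrow> real" where
  "bm_transition s a b = (\<Prod>k\<in>UNIV. normal_density (a $ k) (sqrt s) (b $ k))"

definition time_grid :: "nat \<Rightarrow> (nat \<Rightarrow> real) \<Rightarrow> bool" where
  "time_grid m t \<longleftrightarrow> t 0 = 0 \<and> t (Suc m) = 1 \<and> strict_mono_on {0..Suc m} t"

text \<open>The joint law at the interior times \<open>t 1 < \<dots> < t m\<close> of a grid of the standard Brownian bridge
  of duration 1 from \<open>a\<close> to \<open>b\<close>: the density of Brownian motion started from \<open>a\<close> at the times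
  \<open>t 1, \<dots>, t m, 1\<close>, conditioned on the value \<open>b\<close> at time 1.\<close>

definition brownian_bridge_fdd ::
  "nat \<Rightarrow> (nat \<Rightarrow> real) \<Rightarrow> real ^ 'N \<Rightarrow> real ^ 'N \<Rightarrow> (nat \<Rightarrow> real ^ 'N) measure" where
  "brownian_bridge_fdd m t a b =
     density (Pi\<^sub>M {1..m} (\<lambda>_. lborel))
       (\<lambda>q. let p = q(0 := a, Suc m := b)
            in ennreal ((\<Prod>i\<le>m. bm_transition (t (Suc i) - t i) (p i) (p (Suc i)))
                        / bm_transition 1 a b))"


section \<open>The extension of the spin model to the cable graph\<close>

definition edge_values ::
  "nat \<Rightarrow> nat \<Rightarrow> (nat \<Rightarrow> real) \<Rightarrow> (real \<times> real \<Rightarrow> real ^ 'N)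
   \<Rightarrow> (real \<times> real) \<times> (real \<times> real) \<Rightarrow> nat \<Rightarrow> real ^ 'N" where
  "edge_values n m t \<phi> = (\<lambda>(u, v)\<in>box_edges n. \<lambda>i\<in>{1..m}. \<phi> (linepath u v (t i)))"

text \<open>\<open>\<theta>\<close> is a spin O(N) model and \<open>\<Phi>\<close> its extension to the cable graph, defined on the probability
  space \<open>M\<close>. The last clause says that a regular conditional law of \<open>\<Phi>\<close> along the edges given \<open>\<theta>\<close>
  is that of independent Brownian bridges. It is stated through finite-dimensional laws, which
  together with continuity determine the law of the paths; one grid common to all edges is
  enough because finitely many grids have a common refinement.\<close>

definition cable_spin_field ::
  "'\<omega> measure \<Rightarrow> real \<Rightarrow> nat \<Rightarrow> ('\<omega> \<Rightarrow> real \<times> real \<Rightarrow> real ^ 'N)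
   \<Rightarrow> ('\<omega> \<Rightarrow> real \<times> real \<Rightarrow> real ^ 'N) \<Rightarrow> bool" where
  "cable_spin_field M \<beta> n \<theta> \<Phi> \<longleftrightarrow>
     prob_space M \<and>
     (\<forall>v\<in>lattice_box n. (\<lambda>\<omega>. \<theta> \<omega> v) \<in> borel_measurable M) \<and>
     (\<forall>z\<in>cable_graph n. (\<lambda>\<omega>. \<Phi> \<omega> z) \<in> borel_measurable M) \<and>
     distr M (Pi\<^sub>M (lattice_box n) (\<lambda>_. borel)) (\<lambda>\<omega>. restrict (\<theta> \<omega>) (lattice_box n))
       = spin_O_model \<beta> n \<and>
     (\<forall>\<omega>\<in>space M. continuous_on (cable_graph n) (\<Phi> \<omega>)) \<and>
     (\<forall>\<omega>\<in>space M. \<forall>v\<in>lattice_box n. \<Phi> \<omega> v = sqrt \<beta> *\<^sub>R \<theta> \<omega> v) \<and>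
     (\<forall>m t. time_grid m t \<longrightarrow>
        (\<forall>A\<in>sets (Pi\<^sub>M (lattice_box n) (\<lambda>_. borel)).
         \<forall>C\<in>sets (Pi\<^sub>M (box_edges n) (\<lambda>_. Pi\<^sub>M {1..m} (\<lambda>_. borel))).
           emeasure M {\<omega> \<in> space M. restrict (\<theta> \<omega>) (lattice_box n) \<in> A \<and>
                                    edge_values n m t (\<Phi> \<omega>) \<in> C}
           = (\<integral>\<^sup>+ \<sigma>. indicator A \<sigma> *
                emeasure (Pi\<^sub>M (box_edges n) (\<lambda>(u, v).
                   brownian_bridge_fdd m t (sqrt \<beta> *\<^sub>R \<sigma> u) (sqrt \<beta> *\<^sub>R \<sigma> v))) C
              \<partial>spin_O_model \<beta> n)))"

text \<open>The occupation field of the loops with label \<open>k\<close>.\<close>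

definition label_field :: "'N \<Rightarrow> (real \<times> real \<Rightarrow> real ^ 'N) \<Rightarrow> real \<times> real \<Rightarrow> real" where
  "label_field k \<phi> z = (\<phi> z $ k)\<^sup>2"

definition label_connected ::
  "nat \<Rightarrow> 'N \<Rightarrow> (real \<times> real \<Rightarrow> real ^ 'N) \<Rightarrow> real \<times> real \<Rightarrow> real \<times> real \<Rightarrow> bool" where
  "label_connected n k \<phi> x y \<longleftrightarrow>
     connected_component {z \<in> cable_graph n. label_field k \<phi> z > 0} x y"

end

theory Submission
  imports Defs "HOL-Real_Asymp.Real_Asymp"
begin

text \<open>Call an edge open if coordinate \<open>k\<close> of the field has no zero on it; then \<open>x\<close> and \<open>y\<close> are connected
  iff they are joined by open edges. Given the spins, the edges are open independently, and by the
  reflection principle a closed edge contributes a weight that is invariant under flipping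
  coordinate \<open>k\<close> of either of its endpoints. Flipping the cluster of \<open>x\<close> shows that an odd function of
  \<open>\<theta> x $ k\<close> times a function of \<open>\<theta> y $ k\<close> has zero expectation off the event of connection, on which
  both coordinates have the same sign.

  The upper bound follows from \<open>E[\<theta> x \<bullet> \<theta> y] = N E[\<theta> x $ k * \<theta> y $ k]\<close>. For the lower bound, put
  \<open>r = \<bar>\<theta> x $ k\<bar>\<close> and \<open>s = \<bar>\<theta> y $ k\<bar>\<close>. Then \<open>1 \<le> (r / s + s / r) / 2\<close>, and \<open>E[r / s; connected]\<close> equals
  \<open>E[\<theta> x $ k / \<theta> y $ k]\<close>, which is \<open>E[\<theta> x \<bullet> \<theta> y]\<close> by reflecting all spins in the line spanned by \<open>\<theta> y\<close>. This
  proves the lower bound even without the factor \<open>1 / N\<close>. (The ratios are truncated, since they need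
  not be integrable.)\<close>

section \<open>Brownian bridges avoiding the origin\<close>

text \<open>The field is described through its values on finite grids, while the absence of zeros
  concerns whole paths. The link is the probability 1 - exp (- 2 a b / s) that a bridge of duration
  s between a, b > 0 stays positive. Multiplied by the Gaussian density it is the heat kernel of the
  half-line, which again satisfies the Chapman-Kolmogorov equation. So the product of these
  probabilities along a grid has the same expectation for every grid, and the limit of fine grids
  needs only continuity of the paths.

  The flip works because two exponents match. Endpoints are scaled by sqrt \<beta>, so for
  coordinates s, t of equal sign an edge is closed with probability exp (- 2 \<beta> s t), the very
  factor that turns exp (\<beta> s t) into exp (- \<beta> s t).

  For the lower bound, the probability of connection is the expectation of a product of two signs,
  which is not a function of the inner product of the spins. The arithmetic-geometric mean
  inequality trades it for ratios of coordinates. There only the numerator has to be odd, and the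
  ratio can be averaged over the orthogonal group.\<close>

abbreviation gauss :: "real \<Rightarrow> real \<Rightarrow> real \<Rightarrow> real" where
  "gauss s a b \<equiv> normal_density a (sqrt s) b"

text \<open>Probability that a Brownian bridge of duration \<open>s\<close> from \<open>a\<close> to
  \<open>b\<close> stays positive. Truncating at 0 makes it vanish as soon as one end is not
  positive, so an integral over an intermediate point restricts itself to the half-line.\<close>

definition survival :: "real \<Rightarrow> real \<Rightarrow> real \<Rightarrow> real" where
  "survival s a b = 1 - exp (- (2 * max a 0 * max b 0 / s))"

lemma survival_bounds: "s > 0 \<Longrightarrow> 0 \<le> survival s a b" "survival s a b \<le> 1"
  by (auto simp: survival_def)

lemma survival_eq_0: "a \<le> 0 \<or> b \<le> 0 \<Longrightarrow> survival s a b = 0"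
  by (auto simp: survival_def max_def)

lemma survival_measurable [measurable]:
  assumes [measurable]: "f \<in> borel_measurable M" "g \<in> borel_measurable M"
  shows "(\<lambda>x. survival s (f x) (g x)) \<in> borel_measurable M"
  unfolding survival_def by measurable

lemma gauss_translate: "gauss s (a + c) (b + c) = gauss s a b"
  by (simp add: normal_density_def)

lemma gauss_minus: "gauss s (- a) b = gauss s a (- b)"
  by (simp add: normal_density_def power2_eq_square algebra_simps)

lemma gauss_measurable [measurable]:
  assumes [measurable]: "f \<in> borel_measurable M" "g \<in> borel_measurable M"
  shows "(\<lambda>x. gauss s (f x) (g x)) \<in> borel_measurable M"
  unfolding normal_density_def by measurable

lemma gauss_Chapman_Kolmogorov:
  assumes "s > 0" "t > 0"
  shows "(\<integral>\<^sup>+c. ennreal (gauss s a c * gauss t c b) \<partial>lborel) = gauss (s + t) a b"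
proof -
  have "(\<integral>\<^sup>+c. ennreal (gauss s a c * gauss t c b) \<partial>lborel)
      = (\<integral>\<^sup>+y. ennreal (gauss s a (a + 1 * y) * gauss t (a + 1 * y) b) \<partial>lborel)"
    by (subst nn_integral_real_affine[where c=1 and t=a]) auto
  also have "\<dots> = (\<integral>\<^sup>+y. ennreal (gauss t 0 ((b - a) - y) * gauss s 0 y) \<partial>lborel)"
    by (intro nn_integral_cong arg_cong[where f=ennreal])
       (simp add: normal_density_def algebra_simps)
  also have "\<dots> = gauss (s + t) 0 (b - a)"
    using fun_cong[OF conv_normal_density_zero_mean[of "sqrt t" "sqrt s"], of "b - a"] assms
    by (simp add: add.commute)
  also have "\<dots> = gauss (s + t) a b"
    by (simp add: normal_density_def)
  finally show ?thesis .
qed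

lemma gauss_Chapman_Kolmogorov_real:
  assumes "s > 0" "t > 0"
  shows "has_bochner_integral lborel (\<lambda>c. gauss s a c * gauss t c b) (gauss (s + t) a b)"
  by (rule has_bochner_integral_nn_integral)
     (use gauss_Chapman_Kolmogorov[OF assms] in \<open>auto intro!: mult_nonneg_nonneg\<close>)

text \<open>Method of images: the density killed at 0 is the free density minus that of the paths
  reflected at their first zero, which end at \<open>- b\<close>. Algebraically, (b - a)^2 + 4 a b =
  (b + a)^2.\<close>

lemma gauss_survival:
  assumes "s > 0" "a > 0" "b > 0"
  shows "gauss s a b * survival s a b = gauss s a b - gauss s a (- b)"
proof -
  have "- (b - a)\<^sup>2 / (2 * s) - 2 * a * b / s = - (- b - a)\<^sup>2 / (2 * s)"
    using assms by (simp add: field_simps power2_eq_square)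
  then have "gauss s a b * exp (- (2 * a * b / s)) = gauss s a (- b)"
    using assms by (simp add: normal_density_def mult_exp_exp)
  then show ?thesis using assms by (simp add: survival_def algebra_simps max_def)
qed

lemma nn_integral_even:
  fixes f :: "real \<Rightarrow> ennreal"
  assumes [measurable]: "f \<in> borel_measurable borel" and "\<And>x. f (- x) = f x"
  shows "(\<integral>\<^sup>+x. f x \<partial>lborel) = 2 * (\<integral>\<^sup>+x. f x * indicator {0<..} x \<partial>lborel)"
proof -
  have "(\<integral>\<^sup>+x. f x * indicator {0<..} x \<partial>lborel)
      = (\<integral>\<^sup>+x. f (0 + (-1) * x) * indicator {0<..} (0 + (-1) * x) \<partial>lborel)"
    by (subst nn_integral_real_affine[where c="-1" and t=0]) auto
  also have "\<dots> = (\<integral>\<^sup>+x. f x * indicator {..<0} x \<partial>lborel)"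
    by (intro nn_integral_cong) (auto simp: assms indicator_def)
  finally have *: "(\<integral>\<^sup>+x. f x * indicator {0<..} x \<partial>lborel) = (\<integral>\<^sup>+x. f x * indicator {..<0} x \<partial>lborel)" .
  have "(\<integral>\<^sup>+x. f x \<partial>lborel)
      = (\<integral>\<^sup>+x. f x * indicator {0<..} x + f x * indicator {..<0} x \<partial>lborel)"
    by (rule nn_integral_cong_AE, rule eventually_mono[OF AE_lborel_singleton[of 0]])
       (auto simp: indicator_def)
  also have "\<dots> = 2 * (\<integral>\<^sup>+x. f x * indicator {0<..} x \<partial>lborel)"
    by (subst nn_integral_add) (auto simp: * mult_2)
  finally show ?thesis .
qed

text \<open>In image form both factors are odd in the intermediate point, so their product is even
  and its half-line integral is half the integral over the line, where the free Chapman-Kolmogorov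
  equation applies to each term.\<close>

lemma killed_gauss_Chapman_Kolmogorov:
  assumes st: "s > 0" "t > 0"
  shows "(\<integral>\<^sup>+c. ennreal ((gauss s a c * survival s a c) * (gauss t c b * survival t c b)) \<partial>lborel)
       = gauss (s + t) a b * survival (s + t) a b"
proof (cases "a > 0 \<and> b > 0")
  case False
  then have "survival s a c * survival t c b = 0" "survival (s + t) a b = 0" for c
    by (auto simp: survival_eq_0 not_less)
  then have "ennreal ((gauss s a c * survival s a c) * (gauss t c b * survival t c b)) = 0" for c
    by (metis ennreal_0 mult.commute mult.left_commute mult_zero_left)
  with \<open>survival (s + t) a b = 0\<close> show ?thesis by simp
next
  case True
  then have pos: "a > 0" "b > 0" by auto
  \<comment> \<open>The image formula for both factors, now for all real \<open>c\<close>: it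
    represents the killed densities for \<open>c > 0\<close> and is even.\<close>
  define H where "H c = (gauss s a c - gauss s a (- c)) * (gauss t c b - gauss t (- c) b)" for c
  have [measurable]: "H \<in> borel_measurable borel"
    unfolding H_def by measurable
  have H: "(gauss s a c * survival s a c) * (gauss t c b * survival t c b) = H c" if "c > 0" for c
    using pos that st by (simp add: H_def gauss_survival gauss_minus)
  have even: "H (- c) = H c" for c by (simp add: H_def algebra_simps)
  have nn: "0 \<le> H c" for c
  proof -
    have "0 \<le> H c" if "c > 0" for c
      unfolding H[OF that, symmetric] using st by (intro mult_nonneg_nonneg) (auto simp: survival_bounds)
    moreover have "H 0 = 0" by (simp add: H_def)
    ultimately show ?thesis using even[of c] by (cases c "0::real" rule: linorder_cases) (metis neg_0_less_iff_less less_eq_real_def)+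
  qed
  \<comment> \<open>The expansion has terms of both signs, hence Bochner integrals. The four
    resulting free densities agree in pairs, which produces the factor 2.\<close>
  have "has_bochner_integral lborel
          (\<lambda>c. gauss s a c * gauss t c b - gauss s a c * gauss t c (- b)
             - gauss s (- a) c * gauss t c b + gauss s (- a) c * gauss t c (- b))
          (gauss (s + t) a b - gauss (s + t) a (- b)
             - gauss (s + t) (- a) b + gauss (s + t) (- a) (- b))"
    using st by (intro has_bochner_integral_add has_bochner_integral_diff gauss_Chapman_Kolmogorov_real)
  also have "(\<lambda>c. gauss s a c * gauss t c b - gauss s a c * gauss t c (- b)
             - gauss s (- a) c * gauss t c b + gauss s (- a) c * gauss t c (- b)) = H"
    by (simp add: H_def fun_eq_iff gauss_minus algebra_simps)
  also have "gauss (s + t) a b - gauss (s + t) a (- b) - gauss (s + t) (- a) b + gauss (s + t) (- a) (- b)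
      = 2 * (gauss (s + t) a b * survival (s + t) a b)"
    using pos st by (subst gauss_survival) (auto simp: gauss_minus)
  finally have "(\<integral>\<^sup>+c. ennreal (H c) \<partial>lborel) = 2 * (gauss (s + t) a b * survival (s + t) a b)"
    by (simp add: has_bochner_integral_iff nn_integral_eq_integral nn)
  then have "2 * (\<integral>\<^sup>+c. ennreal (H c) * indicator {0<..} c \<partial>lborel)
     = 2 * ennreal (gauss (s + t) a b * survival (s + t) a b)"
    by (subst nn_integral_even[symmetric]) (auto simp: even ennreal_mult' simp flip: ennreal_numeral)
  then have "(\<integral>\<^sup>+c. ennreal (H c) * indicator {0<..} c \<partial>lborel)
     = ennreal (gauss (s + t) a b * survival (s + t) a b)"
    by (simp add: ennreal_mult_cancel_left)
  moreover have "(\<integral>\<^sup>+c. ennreal (H c) * indicator {0<..} c \<partial>lborel)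
     = (\<integral>\<^sup>+c. ennreal ((gauss s a c * survival s a c) * (gauss t c b * survival t c b)) \<partial>lborel)"
    by (intro nn_integral_cong) (auto simp: indicator_def H survival_eq_0)
  ultimately show ?thesis by simp
qed

text \<open>\<open>\<tau>\<close> selects the side of the origin, and \<open>\<epsilon>\<close> is the distance that is kept from it.\<close>

lemma killed_gauss_Chapman_Kolmogorov_affine:
  assumes st: "s > 0" "t > 0" and \<tau>: "\<tau> \<in> {-1, 1}"
  shows "(\<integral>\<^sup>+c. ennreal ((gauss s a c * survival s (\<tau> * a - \<epsilon>) (\<tau> * c - \<epsilon>))
                      * (gauss t c b * survival t (\<tau> * c - \<epsilon>) (\<tau> * b - \<epsilon>))) \<partial>lborel)
       = gauss (s + t) a b * survival (s + t) (\<tau> * a - \<epsilon>) (\<tau> * b - \<epsilon>)"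
proof -
  have g: "gauss r x y = gauss r (\<tau> * x - \<epsilon>) (\<tau> * y - \<epsilon>)" for r x y
    using \<tau> gauss_translate[where s=r and a="\<tau> * x" and c="- \<epsilon>" and b="\<tau> * y"] by (auto simp: gauss_minus)
  let ?f = "\<lambda>c. (gauss s (\<tau> * a - \<epsilon>) c * survival s (\<tau> * a - \<epsilon>) c)
                 * (gauss t c (\<tau> * b - \<epsilon>) * survival t c (\<tau> * b - \<epsilon>))"
  \<comment> \<open>This substitution preserves Lebesgue measure since \<open>\<tau>\<close> is a
    sign, and by \<open>g\<close> it leaves the Gaussian densities unchanged.\<close>
  have "(\<integral>\<^sup>+c. ennreal (?f c) \<partial>lborel) = (\<integral>\<^sup>+c. ennreal (?f (\<tau> * c - \<epsilon>)) \<partial>lborel)"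
    using \<tau> by (subst nn_integral_real_affine[where c=\<tau> and t="- \<epsilon>"]) auto
  also have "(\<integral>\<^sup>+c. ennreal (?f (\<tau> * c - \<epsilon>)) \<partial>lborel)
      = (\<integral>\<^sup>+c. ennreal ((gauss s a c * survival s (\<tau> * a - \<epsilon>) (\<tau> * c - \<epsilon>))
                      * (gauss t c b * survival t (\<tau> * c - \<epsilon>) (\<tau> * b - \<epsilon>))) \<partial>lborel)"
    by (intro nn_integral_cong arg_cong[where f=ennreal])
       (simp add: g[symmetric])
  finally show ?thesis
    using killed_gauss_Chapman_Kolmogorov[OF st, of "\<tau> * a - \<epsilon>" "\<tau> * b - \<epsilon>"] by (simp add: g[symmetric])
qed

section \<open>Weighted transition densities of N-dimensional Brownian motion\<close>

lemma nn_integral_lborel_prod_vec: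
  fixes f :: "'N::finite \<Rightarrow> real \<Rightarrow> real"
  assumes [measurable]: "\<And>k. f k \<in> borel_measurable borel" and "\<And>k x. 0 \<le> f k x"
  shows "(\<integral>\<^sup>+x. ennreal (\<Prod>k\<in>UNIV. f k (x $ k)) \<partial>(lborel :: (real ^ 'N) measure))
       = (\<Prod>k\<in>UNIV. \<integral>\<^sup>+x. f k x \<partial>lborel)"
proof -
  have inj: "inj (\<lambda>k::'N. axis k (1::real))"
    by (auto simp: inj_on_def axis_eq_axis)
  have Basis: "(Basis :: (real ^ 'N) set) = range (\<lambda>k. axis k 1)"
    by (auto simp: Basis_vec_def)
  define g where "g b = f (inv (\<lambda>k::'N. axis k (1::real)) b)" for b
  have g: "g (axis k 1) = f k" for k
    using inv_f_f[OF inj] by (simp add: g_def)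
  have [measurable]: "g b \<in> borel_measurable borel" for b
    unfolding g_def by measurable
  have "(\<integral>\<^sup>+x. ennreal (\<Prod>b\<in>Basis. g b (x \<bullet> b)) \<partial>(lborel :: (real ^ 'N) measure))
      = (\<Prod>b\<in>Basis. \<integral>\<^sup>+x. ennreal (g b x) \<partial>lborel)"
    using assms by (subst prod_ennreal[symmetric]) (auto simp: g_def intro!: nn_integral_lborel_prod)
  then show ?thesis
    by (simp add: Basis prod.reindex[OF inj] g inner_axis)
qed

lemma bm_transition_pos: "s > 0 \<Longrightarrow> bm_transition s a b > 0"
  by (auto simp: bm_transition_def intro!: prod_pos normal_density_pos)

lemma vec_nth_measurable [measurable]:
  fixes f :: "'a \<Rightarrow> real ^ 'N"
  assumes "f \<in> borel_measurable M"
  shows "(\<lambda>x. f x $ k) \<in> borel_measurable M"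
  using measurable_compose[OF assms borel_measurable_nth] .

lemma bm_transition_measurable [measurable]:
  assumes [measurable]: "f \<in> borel_measurable M" "g \<in> borel_measurable M"
  shows "(\<lambda>x. bm_transition s (f x) (g x)) \<in> borel_measurable M"
  unfolding bm_transition_def by measurable

text \<open>Weights \<open>w\<close> for which the heat kernel times \<open>w\<close> is still a
  semigroup. The instances are the constant 1, giving the total mass of the bridge law, and
  \<open>survival\<close>, giving the probability of avoiding 0; one computation then covers
  both.\<close>

definition semigroup_weight :: "(real \<Rightarrow> real \<Rightarrow> real \<Rightarrow> real) \<Rightarrow> bool" where
  "semigroup_weight w \<longleftrightarrow>
     (\<forall>s>0. \<forall>a b. 0 \<le> w s a b) \<and> (\<forall>s. (\<lambda>(a, b). w s a b) \<in> borel_measurable (borel \<Otimes>\<^sub>M borel)) \<and>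
     (\<forall>s>0. \<forall>t>0. \<forall>a b. (\<integral>\<^sup>+c. ennreal ((gauss s a c * w s a c) * (gauss t c b * w t c b)) \<partial>lborel)
        = gauss (s + t) a b * w (s + t) a b)"

lemma semigroup_weight_one: "semigroup_weight (\<lambda>_ _ _. 1)"
  using gauss_Chapman_Kolmogorov by (simp add: semigroup_weight_def)

lemma semigroup_weight_survival:
  "\<tau> \<in> {-1, 1} \<Longrightarrow> semigroup_weight (\<lambda>s a b. survival s (\<tau> * a - \<epsilon>) (\<tau> * b - \<epsilon>))"
  unfolding semigroup_weight_def
  by (intro conjI allI impI killed_gauss_Chapman_Kolmogorov_affine) (auto simp: survival_bounds)

lemma semigroup_weight_measurable:
  assumes "semigroup_weight w"
    and [measurable]: "f \<in> borel_measurable M" "g \<in> borel_measurable M"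
  shows "(\<lambda>x. w s (f x) (g x)) \<in> borel_measurable M"
proof -
  have [measurable]: "(\<lambda>(a, b). w s a b) \<in> borel_measurable (borel \<Otimes>\<^sub>M borel)"
    using assms by (auto simp: semigroup_weight_def)
  have "(\<lambda>x. (\<lambda>(a, b). w s a b) (f x, g x)) \<in> borel_measurable M"
    by measurable
  then show ?thesis by simp
qed

text \<open>The coordinates are independent, so the integral factorises; coordinate \<open>k\<close>
  carries the weight \<open>w\<close> and every other one the weight 1.\<close>

lemma bm_transition_Chapman_Kolmogorov:
  fixes a b :: "real ^ 'N"
  assumes w: "semigroup_weight w" and st: "s > 0" "t > 0"
  shows "(\<integral>\<^sup>+c. ennreal (bm_transition s a c * w s (a $ k) (c $ k))
              * ennreal (bm_transition t c b * w t (c $ k) (b $ k)) \<partial>lborel)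
       = bm_transition (s + t) a b * w (s + t) (a $ k) (b $ k)"
proof -
  define v where "v j = (if j = k then w else (\<lambda>_ _ _. 1))" for j
  have v: "semigroup_weight (v j)" for j
    using w semigroup_weight_one by (simp add: v_def)
  note [measurable] = semigroup_weight_measurable[OF v]
  have nn: "r > 0 \<Longrightarrow> 0 \<le> v j r x y" for j r x y
    using v[of j] by (auto simp: semigroup_weight_def)
  have eq: "bm_transition r x y * w r (x $ k) (y $ k) = (\<Prod>j\<in>UNIV. gauss r (x $ j) (y $ j) * v j r (x $ j) (y $ j))"
    for r and x y :: "real ^ 'N"
    by (simp add: v_def bm_transition_def prod.distrib if_distrib[where f="\<lambda>f. f _ _ _"] cong: if_cong)

  have nn': "r > 0 \<Longrightarrow> 0 \<le> (\<Prod>j\<in>UNIV. gauss r (x $ j) (y $ j) * v j r (x $ j) (y $ j))" for r x y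
    by (auto intro!: prod_nonneg simp: nn)
  have "(\<integral>\<^sup>+c. ennreal (bm_transition s a c * w s (a $ k) (c $ k))
              * ennreal (bm_transition t c b * w t (c $ k) (b $ k)) \<partial>lborel)
      = (\<integral>\<^sup>+c. ennreal (\<Prod>j\<in>UNIV. (gauss s (a $ j) (c $ j) * v j s (a $ j) (c $ j))
                * (gauss t (c $ j) (b $ j) * v j t (c $ j) (b $ j))) \<partial>lborel)"
    using st nn' by (simp add: eq prod.distrib ennreal_mult)
  also have "\<dots> = (\<Prod>j\<in>UNIV. \<integral>\<^sup>+c. ennreal ((gauss s (a $ j) c * v j s (a $ j) c)
                * (gauss t c (b $ j) * v j t c (b $ j))) \<partial>lborel)"
    using st by (intro nn_integral_lborel_prod_vec) (auto simp: nn)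
  also have "\<dots> = (\<Prod>j\<in>UNIV. ennreal (gauss (s + t) (a $ j) (b $ j) * v j (s + t) (a $ j) (b $ j)))"
    using v st by (simp add: semigroup_weight_def)
  also have "\<dots> = bm_transition (s + t) a b * w (s + t) (a $ k) (b $ k)"
    using st by (subst prod_ennreal) (auto simp: eq nn)
  finally show ?thesis .
qed

lemma path_component_measurable:
  assumes "i \<le> Suc m"
    and [measurable]: "f \<in> borel_measurable M" "g \<in> borel_measurable M" "h \<in> measurable M (Pi\<^sub>M {1..m} (\<lambda>_. borel))"
  shows "(\<lambda>x. ((h x)(0 := f x, Suc m := g x)) i) \<in> borel_measurable M"
proof (cases "i \<in> {1..m}")
  case True
  then have "(\<lambda>x. h x i) \<in> borel_measurable M" by measurable
  with True show ?thesis by (auto simp: fun_upd_def)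
next
  case False
  with \<open>i \<le> Suc m\<close> have "i = 0 \<or> i = Suc m" by auto
  then show ?thesis using assms by auto
qed

text \<open>The semigroup property removes interior times one by one, starting with the last. The
  right end varies in the induction because the last interior point becomes the right end of the
  shorter path.\<close>

lemma nn_integral_path_product:
  fixes \<kappa> :: "real \<Rightarrow> real ^ 'N \<Rightarrow> real ^ 'N \<Rightarrow> ennreal"
  assumes meas: "\<And>s. (\<lambda>(a, b). \<kappa> s a b) \<in> borel_measurable (borel \<Otimes>\<^sub>M borel)"
    and CK: "\<And>s t a b. s > 0 \<Longrightarrow> t > 0 \<Longrightarrow> (\<integral>\<^sup>+c. \<kappa> s a c * \<kappa> t c b \<partial>lborel) = \<kappa> (s + t) a b"
    and "strict_mono_on {0..Suc m} t"
  shows "(\<integral>\<^sup>+q. (\<Prod>i\<le>m. \<kappa> (t (Suc i) - t i) ((q(0 := a, Suc m := b)) i) ((q(0 := a, Suc m := b)) (Suc i)))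
            \<partial>Pi\<^sub>M {1..m} (\<lambda>_. lborel)) = \<kappa> (t (Suc m) - t 0) a b"
  using assms(3)
proof (induction m arbitrary: b)
  case 0
  interpret product_sigma_finite "\<lambda>_::nat. lborel :: (real ^ 'N) measure" ..
  show ?case by (simp add: PiM_empty)
next
  case (Suc m)
  interpret product_sigma_finite "\<lambda>_::nat. lborel :: (real ^ 'N) measure" ..
  have \<kappa>[measurable]: "(\<lambda>x. \<kappa> s (f x) (g x)) \<in> borel_measurable M"
    if [measurable]: "f \<in> borel_measurable M" "g \<in> borel_measurable M" for s M and f g :: "_ \<Rightarrow> real ^ 'N"
  proof -
    note [measurable] = meas[of s]
    have "(\<lambda>x. (\<lambda>(a, b). \<kappa> s a b) (f x, g x)) \<in> borel_measurable M"
      by measurable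
    then show ?thesis by simp
  qed
  have sets: "sets (Pi\<^sub>M I (\<lambda>_. lborel :: (real ^ 'N) measure)) = sets (Pi\<^sub>M I (\<lambda>_. borel))" for I :: "nat set"
    by (intro sets_PiM_cong) auto
  let ?p = "\<lambda>q. q(0 := a, Suc (Suc m) := b)"
  let ?F = "\<lambda>m q b. \<Prod>i\<le>m. \<kappa> (t (Suc i) - t i) ((q(0 := a, Suc m := b)) i) ((q(0 := a, Suc m := b)) (Suc i))"
  have F_meas: "(\<lambda>q. ?F l q c) \<in> borel_measurable (Pi\<^sub>M {1..l} (\<lambda>_. lborel))" for l c
    by (intro borel_measurable_prod_ennreal \<kappa> path_component_measurable) (auto simp: sets cong: measurable_cong_sets)
  have mono: "strict_mono_on {0..Suc m} t"
    using Suc.prems by (auto simp: strict_mono_on_def)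
  have less: "t 0 < t (Suc m)" "t (Suc m) < t (Suc (Suc m))"
    using Suc.prems by (auto simp: strict_mono_on_def)
  have ins: "{1..Suc m} = insert (Suc m) {1..m}" by auto
  have "(\<integral>\<^sup>+q. ?F (Suc m) q b \<partial>Pi\<^sub>M {1..Suc m} (\<lambda>_. lborel))
      = (\<integral>\<^sup>+c. (\<integral>\<^sup>+q. ?F (Suc m) (q(Suc m := c)) b \<partial>Pi\<^sub>M {1..m} (\<lambda>_. lborel)) \<partial>lborel)"
    using F_meas[of "Suc m" b] unfolding ins by (intro product_nn_integral_insert_rev) auto
  also have "\<dots> = (\<integral>\<^sup>+c. (\<integral>\<^sup>+q. ?F m q c * \<kappa> (t (Suc (Suc m)) - t (Suc m)) c b \<partial>Pi\<^sub>M {1..m} (\<lambda>_. lborel)) \<partial>lborel)"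
  proof (intro nn_integral_cong)
    fix c q
    have "?F (Suc m) (q(Suc m := c)) b
        = (\<Prod>i\<le>m. \<kappa> (t (Suc i) - t i) ((q(Suc m := c, 0 := a, Suc (Suc m) := b)) i) ((q(Suc m := c, 0 := a, Suc (Suc m) := b)) (Suc i)))
          * \<kappa> (t (Suc (Suc m)) - t (Suc m)) c b"
      by simp
    also have "(\<Prod>i\<le>m. \<kappa> (t (Suc i) - t i) ((q(Suc m := c, 0 := a, Suc (Suc m) := b)) i) ((q(Suc m := c, 0 := a, Suc (Suc m) := b)) (Suc i)))
        = ?F m q c"
      \<comment> \<open>The indices here are at most \<open>Suc m\<close>, so the update at
        \<open>Suc (Suc m)\<close> is not seen and \<open>c\<close> acts as the right end.\<close>
      by (intro prod.cong refl arg_cong2[where f="\<kappa> _"]) (auto simp: fun_upd_def)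
    finally show "?F (Suc m) (q(Suc m := c)) b = ?F m q c * \<kappa> (t (Suc (Suc m)) - t (Suc m)) c b" .
  qed
  also have "\<dots> = (\<integral>\<^sup>+c. \<kappa> (t (Suc m) - t 0) a c * \<kappa> (t (Suc (Suc m)) - t (Suc m)) c b \<partial>lborel)"
    by (intro nn_integral_cong, subst nn_integral_multc[OF F_meas], subst Suc.IH[OF mono]) auto
  also have "\<dots> = \<kappa> (t (Suc (Suc m)) - t 0) a b"
    using less by (subst CK) auto
  finally show ?case .
qed

section \<open>Expectations under the finite-dimensional bridge laws\<close>

lemma sets_brownian_bridge_fdd: "sets (brownian_bridge_fdd m t a b) = sets (Pi\<^sub>M {1..m} (\<lambda>_. borel))"
  unfolding brownian_bridge_fdd_def by (simp cong: sets_PiM_cong)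

lemma brownian_bridge_density_measurable:
  assumes "f \<in> borel_measurable M" "g \<in> borel_measurable M" "h \<in> measurable M (Pi\<^sub>M {1..m} (\<lambda>_. borel))"
  shows "(\<lambda>x. let p = (h x)(0 := f x, Suc m := g x)
            in ennreal ((\<Prod>i\<le>m. bm_transition (t (Suc i) - t i) (p i) (p (Suc i)))
                        / bm_transition 1 (f x) (g x))) \<in> borel_measurable M"
proof -
  note [measurable] = assms path_component_measurable[OF _ assms]
  have "(\<lambda>x. \<Prod>i\<le>m. bm_transition (t (Suc i) - t i) (((h x)(0 := f x, Suc m := g x)) i)
     (((h x)(0 := f x, Suc m := g x)) (Suc i))) \<in> borel_measurable M"
    by (intro borel_measurable_prod bm_transition_measurable path_component_measurable assms) auto
  then show ?thesis unfolding Let_def by measurable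
qed

text \<open>Density times weights is a product of modified kernels, which collapses to the modified
  kernel of duration 1; division by \<open>bm_transition 1 a b\<close> leaves the weight alone. The
  value is the same for every grid.\<close>

lemma nn_integral_brownian_bridge_fdd:
  fixes a b :: "real ^ 'N"
  assumes w: "semigroup_weight w" and t: "time_grid m t"
  shows "(\<integral>\<^sup>+q. (let p = q(0 := a, Suc m := b) in
              ennreal (\<Prod>i\<le>m. w (t (Suc i) - t i) (p i $ k) (p (Suc i) $ k)))
            \<partial>brownian_bridge_fdd m t a b) = w 1 (a $ k) (b $ k)"
proof -
  note [measurable] = semigroup_weight_measurable[OF w]
  have nn: "s > 0 \<Longrightarrow> 0 \<le> w s x y" for s x y
    using w by (auto simp: semigroup_weight_def)
  define \<kappa> where "\<kappa> s a b = ennreal (bm_transition s a b * w s (a $ k) (b $ k))" for s and a b :: "real ^ 'N"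
  have mono: "strict_mono_on {0..Suc m} t" and t01: "t 0 = 0" "t (Suc m) = 1"
    using t by (auto simp: time_grid_def)
  have pos: "i \<le> m \<Longrightarrow> 0 < t (Suc i) - t i" for i
    using mono by (auto simp: strict_mono_on_def)
  let ?p = "\<lambda>q. q(0 := a, Suc m := b)"
  have sets: "sets (Pi\<^sub>M I (\<lambda>_. lborel :: (real ^ 'N) measure)) = sets (Pi\<^sub>M I (\<lambda>_. borel))" for I :: "nat set"
    by (intro sets_PiM_cong) auto
  have comp: "i \<le> Suc m \<Longrightarrow> (\<lambda>q. ?p q i) \<in> borel_measurable (Pi\<^sub>M {1..m} (\<lambda>_. lborel))" for i
    by (intro path_component_measurable) (auto simp: sets cong: measurable_cong_sets)
  have B: "bm_transition 1 a b > 0" by (simp add: bm_transition_pos)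
  have "(\<integral>\<^sup>+q. (let p = q(0 := a, Suc m := b) in
              ennreal (\<Prod>i\<le>m. w (t (Suc i) - t i) (p i $ k) (p (Suc i) $ k)))
            \<partial>brownian_bridge_fdd m t a b)
      = (\<integral>\<^sup>+q. ennreal ((\<Prod>i\<le>m. bm_transition (t (Suc i) - t i) (?p q i) (?p q (Suc i)))
                        / bm_transition 1 a b) *
              ennreal (\<Prod>i\<le>m. w (t (Suc i) - t i) (?p q i $ k) (?p q (Suc i) $ k))
            \<partial>Pi\<^sub>M {1..m} (\<lambda>_. lborel))"
    unfolding brownian_bridge_fdd_def Let_def
  proof (subst nn_integral_density)
    show "(\<lambda>x. ennreal (\<Prod>i\<le>m. w (t (Suc i) - t i) (?p x i $ k) (?p x (Suc i) $ k)))
           \<in> borel_measurable (Pi\<^sub>M {1..m} (\<lambda>_. lborel))"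
      by (intro measurable_compose[OF _ measurable_ennreal] borel_measurable_prod
           semigroup_weight_measurable[OF w] measurable_compose[OF comp borel_measurable_nth]) auto
    show "(\<lambda>x. ennreal ((\<Prod>i\<le>m. bm_transition (t (Suc i) - t i) (?p x i) (?p x (Suc i))) / bm_transition 1 a b))
           \<in> borel_measurable (Pi\<^sub>M {1..m} (\<lambda>_. lborel))"
      using brownian_bridge_density_measurable[of "\<lambda>_. a" _ "\<lambda>_. b" "\<lambda>q. q" m t, unfolded Let_def]
      by (auto simp: sets cong: measurable_cong_sets)
  qed auto
  also have "\<dots> = (\<integral>\<^sup>+q. (\<Prod>i\<le>m. \<kappa> (t (Suc i) - t i) (?p q i) (?p q (Suc i))) * ennreal (1 / bm_transition 1 a b)
            \<partial>Pi\<^sub>M {1..m} (\<lambda>_. lborel))"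
  proof (intro nn_integral_cong)
    fix q
    have 1: "0 \<le> (\<Prod>i\<le>m. bm_transition (t (Suc i) - t i) (?p q i) (?p q (Suc i)))"
      using pos by (intro prod_nonneg) (auto intro!: less_imp_le bm_transition_pos)
    have 2: "0 \<le> (\<Prod>i\<le>m. w (t (Suc i) - t i) (?p q i $ k) (?p q (Suc i) $ k))"
      using pos by (intro prod_nonneg) (auto intro!: nn)
    have "(\<Prod>i\<le>m. \<kappa> (t (Suc i) - t i) (?p q i) (?p q (Suc i)))
      = ennreal ((\<Prod>i\<le>m. bm_transition (t (Suc i) - t i) (?p q i) (?p q (Suc i))) * (\<Prod>i\<le>m. w (t (Suc i) - t i) (?p q i $ k) (?p q (Suc i) $ k)))"
      unfolding \<kappa>_def prod.distrib[symmetric]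
      using pos by (intro prod_ennreal) (auto intro!: mult_nonneg_nonneg less_imp_le[OF bm_transition_pos] nn)
    then show "ennreal ((\<Prod>i\<le>m. bm_transition (t (Suc i) - t i) (?p q i) (?p q (Suc i))) / bm_transition 1 a b)
          * ennreal (\<Prod>i\<le>m. w (t (Suc i) - t i) (?p q i $ k) (?p q (Suc i) $ k))
       = (\<Prod>i\<le>m. \<kappa> (t (Suc i) - t i) (?p q i) (?p q (Suc i))) * ennreal (1 / bm_transition 1 a b)"
      using 1 2 B by (simp add: ennreal_mult[symmetric] del: fun_upd_apply)
  qed
  also have "\<dots> = \<kappa> (t (Suc m) - t 0) a b * ennreal (1 / bm_transition 1 a b)"
  proof (subst nn_integral_multc)
    have 3: "(\<lambda>(a, b). \<kappa> s a b) \<in> borel_measurable (borel \<Otimes>\<^sub>M borel)" for s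
      unfolding \<kappa>_def split_beta' by measurable
    have "(\<lambda>q. \<kappa> s (?p q i) (?p q (Suc i))) \<in> borel_measurable (Pi\<^sub>M {1..m} (\<lambda>_. lborel))" if "i \<le> m" for i s
    proof -
      have [measurable]: "(\<lambda>q. ?p q i) \<in> borel_measurable (Pi\<^sub>M {1..m} (\<lambda>_. lborel))"
        "(\<lambda>q. ?p q (Suc i)) \<in> borel_measurable (Pi\<^sub>M {1..m} (\<lambda>_. lborel))"
        using that comp[of i] comp[of "Suc i"] by (simp_all del: fun_upd_apply)
      show ?thesis unfolding \<kappa>_def
        by (intro measurable_compose[OF _ measurable_ennreal] borel_measurable_times
             semigroup_weight_measurable[OF w] bm_transition_measurable vec_nth_measurable) measurable
    qed
    then show "(\<lambda>q. \<Prod>i\<le>m. \<kappa> (t (Suc i) - t i) (?p q i) (?p q (Suc i))) \<in> borel_measurable (Pi\<^sub>M {1..m} (\<lambda>_. lborel))"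
      by (intro borel_measurable_prod_ennreal) auto
    show "(\<integral>\<^sup>+q. (\<Prod>i\<le>m. \<kappa> (t (Suc i) - t i) (?p q i) (?p q (Suc i))) \<partial>Pi\<^sub>M {1..m} (\<lambda>_. lborel)) * ennreal (1 / bm_transition 1 a b)
      = \<kappa> (t (Suc m) - t 0) a b * ennreal (1 / bm_transition 1 a b)"
    proof (subst nn_integral_path_product[OF 3 _ mono])
      show "(\<integral>\<^sup>+c. \<kappa> s a c * \<kappa> t c b \<partial>lborel) = \<kappa> (s + t) a b" if "s > 0" "t > 0" for s t a b
        unfolding \<kappa>_def by (rule bm_transition_Chapman_Kolmogorov[OF w that])
    qed simp
  qed
  also have "\<dots> = w 1 (a $ k) (b $ k)"
    using B nn[of 1] by (simp add: t01 \<kappa>_def ennreal_mult[symmetric])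
  finally show ?thesis .
qed

lemma prob_space_brownian_bridge_fdd:
  assumes "time_grid m t"
  shows "prob_space (brownian_bridge_fdd m t a b)"
proof
  show "emeasure (brownian_bridge_fdd m t a b) (space (brownian_bridge_fdd m t a b)) = 1"
    using nn_integral_brownian_bridge_fdd[OF semigroup_weight_one assms, where a=a and b=b] by simp
qed

section \<open>The joint law of the spins and the edge values\<close>

lemma finite_lattice_box: "finite (lattice_box n)"
  unfolding lattice_box_def
  by (intro finite_cartesian_product; rule finite_subset[OF _ finite_abs_int_segment[of "real n"]]) auto

lemma box_edges_subset: "box_edges n \<subseteq> lattice_box n \<times> lattice_box n"
  by (auto simp: box_edges_def)

lemma finite_box_edges: "finite (box_edges n)"
  using finite_subset[OF box_edges_subset] finite_lattice_box by auto

lemma linepath_in_cable_graph: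
  assumes "(u, v) \<in> box_edges n" "0 \<le> s" "s \<le> 1"
  shows "linepath u v s \<in> cable_graph n"
  using assms linepath_in_path[of s u v] by (auto simp: cable_graph_def intro!: bexI[of _ "(u, v)"])

lemma time_grid_range:
  assumes "time_grid m t" "i \<in> {0..Suc m}"
  shows "0 \<le> t i" "t i \<le> 1"
proof -
  have mono: "strict_mono_on {0..Suc m} t"
    using assms by (simp add: time_grid_def)
  have "t 0 \<le> t i" "t i \<le> t (Suc m)"
    using assms(2) by (auto intro: strict_mono_on_leD[OF mono])
  then show "0 \<le> t i" "t i \<le> 1" using assms by (auto simp: time_grid_def)
qed

text \<open>The conditional law in the last clause of \<open>cable_spin_field\<close>, named so that
  it can be handled as a Markov kernel.\<close>

definition bridge_kernel ::
  "real \<Rightarrow> nat \<Rightarrow> nat \<Rightarrow> (nat \<Rightarrow> real) \<Rightarrow> (real \<times> real \<Rightarrow> real ^ 'N)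
   \<Rightarrow> ((real \<times> real) \<times> (real \<times> real) \<Rightarrow> nat \<Rightarrow> real ^ 'N) measure" where
  "bridge_kernel \<beta> n m t \<sigma> = Pi\<^sub>M (box_edges n)
     (\<lambda>(u, v). brownian_bridge_fdd m t (sqrt \<beta> *\<^sub>R \<sigma> u) (sqrt \<beta> *\<^sub>R \<sigma> v))"

abbreviation spin_space :: "nat \<Rightarrow> (real \<times> real \<Rightarrow> real ^ 'N) measure" where
  "spin_space n \<equiv> Pi\<^sub>M (lattice_box n) (\<lambda>_. borel)"

abbreviation edge_space :: "nat \<Rightarrow> nat \<Rightarrow> ((real \<times> real) \<times> (real \<times> real) \<Rightarrow> nat \<Rightarrow> real ^ 'N) measure" where
  "edge_space n m \<equiv> Pi\<^sub>M (box_edges n) (\<lambda>_. Pi\<^sub>M {1..m} (\<lambda>_. borel))"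

lemma product_prob_space_bridges:
  assumes "time_grid m t"
  shows "product_prob_space (\<lambda>(u, v). brownian_bridge_fdd m t (sqrt \<beta> *\<^sub>R \<sigma> u) (sqrt \<beta> *\<^sub>R \<sigma> v))"
proof -
  have *: "prob_space (case e of (u, v) \<Rightarrow> brownian_bridge_fdd m t (sqrt \<beta> *\<^sub>R \<sigma> u) (sqrt \<beta> *\<^sub>R \<sigma> v))" for e
    using prob_space_brownian_bridge_fdd[OF assms] by (cases e) auto
  show ?thesis
    unfolding product_prob_space_def product_prob_space_axioms_def product_sigma_finite_def
    using * prob_space_imp_sigma_finite by blast
qed

lemma sets_bridge_kernel: "sets (bridge_kernel \<beta> n m t \<sigma>) = sets (edge_space n m)"
  unfolding bridge_kernel_def
  by (intro sets_PiM_cong) (auto simp: sets_brownian_bridge_fdd)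

lemma spin_component_measurable:
  "v \<in> lattice_box n \<Longrightarrow> (\<lambda>\<sigma>. \<sigma> v) \<in> borel_measurable (spin_space n)"
  by measurable

text \<open>The bridge density is jointly measurable in the endpoints and the path, so its integral
  over \<open>C\<close> is measurable in the endpoints by Tonelli.\<close>

lemma emeasure_brownian_bridge_fdd_measurable:
  fixes f g :: "'a \<Rightarrow> real ^ 'N"
  assumes [measurable]: "f \<in> borel_measurable M" "g \<in> borel_measurable M"
    and C[measurable]: "C \<in> sets (Pi\<^sub>M {1..m} (\<lambda>_. borel))"
  shows "(\<lambda>x. emeasure (brownian_bridge_fdd m t (f x) (g x)) C) \<in> borel_measurable M"
proof -
  interpret product_sigma_finite "\<lambda>_::nat. lborel :: (real ^ 'N) measure" ..
  interpret L: sigma_finite_measure "Pi\<^sub>M {1..m} (\<lambda>_. lborel :: (real ^ 'N) measure)"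
    by (intro sigma_finite) auto
  have sets: "sets (Pi\<^sub>M I (\<lambda>_. lborel :: (real ^ 'N) measure)) = sets (Pi\<^sub>M I (\<lambda>_. borel))" for I :: "nat set"
    by (intro sets_PiM_cong) auto
  let ?d = "\<lambda>x q. let p = q(0 := f x, Suc m := g x)
            in ennreal ((\<Prod>i\<le>m. bm_transition (t (Suc i) - t i) (p i) (p (Suc i))) / bm_transition 1 (f x) (g x))"
  have [measurable]: "(\<lambda>(x, q). ?d x q) \<in> borel_measurable (M \<Otimes>\<^sub>M Pi\<^sub>M {1..m} (\<lambda>_. borel))"
    unfolding split_beta' by (intro brownian_bridge_density_measurable) measurable
  have "(\<lambda>x. \<integral>\<^sup>+q. ?d x q * indicator C q \<partial>Pi\<^sub>M {1..m} (\<lambda>_. lborel)) \<in> borel_measurable M"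
    by (rule L.borel_measurable_nn_integral)
       (subst measurable_cong_sets[OF sets_pair_measure_cong[OF refl sets] refl], measurable)
  also have "(\<lambda>x. \<integral>\<^sup>+q. ?d x q * indicator C q \<partial>Pi\<^sub>M {1..m} (\<lambda>_. lborel))
      = (\<lambda>x. emeasure (brownian_bridge_fdd m t (f x) (g x)) C)"
  proof
    fix x
    have "?d x \<in> borel_measurable (Pi\<^sub>M {1..m} (\<lambda>_. lborel))"
      by (subst measurable_cong_sets[OF sets refl], intro brownian_bridge_density_measurable) measurable
    moreover have "C \<in> sets (Pi\<^sub>M {1..m} (\<lambda>_. lborel))" using C sets by simp
    ultimately show "(\<integral>\<^sup>+q. ?d x q * indicator C q \<partial>Pi\<^sub>M {1..m} (\<lambda>_. lborel)) = emeasure (brownian_bridge_fdd m t (f x) (g x)) C"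
      unfolding brownian_bridge_fdd_def by (subst emeasure_density) auto
  qed
  finally show ?thesis .
qed

text \<open>It is enough to test an intersection-stable generator. On rectangles the kernel is a
  finite product of single-edge probabilities.\<close>

lemma bridge_kernel_measurable:
  assumes t: "time_grid m t"
  shows "(bridge_kernel \<beta> n m t :: (_ \<Rightarrow> real ^ 'N) \<Rightarrow> _) \<in> measurable (spin_space n) (prob_algebra (edge_space n m))"
proof (rule measurable_prob_algebra_generated)
  let ?I = "box_edges n" and ?N = "\<lambda>_. Pi\<^sub>M {1..m} (\<lambda>_. borel :: (real ^ 'N) measure)"
  show "sets (edge_space n m) = sigma_sets (\<Pi>\<^sub>E i\<in>?I. space (?N i)) {Pi\<^sub>E ?I X |X. \<forall>i\<in>?I. X i \<in> sets (?N i)}"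
    unfolding sets_PiM[of ?I] prod_algebra_eq_finite[OF finite_box_edges]
    by (rule arg_cong[where f="sigma_sets _"]) (auto simp: Pi_iff)
  show "Int_stable {Pi\<^sub>E ?I X |X. \<forall>i\<in>?I. X i \<in> sets (?N i)}"
    by (rule Int_stable_PiE)
  show "{Pi\<^sub>E ?I X |X. \<forall>i\<in>?I. X i \<in> sets (?N i)} \<subseteq> Pow (\<Pi>\<^sub>E i\<in>?I. space (?N i))"
    by (auto simp: PiE_iff dest!: sets.sets_into_space)
  fix \<sigma>
  interpret product_prob_space "\<lambda>(u, v). brownian_bridge_fdd m t (sqrt \<beta> *\<^sub>R \<sigma> u) (sqrt \<beta> *\<^sub>R \<sigma> v)" ?I
    using t by (rule product_prob_space_bridges)
  show "prob_space (bridge_kernel \<beta> n m t \<sigma>)"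
    unfolding bridge_kernel_def by (rule P.prob_space_axioms)
  show "sets (bridge_kernel \<beta> n m t \<sigma>) = sets (edge_space n m)"
    by (rule sets_bridge_kernel)
next
  let ?I = "box_edges n" and ?N = "\<lambda>_. Pi\<^sub>M {1..m} (\<lambda>_. borel :: (real ^ 'N) measure)"
  fix A assume "A \<in> {Pi\<^sub>E ?I X |X. \<forall>i\<in>?I. X i \<in> sets (?N i)}"
  then obtain X where A: "A = Pi\<^sub>E ?I X" and X: "\<And>i. i \<in> ?I \<Longrightarrow> X i \<in> sets (Pi\<^sub>M {1..m} (\<lambda>_. borel))"
    by blast
  have "emeasure (bridge_kernel \<beta> n m t \<sigma>) A
      = (\<Prod>e\<in>?I. emeasure (brownian_bridge_fdd m t (sqrt \<beta> *\<^sub>R \<sigma> (fst e)) (sqrt \<beta> *\<^sub>R \<sigma> (snd e))) (X e))" for \<sigma> :: "real \<times> real \<Rightarrow> real ^ 'N"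
  proof -
    interpret product_prob_space "\<lambda>(u, v). brownian_bridge_fdd m t (sqrt \<beta> *\<^sub>R \<sigma> u) (sqrt \<beta> *\<^sub>R \<sigma> v)" ?I
      using t by (rule product_prob_space_bridges)
    show ?thesis
      unfolding bridge_kernel_def A
      by (subst emeasure_PiM) (auto simp: finite_box_edges split_beta' sets_brownian_bridge_fdd X simp del: One_nat_def)
  qed
  moreover have "(\<lambda>\<sigma>. \<Prod>e\<in>?I. emeasure (brownian_bridge_fdd m t (sqrt \<beta> *\<^sub>R \<sigma> (fst e)) (sqrt \<beta> *\<^sub>R \<sigma> (snd e))) (X e))
     \<in> borel_measurable (spin_space n)"
    using box_edges_subset[of n] X
    by (intro borel_measurable_prod_ennreal emeasure_brownian_bridge_fdd_measurable borel_measurable_scaleR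
          spin_component_measurable borel_measurable_const) auto
  ultimately show "(\<lambda>\<sigma>. emeasure (bridge_kernel \<beta> n m t \<sigma>) A) \<in> borel_measurable (spin_space n)"
    by simp
qed

lemma sets_spin_O_model: "sets (spin_O_model \<beta> n :: (_ \<Rightarrow> real ^ 'N) measure) = sets (spin_space n)"
  unfolding spin_O_model_def Let_def by (simp add: sphere_uniform_def cong: sets_PiM_cong)

locale cable_spin =
  fixes M :: "'\<omega> measure" and \<beta> :: real and n :: nat
    and \<theta> \<Phi> :: "'\<omega> \<Rightarrow> real \<times> real \<Rightarrow> real ^ 'N"
  assumes \<beta>: "\<beta> > 0" and n: "n \<ge> 1" and field: "cable_spin_field M \<beta> n \<theta> \<Phi>"
begin

abbreviation "V \<equiv> lattice_box n"
abbreviation "E \<equiv> box_edges n"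
abbreviation "\<mu> \<equiv> spin_O_model \<beta> n :: (real \<times> real \<Rightarrow> real ^ 'N) measure"

sublocale prob_space M
  using field by (simp add: cable_spin_field_def)

lemma \<theta>_measurable [measurable]: "v \<in> V \<Longrightarrow> (\<lambda>\<omega>. \<theta> \<omega> v) \<in> borel_measurable M"
  using field by (simp add: cable_spin_field_def)

lemma \<Phi>_measurable: "z \<in> cable_graph n \<Longrightarrow> (\<lambda>\<omega>. \<Phi> \<omega> z) \<in> borel_measurable M"
  using field by (simp add: cable_spin_field_def)

lemma \<Phi>_continuous: "\<omega> \<in> space M \<Longrightarrow> continuous_on (cable_graph n) (\<Phi> \<omega>)"
  using field by (simp add: cable_spin_field_def)

lemma \<Phi>_vertex: "\<omega> \<in> space M \<Longrightarrow> v \<in> V \<Longrightarrow> \<Phi> \<omega> v = sqrt \<beta> *\<^sub>R \<theta> \<omega> v"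
  using field by (simp add: cable_spin_field_def)

definition "spins \<omega> = restrict (\<theta> \<omega>) V"

lemma spins_measurable [measurable]: "spins \<in> measurable M (spin_space n)"
  unfolding spins_def by (rule measurable_restrict) simp

lemma distr_spins: "distr M (spin_space n) spins = \<mu>"
  using field by (simp add: cable_spin_field_def spins_def[abs_def])

lemma edge_values_measurable:
  assumes "time_grid m t"
  shows "(\<lambda>\<omega>. edge_values n m t (\<Phi> \<omega>)) \<in> measurable M (edge_space n m)"
  unfolding edge_values_def
proof (rule measurable_restrict)
  fix e assume "e \<in> E"
  then show "(\<lambda>\<omega>. case e of (u, v) \<Rightarrow> \<lambda>i\<in>{1..m}. \<Phi> \<omega> (linepath u v (t i))) \<in> measurable M (Pi\<^sub>M {1..m} (\<lambda>_. borel))"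
    by (cases e) (auto simp del: One_nat_def intro!: measurable_restrict \<Phi>_measurable
         linepath_in_cable_graph time_grid_range[OF assms])
qed

lemma prob_space_\<mu>: "prob_space \<mu>"
  unfolding distr_spins[symmetric] by (rule prob_space_distr) simp

text \<open>The definition of the field determines the joint law on products
  \<open>A \<times> C\<close> only; uniqueness of measures extends this to the whole product space,
  hence to all nonnegative integrands.\<close>

lemma nn_integral_spins_edge_values:
  fixes g :: "_ \<Rightarrow> ennreal"
  assumes t: "time_grid m t"
    and g[measurable]: "g \<in> borel_measurable (spin_space n \<Otimes>\<^sub>M edge_space n m)"
  shows "(\<integral>\<^sup>+\<omega>. g (spins \<omega>, edge_values n m t (\<Phi> \<omega>)) \<partial>M)
       = (\<integral>\<^sup>+\<sigma>. (\<integral>\<^sup>+q. g (\<sigma>, q) \<partial>bridge_kernel \<beta> n m t \<sigma>) \<partial>\<mu>)"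
proof -
  let ?B = "spin_space n :: (real \<times> real \<Rightarrow> real ^ 'N) measure"
  let ?N = "edge_space n m :: (_ \<Rightarrow> nat \<Rightarrow> real ^ 'N) measure"
  let ?K = "bridge_kernel \<beta> n m t :: (real \<times> real \<Rightarrow> real ^ 'N) \<Rightarrow> _"
  let ?J = "\<lambda>\<sigma>. distr (?K \<sigma>) (?B \<Otimes>\<^sub>M ?N) (Pair \<sigma>)"
  note [measurable] = edge_values_measurable[OF t] and One_nat_def[simp del]
  interpret \<mu>: prob_space \<mu> by (rule prob_space_\<mu>)
  have space_\<mu>: "space \<mu> = space ?B" using sets_spin_O_model by (rule sets_eq_imp_space_eq)
  have K: "?K \<in> measurable ?B (subprob_algebra ?N)"
    using bridge_kernel_measurable[OF t] by (rule measurable_prob_algebraD)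
  have J: "?J \<in> measurable \<mu> (subprob_algebra (?B \<Otimes>\<^sub>M ?N))"
    unfolding measurable_cong_sets[OF sets_spin_O_model refl]
    by (rule measurable_distr2[OF _ K]) simp
  have PairM: "Pair \<sigma> \<in> measurable (?K \<sigma>) (?B \<Otimes>\<^sub>M ?N)" if "\<sigma> \<in> space \<mu>" for \<sigma>
    using that unfolding measurable_cong_sets[OF sets_bridge_kernel refl] space_\<mu> by measurable
  have "distr M (?B \<Otimes>\<^sub>M ?N) (\<lambda>\<omega>. (spins \<omega>, edge_values n m t (\<Phi> \<omega>))) = \<mu> \<bind> ?J"
  \<comment> \<open>The law has finite mass, so the constant sequence of whole spaces serves as the
    exhaustion.\<close>
  proof (rule measure_eqI_generator_eq[where E="{a \<times> b |a b. a \<in> sets ?B \<and> b \<in> sets ?N}"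
        and \<Omega>="space ?B \<times> space ?N" and A="\<lambda>_. space ?B \<times> space ?N"])
    fix X assume "X \<in> {a \<times> b |a b. a \<in> sets ?B \<and> b \<in> sets ?N}"
    then obtain A C where X: "X = A \<times> C" and [measurable]: "A \<in> sets ?B" "C \<in> sets ?N" by blast
    have "emeasure (distr M (?B \<Otimes>\<^sub>M ?N) (\<lambda>\<omega>. (spins \<omega>, edge_values n m t (\<Phi> \<omega>)))) X
        = emeasure M {\<omega> \<in> space M. spins \<omega> \<in> A \<and> edge_values n m t (\<Phi> \<omega>) \<in> C}"
      unfolding X by (subst emeasure_distr) (auto intro!: arg_cong[where f="emeasure M"])
    also have "\<dots> = (\<integral>\<^sup>+ \<sigma>. indicator A \<sigma> * emeasure (?K \<sigma>) C \<partial>\<mu>)"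
      using field t \<open>A \<in> sets ?B\<close> \<open>C \<in> sets ?N\<close>
      unfolding cable_spin_field_def spins_def bridge_kernel_def by blast
    also have "\<dots> = (\<integral>\<^sup>+ \<sigma>. emeasure (?J \<sigma>) X \<partial>\<mu>)"
    proof (intro nn_integral_cong)
      fix \<sigma> assume \<sigma>: "\<sigma> \<in> space \<mu>"
      have "emeasure (?J \<sigma>) X = emeasure (?K \<sigma>) (Pair \<sigma> -` X \<inter> space (?K \<sigma>))"
        unfolding X by (rule emeasure_distr[OF PairM[OF \<sigma>]]) measurable
      also have "Pair \<sigma> -` X \<inter> space (?K \<sigma>) = (if \<sigma> \<in> A then C else {})"
        using sets.sets_into_space[OF \<open>C \<in> sets ?N\<close>] sets_eq_imp_space_eq[OF sets_bridge_kernel, of \<beta> n m t \<sigma>]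
        by (auto simp: X)
      finally show "indicator A \<sigma> * emeasure (?K \<sigma>) C = emeasure (?J \<sigma>) X" by simp
    qed
    also have "\<dots> = emeasure (\<mu> \<bind> ?J) X"
      by (rule emeasure_bind[OF \<mu>.not_empty J, symmetric]) (simp add: X)
    finally show "emeasure (distr M (?B \<Otimes>\<^sub>M ?N) (\<lambda>\<omega>. (spins \<omega>, edge_values n m t (\<Phi> \<omega>)))) X = emeasure (\<mu> \<bind> ?J) X" .
  next
    show "sets (\<mu> \<bind> ?J) = sigma_sets (space ?B \<times> space ?N) {a \<times> b |a b. a \<in> sets ?B \<and> b \<in> sets ?N}"
      using sets_bind[OF sets_kernel[OF J] \<mu>.not_empty] by (simp add: sets_pair_measure)
    show "emeasure (distr M (?B \<Otimes>\<^sub>M ?N) (\<lambda>\<omega>. (spins \<omega>, edge_values n m t (\<Phi> \<omega>)))) (space ?B \<times> space ?N) \<noteq> \<infinity>" for i :: nat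
      by (subst emeasure_distr) auto
  qed (auto simp: sets_pair_measure intro!: Int_stable_pair_measure_generator dest: sets.sets_into_space)
  then have "(\<integral>\<^sup>+z. g z \<partial>distr M (?B \<Otimes>\<^sub>M ?N) (\<lambda>\<omega>. (spins \<omega>, edge_values n m t (\<Phi> \<omega>)))) = (\<integral>\<^sup>+z. g z \<partial>(\<mu> \<bind> ?J))"
    by simp
  also have "\<dots> = (\<integral>\<^sup>+\<sigma>. \<integral>\<^sup>+z. g z \<partial>?J \<sigma> \<partial>\<mu>)"
    by (rule nn_integral_bind[OF g J])
  also have "\<dots> = (\<integral>\<^sup>+\<sigma>. (\<integral>\<^sup>+q. g (\<sigma>, q) \<partial>?K \<sigma>) \<partial>\<mu>)"
    by (intro nn_integral_cong nn_integral_distr PairM) simp_all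
  finally show ?thesis by (subst (asm) nn_integral_distr) auto
qed

end

section \<open>The law of the open edges\<close>

text \<open>\<open>m\<close> counts the interior points, so there are \<open>m + 1\<close> steps.
  These grids are not nested; limits in \<open>m\<close> rest on continuity of the path, not on
  monotonicity.\<close>

definition uniform_grid :: "nat \<Rightarrow> nat \<Rightarrow> real" where
  "uniform_grid m i = real i / real (Suc m)"

text \<open>Conditional probability, given the values \<open>p\<close> on the grid, that a real path
  stays above \<open>\<epsilon>\<close> (\<open>\<tau> = 1\<close>) or below
  \<open>- \<epsilon>\<close> (\<open>\<tau> = -1\<close>): each step is then a bridge of duration
  \<open>1 / (m + 1)\<close>, independent of the others.\<close>

definition grid_survival :: "real \<Rightarrow> nat \<Rightarrow> (nat \<Rightarrow> real) \<Rightarrow> real" where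
  "grid_survival \<epsilon> m p =
     (\<Sum>\<tau>\<in>{-1, 1}. \<Prod>i\<le>m. survival (1 / real (Suc m)) (\<tau> * p i - \<epsilon>) (\<tau> * p (Suc i) - \<epsilon>))"

definition edge_survival :: "real \<Rightarrow> real \<Rightarrow> real \<Rightarrow> real" where
  "edge_survival \<epsilon> a b = (\<Sum>\<tau>\<in>{-1, 1}. survival 1 (\<tau> * a - \<epsilon>) (\<tau> * b - \<epsilon>))"

lemma time_grid_uniform: "time_grid m (uniform_grid m)"
  by (auto simp: time_grid_def uniform_grid_def strict_mono_on_def divide_strict_right_mono)

lemma uniform_grid_diff: "uniform_grid m (Suc i) - uniform_grid m i = 1 / real (Suc m)"
  by (simp add: uniform_grid_def diff_divide_distrib[symmetric])

lemma uniform_grid_range: "i \<le> Suc m \<Longrightarrow> uniform_grid m i \<in> {0..1}"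
  using time_grid_range[OF time_grid_uniform, of i m] by auto

lemma survival_prod_bounds:
  assumes "\<And>i. s i > 0"
  shows "0 \<le> (\<Prod>i\<le>m::nat. survival (s i) (a i) (b i))" "(\<Prod>i\<le>m. survival (s i) (a i) (b i)) \<le> 1"
  using assms by (auto intro!: prod_nonneg prod_le_1 simp: survival_bounds)

text \<open>For \<open>\<epsilon> \<ge> 0\<close> the starting value \<open>p 0\<close> cannot lie
  on both sides, so at most one of the two products is nonzero.\<close>

lemma grid_survival_bounds:
  assumes "\<epsilon> \<ge> 0"
  shows "0 \<le> grid_survival \<epsilon> m p" "grid_survival \<epsilon> m p \<le> 1"
proof -
  define P where "P \<tau> = (\<Prod>i\<le>m. survival (1 / real (Suc m)) (\<tau> * p i - \<epsilon>) (\<tau> * p (Suc i) - \<epsilon>))" for \<tau>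
  have P: "0 \<le> P \<tau>" "P \<tau> \<le> 1" for \<tau>
    unfolding P_def by (intro survival_prod_bounds; simp)+
  have P0: "P \<tau> = 0" if "\<tau> * p 0 \<le> \<epsilon>" for \<tau>
    unfolding P_def using that by (intro prod_zero) (auto intro!: bexI[of _ 0] survival_eq_0)
  have "P (- 1) = 0 \<or> P 1 = 0"
    using assms P0[of 1] P0[of "-1"] by fastforce
  with P[of 1] P[of "-1"] show "0 \<le> grid_survival \<epsilon> m p" "grid_survival \<epsilon> m p \<le> 1"
    unfolding grid_survival_def P_def[symmetric] by auto
qed

lemma edge_survival_bounds:
  assumes "\<epsilon> \<ge> 0"
  shows "0 \<le> edge_survival \<epsilon> a b" "edge_survival \<epsilon> a b \<le> 1"
  \<comment> \<open>A single step: \<open>m = 0\<close> with grid values \<open>a\<close> and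
    \<open>b\<close>.\<close>
  using grid_survival_bounds[OF assms, of 0 "case_nat a (\<lambda>_. b)"]
  by (auto simp: edge_survival_def grid_survival_def)

lemma edge_survival_measurable [measurable]:
  assumes [measurable]: "f \<in> borel_measurable M" "g \<in> borel_measurable M"
  shows "(\<lambda>x. edge_survival \<epsilon> (f x) (g x)) \<in> borel_measurable M"
  unfolding edge_survival_def by measurable

lemma edge_survival_tendsto: "(\<lambda>j. edge_survival (inverse (real (Suc j))) a b) \<longlonglongrightarrow> edge_survival 0 a b"
  unfolding edge_survival_def survival_def
  by (intro tendsto_sum tendsto_diff tendsto_exp tendsto_minus tendsto_divide tendsto_mult tendsto_max
        tendsto_const LIMSEQ_inverse_real_of_nat) auto

lemma eventually_near_grid_point:
  assumes "z \<in> {0..1}" "\<delta> > 0"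
  shows "\<forall>\<^sub>F m in sequentially. \<exists>i\<le>Suc m. \<bar>uniform_grid m i - z\<bar> < \<delta>"
proof -
  have "\<forall>\<^sub>F m in sequentially. inverse (real (Suc m)) < \<delta>"
    using assms(2) LIMSEQ_inverse_real_of_nat by (rule order_tendstoD(2)[rotated])
  then show ?thesis
  proof eventually_elim
    case (elim m)
    define i where "i = nat \<lfloor>z * real (Suc m)\<rfloor>"
    have i: "real i \<le> z * real (Suc m)" "z * real (Suc m) < real i + 1"
      using assms(1) unfolding i_def by (auto simp: of_nat_nat)
    have "z * real (Suc m) \<le> 1 * real (Suc m)"
      using assms(1) by (intro mult_right_mono) auto
    from order_trans[OF i(1) this] have "real i \<le> real (Suc m)" by simp
    then have "i \<le> Suc m" by simp
    moreover have "uniform_grid m i \<le> z" "z < uniform_grid m i + inverse (real (Suc m))"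
      using i by (auto simp: uniform_grid_def field_simps)
    with elim have "\<bar>uniform_grid m i - z\<bar> < \<delta>" by simp
    ultimately show ?case by blast
  qed
qed

text \<open>Near a zero the path is smaller than \<open>\<epsilon>\<close> in absolute value, and a
  fine grid has a point there; it kills a factor on either side.\<close>

lemma grid_survival_eventually_0:
  assumes f: "continuous_on {0..1} f" and z: "z \<in> {0..1}" "f z = 0" and "\<epsilon> > 0"
  shows "\<forall>\<^sub>F m in sequentially. grid_survival \<epsilon> m (\<lambda>i. f (uniform_grid m i)) = 0"
proof -
  obtain \<delta> where \<delta>: "\<delta> > 0" "\<And>s. s \<in> {0..1} \<Longrightarrow> dist s z < \<delta> \<Longrightarrow> dist (f s) (f z) < \<epsilon>"
    using f z \<open>\<epsilon> > 0\<close> unfolding continuous_on_iff by metis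
  from eventually_near_grid_point[OF z(1) \<delta>(1)] show ?thesis
  proof eventually_elim
    case (elim m)
    then obtain i where i: "i \<le> Suc m" "\<bar>uniform_grid m i - z\<bar> < \<delta>" by blast
    let ?p = "\<lambda>i. f (uniform_grid m i)"
    have "\<bar>?p i\<bar> < \<epsilon>"
      using \<delta>(2)[OF uniform_grid_range[OF i(1)]] i(2) z(2) by (simp add: dist_real_def)
    then have small: "\<tau> * ?p i - \<epsilon> \<le> 0" if "\<tau> \<in> {-1, 1}" for \<tau>
      using that by auto
    \<comment> \<open>A grid point is the left end of a step, except the last one, which is only a
      right end.\<close>
    obtain j where j: "j \<le> m" "i = j \<or> i = Suc j"
      using i(1) by (cases i) auto
    have "survival (1 / real (Suc m)) (\<tau> * ?p j - \<epsilon>) (\<tau> * ?p (Suc j) - \<epsilon>) = 0" if "\<tau> \<in> {-1, 1}" for \<tau>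
      using small[OF that] j(2) by (intro survival_eq_0) auto
    then have "(\<Prod>i\<le>m. survival (1 / real (Suc m)) (\<tau> * ?p i - \<epsilon>) (\<tau> * ?p (Suc i) - \<epsilon>)) = 0"
      if "\<tau> \<in> {-1, 1}" for \<tau>
      using that j(1) by (intro prod_zero) auto
    then show ?case
      unfolding grid_survival_def by (intro sum.neutral) blast
  qed
qed

text \<open>The intermediate value theorem fixes the sign, and the minimum attained on the compact
  interval provides \<open>\<delta>\<close>.\<close>

lemma nonzero_continuous_bounded_away:
  fixes f :: "real \<Rightarrow> real"
  assumes f: "continuous_on {0..1} f" and nz: "\<And>z. z \<in> {0..1} \<Longrightarrow> f z \<noteq> 0"
  obtains \<tau> \<delta> where "\<tau> \<in> {-1, 1}" "\<delta> > 0" "\<And>z. z \<in> {0..1} \<Longrightarrow> \<delta> \<le> \<tau> * f z"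
proof -
  have "f 0 \<noteq> 0" using nz[of 0] by simp
  define \<tau> where "\<tau> = sgn (f 0)"
  have \<tau>: "\<tau> \<in> {-1, 1}" "\<tau> * f 0 > 0"
    using \<open>f 0 \<noteq> 0\<close> by (auto simp: \<tau>_def sgn_real_def)
  have cont: "continuous_on {0..1} (\<lambda>z. \<tau> * f z)"
    by (intro continuous_intros f)
  obtain z0 where z0: "z0 \<in> {0..1}" "\<And>z. z \<in> {0..1} \<Longrightarrow> \<tau> * f z0 \<le> \<tau> * f z"
    using continuous_attains_inf[OF _ _ cont] by auto
  have "\<tau> * f z0 > 0"
  proof (rule ccontr)
    assume "\<not> \<tau> * f z0 > 0"
    then have "\<exists>x\<ge>0. x \<le> z0 \<and> \<tau> * f x = 0"
      using \<tau>(2) z0(1) by (intro IVT2' continuous_on_subset[OF cont]) auto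
    then show False using nz z0(1) \<tau> by auto
  qed
  then show ?thesis using \<tau>(1) z0(2) that by blast
qed

text \<open>Away from 0 each of the \<open>m + 1\<close> factors differs from 1 by an amount
  exponentially small in \<open>m\<close>, so Bernoulli's inequality controls the product.\<close>

lemma grid_survival_tendsto_1:
  fixes f :: "real \<Rightarrow> real"
  assumes f: "continuous_on {0..1} f" and nz: "\<And>z. z \<in> {0..1} \<Longrightarrow> f z \<noteq> 0"
  shows "(\<lambda>m. grid_survival 0 m (\<lambda>i. f (uniform_grid m i))) \<longlonglongrightarrow> 1"
proof -
  obtain \<tau> \<delta> where \<tau>: "\<tau> \<in> {-1, 1}" and \<delta>: "\<delta> > 0" "\<And>z. z \<in> {0..1} \<Longrightarrow> \<delta> \<le> \<tau> * f z"
    using nonzero_continuous_bounded_away[OF f nz] by blast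
  \<comment> \<open>The exponent of \<open>survival\<close> is 2 a b / s, with both ends at least
    \<open>\<delta>\<close> and \<open>s = 1 / (m + 1)\<close>.\<close>
  define c where "c = 2 * \<delta> * \<delta>"
  have "c > 0" using \<delta> by (simp add: c_def)
  have lower: "1 - real (Suc m) * exp (- (c * real (Suc m))) \<le> grid_survival 0 m (\<lambda>i. f (uniform_grid m i))" for m
  proof -
    let ?p = "\<lambda>i. f (uniform_grid m i)" and ?q = "1 - exp (- (c * real (Suc m)))"
    have p: "\<delta> \<le> \<tau> * ?p i" if "i \<le> Suc m" for i
      using \<delta>(2)[OF uniform_grid_range[OF that]] .
    have q: "0 \<le> ?q" using \<open>c > 0\<close> by simp
    have "?q \<le> survival (1 / real (Suc m)) (\<tau> * ?p i - 0) (\<tau> * ?p (Suc i) - 0)" if "i \<le> m" for i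
    proof -
      have "\<delta> * \<delta> \<le> (\<tau> * ?p i) * (\<tau> * ?p (Suc i))"
        using p[of i] p[of "Suc i"] that \<delta>(1) by (intro mult_mono) auto
      then have "c * real (Suc m) \<le> 2 * ((\<tau> * ?p i) * (\<tau> * ?p (Suc i))) * real (Suc m)"
        unfolding c_def by (intro mult_right_mono) auto
      moreover have "max (\<tau> * ?p i) 0 = \<tau> * ?p i" "max (\<tau> * ?p (Suc i)) 0 = \<tau> * ?p (Suc i)"
        using p[of i] p[of "Suc i"] that \<delta>(1) by auto
      ultimately show ?thesis by (simp add: survival_def mult_ac)
    qed
    then have "(\<Prod>i\<le>m. ?q) \<le> (\<Prod>i\<le>m. survival (1 / real (Suc m)) (\<tau> * ?p i - 0) (\<tau> * ?p (Suc i) - 0))"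
      using q by (intro prod_mono) auto
    also have "\<dots> \<le> grid_survival 0 m ?p"
      unfolding grid_survival_def
      by (rule member_le_sum[OF \<tau>]) (auto intro!: survival_prod_bounds)
    finally have "?q ^ Suc m \<le> grid_survival 0 m ?p" by simp
    moreover have "1 + real (Suc m) * (- exp (- (c * real (Suc m)))) \<le> (1 + - exp (- (c * real (Suc m)))) ^ Suc m"
      using \<open>c > 0\<close> by (intro Bernoulli_inequality) simp
    ultimately show ?thesis by simp
  qed
  have "(\<lambda>m. 1 - real (Suc m) * exp (- (c * real (Suc m)))) \<longlonglongrightarrow> 1"
    using \<open>c > 0\<close> by real_asymp
  then show ?thesis
    by (rule tendsto_sandwich[rotated 2, OF _ tendsto_const])
       (auto intro!: always_eventually grid_survival_bounds simp del: of_nat_Suc simp: lower)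
qed

section \<open>Open edges of the random field\<close>

context cable_spin
begin

definition edge_path :: "'N \<Rightarrow> (real \<times> real) \<times> (real \<times> real) \<Rightarrow> '\<omega> \<Rightarrow> real \<Rightarrow> real" where
  "edge_path k e \<omega> s = \<Phi> \<omega> (linepath (fst e) (snd e) s) $ k"

definition edge_open :: "'N \<Rightarrow> '\<omega> \<Rightarrow> (real \<times> real) \<times> (real \<times> real) \<Rightarrow> bool" where
  "edge_open k \<omega> e \<longleftrightarrow> (\<forall>s\<in>{0..1}. edge_path k e \<omega> s \<noteq> 0)"

lemma edge_path_measurable:
  "e \<in> E \<Longrightarrow> s \<in> {0..1} \<Longrightarrow> (\<lambda>\<omega>. edge_path k e \<omega> s) \<in> borel_measurable M"
  unfolding edge_path_def
  by (intro vec_nth_measurable \<Phi>_measurable linepath_in_cable_graph) auto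

lemma edge_path_continuous:
  assumes "e \<in> E" "\<omega> \<in> space M"
  shows "continuous_on {0..1} (edge_path k e \<omega>)"
proof -
  have "continuous_on {0..1} (\<lambda>s. \<Phi> \<omega> (linepath (fst e) (snd e) s))"
    using assms by (intro continuous_on_compose2[OF \<Phi>_continuous continuous_on_linepath])
       (auto intro!: linepath_in_cable_graph)
  then show ?thesis
    unfolding edge_path_def[abs_def] by (intro continuous_on_component)
qed

lemma edge_path_endpoints:
  assumes "e \<in> E" "\<omega> \<in> space M"
  shows "edge_path k e \<omega> 0 = sqrt \<beta> * spins \<omega> (fst e) $ k" "edge_path k e \<omega> 1 = sqrt \<beta> * spins \<omega> (snd e) $ k"
proof -
  have "fst e \<in> V" "snd e \<in> V" using assms(1) box_edges_subset[of n] by auto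
  then show "edge_path k e \<omega> 0 = sqrt \<beta> * spins \<omega> (fst e) $ k" "edge_path k e \<omega> 1 = sqrt \<beta> * spins \<omega> (snd e) $ k"
    using \<Phi>_vertex[OF assms(2)] by (simp_all add: edge_path_def linepath_0' linepath_1' spins_def)
qed

text \<open>Replaces the uncountable quantifier over the edge by countable ones, for measurability.
  A path without zeros is bounded away from 0, and a uniform bound on all grids passes to the whole
  edge by continuity.\<close>

lemma edge_open_iff:
  assumes "e \<in> E" "\<omega> \<in> space M"
  shows "edge_open k \<omega> e \<longleftrightarrow> (\<exists>j. \<forall>m. \<forall>i\<in>{..Suc m}. inverse (real (Suc j)) \<le> \<bar>edge_path k e \<omega> (uniform_grid m i)\<bar>)"
    (is "_ \<longleftrightarrow> ?R")
proof
  assume "edge_open k \<omega> e"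
  then obtain \<tau> \<delta> where \<tau>: "\<tau> \<in> {-1, 1}" and \<delta>: "\<delta> > 0" "\<And>z. z \<in> {0..1} \<Longrightarrow> \<delta> \<le> \<tau> * edge_path k e \<omega> z"
    using nonzero_continuous_bounded_away[OF edge_path_continuous[OF assms, of k]]
    unfolding edge_open_def by metis
  obtain j where "inverse (real (Suc j)) < \<delta>" using reals_Archimedean[OF \<delta>(1)] by blast
  have "inverse (real (Suc j)) \<le> \<bar>edge_path k e \<omega> (uniform_grid m i)\<bar>" if "i \<in> {..Suc m}" for m i
  proof -
    have "\<delta> \<le> \<tau> * edge_path k e \<omega> (uniform_grid m i)"
      using that by (intro \<delta>(2) uniform_grid_range) auto
    with \<open>inverse (real (Suc j)) < \<delta>\<close> \<tau> show ?thesis by auto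
  qed
  then show ?R by blast
next
  assume ?R
  then obtain j where j: "\<And>m i. i \<le> Suc m \<Longrightarrow> inverse (real (Suc j)) \<le> \<bar>edge_path k e \<omega> (uniform_grid m i)\<bar>"
    by auto
  show "edge_open k \<omega> e"
    unfolding edge_open_def
  proof (intro ballI notI)
    fix z :: real assume z: "z \<in> {0..1}" "edge_path k e \<omega> z = 0"
    have "inverse (real (Suc j)) > 0" by simp
    then obtain \<delta> where \<delta>: "\<delta> > 0" "\<And>s. s \<in> {0..1} \<Longrightarrow> dist s z < \<delta> \<Longrightarrow> dist (edge_path k e \<omega> s) (edge_path k e \<omega> z) < inverse (real (Suc j))"
      using edge_path_continuous[OF assms, of k] z(1) unfolding continuous_on_iff by metis
    from eventually_happens[OF eventually_near_grid_point[OF z(1) \<delta>(1)]]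
    obtain m i where i: "i \<le> Suc m" "\<bar>uniform_grid m i - z\<bar> < \<delta>" by auto
    with \<delta>(2)[OF uniform_grid_range[OF i(1)]] j[OF i(1)] z(2) show False
      by (simp add: dist_real_def)
  qed
qed

lemma edge_open_measurable [measurable]:
  assumes "e \<in> E"
  shows "Measurable.pred M (\<lambda>\<omega>. edge_open k \<omega> e)"
proof -
  have "Measurable.pred M (\<lambda>\<omega>. \<exists>j. \<forall>m. \<forall>i\<in>{..Suc m}. inverse (real (Suc j)) \<le> \<bar>edge_path k e \<omega> (uniform_grid m i)\<bar>)"
  proof (intro pred_intros_countable pred_intros_finite)
    fix j m i assume "i \<in> {..Suc m}"
    then have [measurable]: "(\<lambda>\<omega>. edge_path k e \<omega> (uniform_grid m i)) \<in> borel_measurable M"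
      using assms by (intro edge_path_measurable uniform_grid_range) auto
    show "Measurable.pred M (\<lambda>\<omega>. inverse (real (Suc j)) \<le> \<bar>edge_path k e \<omega> (uniform_grid m i)\<bar>)"
      by measurable
  qed simp
  also have "?this \<longleftrightarrow> ?thesis"
    using assms by (intro measurable_cong) (simp add: edge_open_iff)
  finally show ?thesis .
qed

end

lemma grid_survival_cong:
  assumes "\<And>i. i \<le> Suc m \<Longrightarrow> p i = q i"
  shows "grid_survival \<epsilon> m p = grid_survival \<epsilon> m q"
  unfolding grid_survival_def using assms by (intro sum.cong prod.cong) auto

lemma grid_survival_measurable:
  assumes "\<And>i. i \<le> Suc m \<Longrightarrow> (\<lambda>x. p x i) \<in> borel_measurable M"
  shows "(\<lambda>x. grid_survival \<epsilon> m (p x)) \<in> borel_measurable M"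
  unfolding grid_survival_def using assms
  by (intro borel_measurable_sum borel_measurable_prod survival_measurable
        borel_measurable_diff borel_measurable_times borel_measurable_const) auto

text \<open>Tower property: averaging the conditional survival probability over the grid values
  gives the survival probability of the whole bridge, exactly and for every
  \<open>m\<close>.\<close>

lemma nn_integral_bridge_grid_survival:
  fixes a b :: "real ^ 'N"
  shows "(\<integral>\<^sup>+q. ennreal (grid_survival \<epsilon> m (\<lambda>i. (q(0 := a, Suc m := b)) i $ k))
            \<partial>brownian_bridge_fdd m (uniform_grid m) a b) = edge_survival \<epsilon> (a $ k) (b $ k)"
proof -
  let ?B = "brownian_bridge_fdd m (uniform_grid m) a b"
  let ?p = "\<lambda>q i. (q(0 := a, Suc m := b)) i $ k"
  let ?P = "\<lambda>\<tau> q. \<Prod>i\<le>m. survival (1 / real (Suc m)) (\<tau> * ?p q i - \<epsilon>) (\<tau> * ?p q (Suc i) - \<epsilon>)"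
  have nn: "0 \<le> ?P \<tau> q" for \<tau> q
    by (intro prod_nonneg ballI survival_bounds) simp
  have comp: "(\<lambda>q. ?p q i) \<in> borel_measurable ?B" if "i \<le> Suc m" for i
    unfolding measurable_cong_sets[OF sets_brownian_bridge_fdd refl]
    using that by (intro vec_nth_measurable path_component_measurable) auto
  have meas: "(\<lambda>q. ennreal (?P \<tau> q)) \<in> borel_measurable ?B" for \<tau>
    by (intro measurable_compose[OF _ measurable_ennreal] borel_measurable_prod survival_measurable
        borel_measurable_diff borel_measurable_times borel_measurable_const comp) auto
  have one: "(\<integral>\<^sup>+q. ennreal (?P \<tau> q) \<partial>?B) = survival 1 (\<tau> * a $ k - \<epsilon>) (\<tau> * b $ k - \<epsilon>)"
    if "\<tau> \<in> {-1, 1}" for \<tau>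
    by (rule nn_integral_brownian_bridge_fdd[OF semigroup_weight_survival[OF that] time_grid_uniform,
          unfolded Let_def uniform_grid_diff])
  have "(\<integral>\<^sup>+q. ennreal (grid_survival \<epsilon> m (?p q)) \<partial>?B) = (\<integral>\<^sup>+q. (\<Sum>\<tau>\<in>{-1, 1}. ennreal (?P \<tau> q)) \<partial>?B)"
    unfolding grid_survival_def using nn by (subst sum_ennreal) auto
  also have "\<dots> = (\<Sum>\<tau>\<in>{-1, 1}. \<integral>\<^sup>+q. ennreal (?P \<tau> q) \<partial>?B)"
    by (intro nn_integral_sum meas)
  also have "\<dots> = (\<Sum>\<tau>\<in>{-1, 1}. ennreal (survival 1 (\<tau> * a $ k - \<epsilon>) (\<tau> * b $ k - \<epsilon>)))"
    by (intro sum.cong refl one)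
  also have "\<dots> = edge_survival \<epsilon> (a $ k) (b $ k)"
    unfolding edge_survival_def by (subst sum_ennreal) (auto simp: survival_bounds)
  finally show ?thesis .
qed

context cable_spin
begin

abbreviation spin_survival :: "'N \<Rightarrow> real \<Rightarrow> (real \<times> real \<Rightarrow> real ^ 'N) \<Rightarrow> (real \<times> real) \<times> (real \<times> real) \<Rightarrow> real" where
  "spin_survival k \<epsilon> \<sigma> e \<equiv> edge_survival \<epsilon> (sqrt \<beta> * \<sigma> (fst e) $ k) (sqrt \<beta> * \<sigma> (snd e) $ k)"

abbreviation path_survival :: "'N \<Rightarrow> real \<Rightarrow> nat \<Rightarrow> '\<omega> \<Rightarrow> (real \<times> real) \<times> (real \<times> real) \<Rightarrow> real" where
  "path_survival k \<epsilon> m \<omega> e \<equiv> grid_survival \<epsilon> m (\<lambda>i. edge_path k e \<omega> (uniform_grid m i))"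

lemma edge_vertices: "e \<in> E \<Longrightarrow> fst e \<in> V" "e \<in> E \<Longrightarrow> snd e \<in> V"
  using box_edges_subset[of n] by auto

lemma spin_survival_measurable [measurable]:
  "e \<in> E \<Longrightarrow> (\<lambda>\<sigma>. spin_survival k \<epsilon> \<sigma> e) \<in> borel_measurable (spin_space n)"
  by (intro edge_survival_measurable borel_measurable_times borel_measurable_const vec_nth_measurable
      spin_component_measurable edge_vertices)

lemma path_survival_measurable [measurable]:
  "e \<in> E \<Longrightarrow> (\<lambda>\<omega>. path_survival k \<epsilon> m \<omega> e) \<in> borel_measurable M"
  by (intro grid_survival_measurable edge_path_measurable uniform_grid_range)

text \<open>Given the spins the bridges on different edges are independent, so the expectation of
  the product over \<open>F\<close> factorises.\<close>

lemma nn_integral_path_survival: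
  assumes \<epsilon>: "\<epsilon> \<ge> 0" and F: "F \<subseteq> E" and A: "A \<in> sets (spin_space n)"
  shows "(\<integral>\<^sup>+\<omega>. indicator A (spins \<omega>) * ennreal (\<Prod>e\<in>F. path_survival k \<epsilon> m \<omega> e) \<partial>M)
       = (\<integral>\<^sup>+\<sigma>. indicator A \<sigma> * ennreal (\<Prod>e\<in>F. spin_survival k \<epsilon> \<sigma> e) \<partial>\<mu>)"
proof -
  let ?t = "uniform_grid m"
  define p where "p \<sigma> e q i = (q(0 := sqrt \<beta> *\<^sub>R \<sigma> (fst e), Suc m := sqrt \<beta> *\<^sub>R \<sigma> (snd e))) i $ k"
    for \<sigma> :: "real \<times> real \<Rightarrow> real ^ 'N" and e :: "(real \<times> real) \<times> real \<times> real" and q :: "nat \<Rightarrow> real ^ 'N" and i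
  define g where "g = (\<lambda>(\<sigma>, q). indicator A \<sigma> * ennreal (\<Prod>e\<in>F. grid_survival \<epsilon> m (p \<sigma> e (q e))))"
  have comp: "(\<lambda>(\<sigma>, q). p \<sigma> e (q e) i) \<in> borel_measurable (spin_space n \<Otimes>\<^sub>M edge_space n m)"
    if "i \<le> Suc m" "e \<in> E" for i e
  proof -
    have [measurable]: "fst e \<in> V" "snd e \<in> V" "e \<in> E"
      using that edge_vertices by auto
    show ?thesis
      unfolding p_def split_beta' using that(1)
      by (intro vec_nth_measurable path_component_measurable) measurable
  qed
  have G: "(\<lambda>x. grid_survival \<epsilon> m (p (fst x) e (snd x e))) \<in> borel_measurable (spin_space n \<Otimes>\<^sub>M edge_space n m)"
    if "e \<in> E" for e
    using comp[OF _ that] by (intro grid_survival_measurable) (auto simp: split_beta')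
  have [measurable]: "g \<in> borel_measurable (spin_space n \<Otimes>\<^sub>M edge_space n m)"
  proof -
    have [measurable]: "(\<lambda>x. \<Prod>e\<in>F. grid_survival \<epsilon> m (p (fst x) e (snd x e))) \<in> borel_measurable (spin_space n \<Otimes>\<^sub>M edge_space n m)"
      using F by (intro borel_measurable_prod G) auto
    show ?thesis unfolding g_def split_beta' using A by measurable
  qed
  have "(\<integral>\<^sup>+\<omega>. indicator A (spins \<omega>) * ennreal (\<Prod>e\<in>F. path_survival k \<epsilon> m \<omega> e) \<partial>M)
      = (\<integral>\<^sup>+\<omega>. g (spins \<omega>, edge_values n m ?t (\<Phi> \<omega>)) \<partial>M)"
  proof (intro nn_integral_cong)
    fix \<omega> assume \<omega>: "\<omega> \<in> space M"
    have "path_survival k \<epsilon> m \<omega> e = grid_survival \<epsilon> m (p (spins \<omega>) e (edge_values n m ?t (\<Phi> \<omega>) e))" if "e \<in> F" for e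
    proof (rule grid_survival_cong)
      fix i assume "i \<le> Suc m"
      have e: "e \<in> E" using F that by auto
      \<comment> \<open>\<open>edge_values\<close> records interior times only; the two ends of the
        grid are vertices and are read off from the spins.\<close>
      consider "i = 0" | "i = Suc m" | "i \<in> {1..m}" using \<open>i \<le> Suc m\<close> by force
      then show "edge_path k e \<omega> (uniform_grid m i) = p (spins \<omega>) e (edge_values n m ?t (\<Phi> \<omega>) e) i"
      proof cases
        case 1
        then show ?thesis using edge_path_endpoints(1)[OF e \<omega>] by (simp add: uniform_grid_def p_def)
      next
        case 2
        then show ?thesis using edge_path_endpoints(2)[OF e \<omega>] by (simp add: uniform_grid_def p_def)
      next
        case 3
        then show ?thesis using e by (cases e) (auto simp: edge_path_def p_def edge_values_def)
      qed
    qed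
    then show "indicator A (spins \<omega>) * ennreal (\<Prod>e\<in>F. path_survival k \<epsilon> m \<omega> e)
        = g (spins \<omega>, edge_values n m ?t (\<Phi> \<omega>))"
      by (simp add: g_def)
  qed
  also have "\<dots> = (\<integral>\<^sup>+\<sigma>. (\<integral>\<^sup>+q. g (\<sigma>, q) \<partial>bridge_kernel \<beta> n m ?t \<sigma>) \<partial>\<mu>)"
    by (rule nn_integral_spins_edge_values[OF time_grid_uniform]) measurable
  also have "\<dots> = (\<integral>\<^sup>+\<sigma>. indicator A \<sigma> * ennreal (\<Prod>e\<in>F. spin_survival k \<epsilon> \<sigma> e) \<partial>\<mu>)"
  proof (intro nn_integral_cong)
    fix \<sigma> assume "\<sigma> \<in> space \<mu>"
    then have \<sigma>: "\<sigma> \<in> space (spin_space n)" using sets_eq_imp_space_eq[OF sets_spin_O_model] by blast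
    let ?B = "\<lambda>(u, v). brownian_bridge_fdd m ?t (sqrt \<beta> *\<^sub>R \<sigma> u) (sqrt \<beta> *\<^sub>R \<sigma> v)"
    interpret product_prob_space ?B E
      using time_grid_uniform by (rule product_prob_space_bridges)
    \<comment> \<open>The factor 1 outside \<open>F\<close> lets the product run over all edges, as
      the product measure does; these edges integrate to 1.\<close>
    let ?h = "\<lambda>e q. if e \<in> F then ennreal (grid_survival \<epsilon> m (p \<sigma> e q)) else 1"
    have h: "?h e \<in> borel_measurable (?B e)" if "e \<in> E" for e
    proof -
      have "(\<lambda>q. grid_survival \<epsilon> m (p \<sigma> e q)) \<in> borel_measurable (Pi\<^sub>M {1..m} (\<lambda>_. borel))"
        unfolding p_def
        by (intro grid_survival_measurable vec_nth_measurable path_component_measurable) auto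
      then show ?thesis
        by (cases e) (auto simp: measurable_cong_sets[OF sets_brownian_bridge_fdd refl])
    qed
    have nn: "0 \<le> (\<Prod>e\<in>F. grid_survival \<epsilon> m (p \<sigma> e (q e)))" for q
      using \<epsilon> by (intro prod_nonneg) (auto simp: grid_survival_bounds)
    have prod_h: "ennreal (\<Prod>e\<in>F. grid_survival \<epsilon> m (p \<sigma> e (q e))) = (\<Prod>e\<in>E. ?h e (q e))" for q
      using \<epsilon> F finite_box_edges[of n]
      by (subst prod_ennreal[symmetric]) (auto simp: grid_survival_bounds prod.If_cases Int_absorb1)
    have "(\<integral>\<^sup>+q. g (\<sigma>, q) \<partial>bridge_kernel \<beta> n m ?t \<sigma>) = (\<integral>\<^sup>+q. indicator A \<sigma> * (\<Prod>e\<in>E. ?h e (q e)) \<partial>Pi\<^sub>M E ?B)"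
      unfolding g_def bridge_kernel_def by (simp add: prod_h)
    also have "\<dots> = indicator A \<sigma> * (\<integral>\<^sup>+q. (\<Prod>e\<in>E. ?h e (q e)) \<partial>Pi\<^sub>M E ?B)"
      using h by (intro nn_integral_cmult borel_measurable_prod_ennreal
          measurable_compose[OF measurable_component_singleton]) auto
    also have "(\<integral>\<^sup>+q. (\<Prod>e\<in>E. ?h e (q e)) \<partial>Pi\<^sub>M E ?B) = (\<Prod>e\<in>E. \<integral>\<^sup>+q. ?h e q \<partial>?B e)"
      using h finite_box_edges by (intro product_nn_integral_prod) auto
    also have "\<dots> = (\<Prod>e\<in>E. if e \<in> F then ennreal (spin_survival k \<epsilon> \<sigma> e) else 1)"
    proof (intro prod.cong refl)
      fix e assume "e \<in> E"
      have "prob_space (?B e)"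
        using prob_space_brownian_bridge_fdd[OF time_grid_uniform] by (cases e) auto
      then have "emeasure (?B e) (space (?B e)) = 1" by (rule prob_space.emeasure_space_1)
      then show "(\<integral>\<^sup>+q. ?h e q \<partial>?B e) = (if e \<in> F then ennreal (spin_survival k \<epsilon> \<sigma> e) else 1)"
        using nn_integral_bridge_grid_survival[of m "sqrt \<beta> *\<^sub>R \<sigma> (fst e)" "sqrt \<beta> *\<^sub>R \<sigma> (snd e)" \<epsilon> k]
        by (cases e) (auto simp: p_def[abs_def] simp del: fun_upd_apply)
    qed
    also have "\<dots> = ennreal (\<Prod>e\<in>F. spin_survival k \<epsilon> \<sigma> e)"
      using \<epsilon> F finite_box_edges[of n]
      by (subst prod_ennreal[symmetric]) (auto simp: edge_survival_bounds prod.If_cases Int_absorb1)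
    finally show "(\<integral>\<^sup>+q. g (\<sigma>, q) \<partial>bridge_kernel \<beta> n m ?t \<sigma>)
       = indicator A \<sigma> * ennreal (\<Prod>e\<in>F. spin_survival k \<epsilon> \<sigma> e)" .
  qed
  finally show ?thesis .
qed

text \<open>On the event that all edges are open, the grid survival probabilities tend to 1, which gives one
  inequality. A path with a zero is only detected by the grid if it has to keep a distance \<open>\<epsilon> > 0\<close> from
  zero, hence the opposite inequality is obtained for \<open>\<epsilon> > 0\<close> first.\<close>

lemma emeasure_open_edges:
  assumes F: "F \<subseteq> E" and A: "A \<in> sets (spin_space n)"
  shows "emeasure M {\<omega> \<in> space M. spins \<omega> \<in> A \<and> (\<forall>e\<in>F. edge_open k \<omega> e)}
       = (\<integral>\<^sup>+\<sigma>. indicator A \<sigma> * ennreal (\<Prod>e\<in>F. spin_survival k 0 \<sigma> e) \<partial>\<mu>)"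
    (is "emeasure M ?O = ?I 0")
proof (rule antisym)
  have finF: "finite F" using F finite_box_edges finite_subset by blast
  note [measurable] = A
  have [measurable]: "Measurable.pred M (\<lambda>\<omega>. \<forall>e\<in>F. edge_open k \<omega> e)"
    using F finF by (intro pred_intros_finite edge_open_measurable) auto
  have O[measurable]: "?O \<in> sets M" by measurable
  have pm[measurable]: "(\<lambda>\<omega>. \<Prod>e\<in>F. path_survival k \<epsilon> m \<omega> e) \<in> borel_measurable M" for \<epsilon> m
    using F by (intro borel_measurable_prod path_survival_measurable) auto
  let ?g = "\<lambda>\<epsilon> m \<omega>. indicator A (spins \<omega>) * ennreal (\<Prod>e\<in>F. path_survival k \<epsilon> m \<omega> e) :: ennreal"
  have g1: "(\<Prod>e\<in>F. path_survival k \<epsilon> m \<omega> e) \<le> 1" if "\<epsilon> \<ge> 0" for \<epsilon> m \<omega>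
    using that by (intro prod_le_1) (auto simp: grid_survival_bounds)
  have "emeasure M ?O = (\<integral>\<^sup>+\<omega>. indicator ?O \<omega> \<partial>M)" by simp
  \<comment> \<open>Fatou's lemma in \<open>m\<close>, whose integrals all equal
    \<open>?I 0\<close>.\<close>
  also have "\<dots> \<le> (\<integral>\<^sup>+\<omega>. liminf (\<lambda>m. ?g 0 m \<omega>) \<partial>M)"
  proof (intro nn_integral_mono)
    fix \<omega> assume \<omega>: "\<omega> \<in> space M"
    show "indicator ?O \<omega> \<le> liminf (\<lambda>m. ?g 0 m \<omega>)"
    proof (cases "\<omega> \<in> ?O")
      case True
      have "(\<lambda>m. path_survival k 0 m \<omega> e) \<longlonglongrightarrow> 1" if "e \<in> F" for e
        using True that F \<omega> by (intro grid_survival_tendsto_1 edge_path_continuous) (auto simp: edge_open_def)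
      then have "(\<lambda>m. \<Prod>e\<in>F. path_survival k 0 m \<omega> e) \<longlonglongrightarrow> (\<Prod>e\<in>F. 1)"
        by (intro tendsto_prod)
      then have "(\<lambda>m. ?g 0 m \<omega>) \<longlonglongrightarrow> 1"
        using True tendsto_ennrealI by fastforce
      then have "liminf (\<lambda>m. ?g 0 m \<omega>) = 1"
        by (rule lim_imp_Liminf[rotated]) simp
      then show ?thesis by (simp add: indicator_def)
    qed simp
  qed
  also have "\<dots> \<le> liminf (\<lambda>m. \<integral>\<^sup>+\<omega>. ?g 0 m \<omega> \<partial>M)"
    by (intro nn_integral_liminf) measurable
  also have "\<dots> = ?I 0"
    by (subst nn_integral_path_survival[OF _ F A]) (simp_all add: Liminf_const)
  finally show "emeasure M ?O \<le> ?I 0" .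

  have lower: "?I \<epsilon> \<le> emeasure M ?O" if \<epsilon>: "\<epsilon> > 0" for \<epsilon>
  proof -
    \<comment> \<open>The part of the grid expectation that comes from outside \<open>?O\<close>.
      There some edge of \<open>F\<close> has a zero, unless \<open>spins \<omega>\<close> is
      outside \<open>A\<close>, so it vanishes for large \<open>m\<close>.\<close>
    let ?h = "\<lambda>m \<omega>. ?g \<epsilon> m \<omega> * indicator (- ?O) \<omega>"
    have "(\<lambda>m. \<integral>\<^sup>+\<omega>. ?h m \<omega> \<partial>M) \<longlonglongrightarrow> (\<integral>\<^sup>+\<omega>. 0 \<partial>M)"
    proof (rule nn_integral_dominated_convergence[where w="\<lambda>_. 1"])
      show "AE \<omega> in M. (\<lambda>m. ?h m \<omega>) \<longlonglongrightarrow> 0"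
      proof (intro AE_I2)
        fix \<omega> assume \<omega>: "\<omega> \<in> space M"
        show "(\<lambda>m. ?h m \<omega>) \<longlonglongrightarrow> 0"
        proof (cases "spins \<omega> \<in> A \<and> (\<exists>e\<in>F. \<not> edge_open k \<omega> e)")
          case True
          then obtain e s where e: "e \<in> F" "s \<in> {0..1}" "edge_path k e \<omega> s = 0"
            by (auto simp: edge_open_def)
          have "\<forall>\<^sub>F m in sequentially. path_survival k \<epsilon> m \<omega> e = 0"
            using e F \<omega> \<epsilon> by (intro grid_survival_eventually_0[of _ s] edge_path_continuous) auto
          then have "\<forall>\<^sub>F m in sequentially. ?h m \<omega> = 0"
          proof eventually_elim
            case (elim m)
            then have "(\<Prod>e\<in>F. path_survival k \<epsilon> m \<omega> e) = 0"
              using e(1) finF by (intro prod_zero) auto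
            then show ?case by simp
          qed
          then show ?thesis by (rule tendsto_eventually)
        qed (auto simp: indicator_def \<omega>)
      qed
      show "AE \<omega> in M. ?h m \<omega> \<le> 1" for m
        using \<epsilon> by (intro AE_I2) (auto simp: g1 indicator_def)
    qed (auto simp: emeasure_space_1)
    then have lim: "(\<lambda>m. emeasure M ?O + (\<integral>\<^sup>+\<omega>. ?h m \<omega> \<partial>M)) \<longlonglongrightarrow> emeasure M ?O + 0"
      by (intro tendsto_add tendsto_const) simp
    have "?I \<epsilon> \<le> emeasure M ?O + (\<integral>\<^sup>+\<omega>. ?h m \<omega> \<partial>M)" for m
    proof -
      have "?I \<epsilon> = (\<integral>\<^sup>+\<omega>. ?g \<epsilon> m \<omega> \<partial>M)"
        using \<epsilon> by (subst nn_integral_path_survival[OF _ F A]) auto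
      also have "\<dots> \<le> (\<integral>\<^sup>+\<omega>. indicator ?O \<omega> + ?h m \<omega> \<partial>M)"
        using \<epsilon> by (intro nn_integral_mono) (auto simp: g1 indicator_def)
      also have "\<dots> = emeasure M ?O + (\<integral>\<^sup>+\<omega>. ?h m \<omega> \<partial>M)"
        by (subst nn_integral_add) auto
      finally show ?thesis .
    qed
    then show ?thesis using LIMSEQ_le_const[OF lim] by auto
  qed
  \<comment> \<open>Fatou's lemma again, now along \<open>\<epsilon> = 1 / (j + 1)\<close>, where
    the survival probabilities converge pointwise.\<close>
  have "?I 0 \<le> (\<integral>\<^sup>+\<sigma>. liminf (\<lambda>j. indicator A \<sigma> * ennreal (\<Prod>e\<in>F. spin_survival k (inverse (real (Suc j))) \<sigma> e)) \<partial>\<mu>)"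
  proof (intro nn_integral_mono)
    fix \<sigma>
    have "(\<lambda>j. indicator A \<sigma> * ennreal (\<Prod>e\<in>F. spin_survival k (inverse (real (Suc j))) \<sigma> e))
        \<longlonglongrightarrow> indicator A \<sigma> * ennreal (\<Prod>e\<in>F. spin_survival k 0 \<sigma> e)"
      by (intro ennreal_tendsto_cmult tendsto_ennrealI tendsto_prod edge_survival_tendsto) (simp add: indicator_def)
    then show "indicator A \<sigma> * ennreal (\<Prod>e\<in>F. spin_survival k 0 \<sigma> e)
       \<le> liminf (\<lambda>j. indicator A \<sigma> * ennreal (\<Prod>e\<in>F. spin_survival k (inverse (real (Suc j))) \<sigma> e))"
      by (subst lim_imp_Liminf) auto
  qed
  also have "\<dots> \<le> liminf (\<lambda>j. ?I (inverse (real (Suc j))))"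
  proof (intro nn_integral_liminf)
    fix j
    have [measurable]: "(\<lambda>\<sigma>. \<Prod>e\<in>F. spin_survival k (inverse (real (Suc j))) \<sigma> e) \<in> borel_measurable (spin_space n)"
      using F by (intro borel_measurable_prod spin_survival_measurable) auto
    show "(\<lambda>\<sigma>. indicator A \<sigma> * ennreal (\<Prod>e\<in>F. spin_survival k (inverse (real (Suc j))) \<sigma> e)) \<in> borel_measurable \<mu>"
      unfolding measurable_cong_sets[OF sets_spin_O_model refl] by measurable
  qed
  also have "\<dots> \<le> emeasure M ?O"
    by (rule Liminf_le) (auto intro!: always_eventually lower)
  finally show "?I 0 \<le> emeasure M ?O" .
qed

end

section \<open>Invariance of the uniform measure on the sphere\<close>

lemma nn_integral_lborel_translate:
  fixes g :: "'a::euclidean_space \<Rightarrow> ennreal"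
  assumes [measurable]: "g \<in> borel_measurable borel"
  shows "(\<integral>\<^sup>+x. g (t + x) \<partial>lborel) = (\<integral>\<^sup>+x. g x \<partial>lborel)"
proof -
  have "(\<integral>\<^sup>+x. g x \<partial>lborel) = (\<integral>\<^sup>+x. g x \<partial>distr lborel borel ((+) t))"
    by (simp add: lborel_distr_plus)
  then show ?thesis by (simp add: nn_integral_distr)
qed

lemma nn_integral_lborel_reflect:
  fixes g :: "'a::euclidean_space \<Rightarrow> ennreal"
  assumes [measurable]: "g \<in> borel_measurable borel"
  shows "(\<integral>\<^sup>+x. g (t - x) \<partial>lborel) = (\<integral>\<^sup>+x. g x \<partial>lborel)"
proof -
  have "(\<integral>\<^sup>+x. g x \<partial>lborel) = (\<integral>\<^sup>+x. g x \<partial>distr lborel borel (\<lambda>x. t + (- 1) *\<^sub>R x :: 'a))"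
    by (subst lborel_affine[of "- 1" t]) (simp_all add: density_1)
  then show ?thesis by (simp add: nn_integral_distr)
qed

lemma emeasure_unit_ball:
  "emeasure lborel (ball (0::'a::euclidean_space) 1) \<noteq> 0" "emeasure lborel (ball (0::'a) 1) \<noteq> \<infinity>"
proof -
  show "emeasure lborel (ball (0::'a) 1) \<noteq> 0"
    using content_ball_pos[of 1 "0::'a"] unfolding measure_def by auto
  show "emeasure lborel (ball (0::'a) 1) \<noteq> \<infinity>"
    using emeasure_lborel_ball_finite[of "0::'a" 1] by simp
qed

text \<open>The library has this only for well-ordered index types. Here it comes from the uniqueness of
  translation-invariant measures: both sides are compared through their convolution with the unit
  ball, which \<open>f\<close> preserves.\<close>

lemma nn_integral_lborel_orthogonal:
  fixes f :: "'a::euclidean_space \<Rightarrow> 'a"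
  assumes f: "orthogonal_transformation f" and g[measurable]: "g \<in> borel_measurable borel"
  shows "(\<integral>\<^sup>+x. g (f x) \<partial>lborel) = (\<integral>\<^sup>+x. g x \<partial>lborel)"
proof -
  have lin: "linear f" using f by (rule orthogonal_transformation_linear)
  then have [measurable]: "f \<in> borel_measurable borel"
    by (intro borel_measurable_continuous_onI linear_continuous_on) (simp add: linear_linear)
  define h :: "'a \<Rightarrow> ennreal" where "h = indicator (ball 0 1)"
  have [measurable]: "h \<in> borel_measurable borel" unfolding h_def by (intro borel_measurable_indicator) auto
  have hf: "h (f x) = h x" for x
    using orthogonal_transformation_norm[OF f] by (simp add: h_def indicator_def)
  obtain f' where f': "f (f' y) = y" for y
    using orthogonal_transformation_surj[OF f] by (metis surjD)
  \<comment> \<open>The double integral of \<open>g (f x) * h (f x + y)\<close> is evaluated twice.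
    Integrating over \<open>y\<close> first gives this product; for the other value \<open>x\<close>
    is shifted by \<open>- f' y\<close>, after which \<open>y\<close> occurs only in
    \<open>g\<close>.\<close>
  have "(\<integral>\<^sup>+x. g (f x) \<partial>lborel) * (\<integral>\<^sup>+y. h y \<partial>lborel) = (\<integral>\<^sup>+x. g (f x) * (\<integral>\<^sup>+y. h (f x + y) \<partial>lborel) \<partial>lborel)"
    by (simp add: nn_integral_lborel_translate nn_integral_multc)
  also have "\<dots> = (\<integral>\<^sup>+x. (\<integral>\<^sup>+y. g (f x) * h (f x + y) \<partial>lborel) \<partial>lborel)"
    by (simp add: nn_integral_cmult)
  also have "\<dots> = (\<integral>\<^sup>+y. (\<integral>\<^sup>+x. g (f x) * h (f x + y) \<partial>lborel) \<partial>lborel)"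
    by (rule lborel_pair.Fubini') measurable
  also have "\<dots> = (\<integral>\<^sup>+y. (\<integral>\<^sup>+x. g (f x - y) * h (f x) \<partial>lborel) \<partial>lborel)"
  proof (rule nn_integral_cong)
    fix y
    have "(\<integral>\<^sup>+x. g (f x) * h (f x + y) \<partial>lborel) = (\<integral>\<^sup>+x. g (f (- f' y + x)) * h (f (- f' y + x) + y) \<partial>lborel)"
      by (subst nn_integral_lborel_translate[where t="- f' y"]) simp_all
    also have "\<dots> = (\<integral>\<^sup>+x. g (f x - y) * h (f x) \<partial>lborel)"
      by (simp add: linear_add[OF lin] linear_neg[OF lin] linear_diff[OF lin] f')
    finally show "(\<integral>\<^sup>+x. g (f x) * h (f x + y) \<partial>lborel) = (\<integral>\<^sup>+x. g (f x - y) * h (f x) \<partial>lborel)" .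
  qed
  also have "\<dots> = (\<integral>\<^sup>+x. (\<integral>\<^sup>+y. g (f x - y) * h (f x) \<partial>lborel) \<partial>lborel)"
    by (rule lborel_pair.Fubini') measurable
  also have "\<dots> = (\<integral>\<^sup>+x. g x \<partial>lborel) * (\<integral>\<^sup>+y. h y \<partial>lborel)"
    by (simp add: nn_integral_multc nn_integral_lborel_reflect hf nn_integral_cmult)
  finally have "(\<integral>\<^sup>+x. g (f x) \<partial>lborel) * (\<integral>\<^sup>+y. h y \<partial>lborel) = (\<integral>\<^sup>+x. g x \<partial>lborel) * (\<integral>\<^sup>+y. h y \<partial>lborel)" .
  moreover have "(\<integral>\<^sup>+y. h y \<partial>lborel) = emeasure lborel (ball (0::'a) 1)"
    by (simp add: h_def)
  moreover note emeasure_unit_ball[where 'a='a]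
  ultimately show ?thesis
    by (simp add: mult.commute[of _ "emeasure lborel (ball 0 1)"] ennreal_mult_cancel_left)
qed

section \<open>Uniform spins under orthogonal maps and reflections\<close>

lemma orthogonal_transformation_measurable:
  fixes f :: "'a::euclidean_space \<Rightarrow> 'a"
  assumes "orthogonal_transformation f"
  shows "f \<in> borel_measurable borel"
  using orthogonal_transformation_linear[OF assms]
  by (intro borel_measurable_continuous_onI linear_continuous_on) (simp add: linear_linear)

lemma sets_sphere_uniform [measurable_cong, simp]: "sets sphere_uniform = sets borel"
  by (simp add: sphere_uniform_def)

lemma prob_space_uniform_ball: "prob_space (uniform_measure lborel (ball (0::real ^ 'N) 1))"
  using emeasure_unit_ball[where 'a="real ^ 'N"] by (intro prob_space_uniform_measure) auto

lemma prob_space_sphere_uniform: "prob_space (sphere_uniform :: (real ^ 'N) measure)"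
  unfolding sphere_uniform_def by (intro prob_space.prob_space_distr[OF prob_space_uniform_ball]) simp

lemma AE_sphere_uniform_norm: "AE x in (sphere_uniform :: (real ^ 'N) measure). norm x = 1"
proof -
  have "AE x in uniform_measure lborel (ball (0::real ^ 'N) 1). x \<noteq> 0"
    using AE_lborel_singleton[of "0::real ^ 'N"] by (intro AE_uniform_measureI) auto
  then have "AE x in uniform_measure lborel (ball (0::real ^ 'N) 1). norm (x /\<^sub>R norm x) = 1"
    by eventually_elim simp
  then show ?thesis
    unfolding sphere_uniform_def by (subst AE_distr_iff) auto
qed

text \<open>The uniform law on the ball is invariant, and an orthogonal map commutes with radial
  projection.\<close>

lemma distr_sphere_uniform_orthogonal:
  fixes f :: "real ^ 'N \<Rightarrow> real ^ 'N"
  assumes f: "orthogonal_transformation f"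
  shows "distr sphere_uniform borel f = sphere_uniform"
proof -
  let ?U = "uniform_measure lborel (ball (0::real ^ 'N) 1)"
  note [measurable] = orthogonal_transformation_measurable[OF f]
  have norm: "norm (f x) = norm x" for x by (rule orthogonal_transformation_norm[OF f])
  have "distr ?U borel f = ?U"
  proof (rule measure_eqI)
    fix A assume "A \<in> sets (distr ?U borel f)"
    then have [measurable]: "A \<in> sets borel" by simp
    have "emeasure lborel (ball 0 1 \<inter> f -` A) = (\<integral>\<^sup>+x. indicator (ball 0 1 \<inter> A) (f x) \<partial>lborel)"
      by (subst nn_integral_indicator[symmetric])
         (auto intro!: nn_integral_cong simp: indicator_def norm measurable_sets_borel[OF orthogonal_transformation_measurable[OF f]])
    also have "\<dots> = (\<integral>\<^sup>+x. indicator (ball 0 1 \<inter> A) x \<partial>lborel)"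
      by (intro nn_integral_lborel_orthogonal[OF f] borel_measurable_indicator) auto
    also have "\<dots> = emeasure lborel (ball 0 1 \<inter> A)"
      by (rule nn_integral_indicator) auto
    finally show "emeasure (distr ?U borel f) A = emeasure ?U A"
      by (subst emeasure_distr) (auto simp: measurable_sets_borel[OF orthogonal_transformation_measurable[OF f]])
  qed simp
  then have "sphere_uniform = distr (distr ?U borel f) borel (\<lambda>x. x /\<^sub>R norm x)"
    by (simp add: sphere_uniform_def)
  also have "\<dots> = distr ?U borel (\<lambda>x. f x /\<^sub>R norm (f x))"
    by (subst distr_distr) (auto simp: comp_def)
  also have "\<dots> = distr ?U borel (\<lambda>x. f (x /\<^sub>R norm x))"
    by (simp add: norm orthogonal_transformation_scaleR[OF f])
  also have "\<dots> = distr sphere_uniform borel f"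
    unfolding sphere_uniform_def by (subst distr_distr) (auto simp: comp_def)
  finally show ?thesis by simp
qed

text \<open>Fixes the line spanned by \<open>b\<close> and negates its orthogonal complement. For
  \<open>b = 0\<close> division by zero makes it \<open>- a\<close>, which is still
  orthogonal.\<close>

definition line_reflection :: "'a::real_inner \<Rightarrow> 'a \<Rightarrow> 'a" where
  "line_reflection b a = (2 * (b \<bullet> a) / (b \<bullet> b)) *\<^sub>R b - a"

lemma orthogonal_line_reflection: "orthogonal_transformation (line_reflection b)"
proof (cases "b = 0")
  case True
  then show ?thesis
    using orthogonal_transformation_neg[of "\<lambda>x. x"] by (simp add: line_reflection_def[abs_def])
next
  case False
  show ?thesis
    unfolding orthogonal_transformation_def
  proof (intro conjI allI)
    show "linear (line_reflection b)"
      unfolding line_reflection_def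
      by (intro linearI) (simp_all add: inner_add_right algebra_simps add_divide_distrib)
    fix v w
    show "line_reflection b v \<bullet> line_reflection b w = v \<bullet> w"
      using False unfolding line_reflection_def
      by (simp add: inner_diff_left inner_diff_right inner_commute field_simps)
  qed
qed

lemma line_reflection_self [simp]: "line_reflection b b = b"
  by (cases "b = 0") (simp_all add: line_reflection_def algebra_simps scaleR_2)

lemma line_reflection_measurable [measurable]:
  fixes f g :: "'a \<Rightarrow> real ^ 'N"
  assumes [measurable]: "f \<in> borel_measurable M" "g \<in> borel_measurable M"
  shows "(\<lambda>x. line_reflection (f x) (g x)) \<in> borel_measurable M"
  unfolding line_reflection_def by measurable

lemma product_sigma_finite_spheres: "product_sigma_finite (\<lambda>_. sphere_uniform :: (real ^ 'N) measure)"
  unfolding product_sigma_finite_def using prob_space_imp_sigma_finite[OF prob_space_sphere_uniform] by auto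

lemma sets_PiM_sphere_uniform: "sets (Pi\<^sub>M I (\<lambda>_. sphere_uniform)) = sets (Pi\<^sub>M I (\<lambda>_. borel))"
  by (intro sets_PiM_cong) auto

text \<open>The map may depend on the site, since the cluster flip moves only some of the
  spins.\<close>

lemma distr_spheres_orthogonal:
  fixes f :: "'i \<Rightarrow> real ^ 'N \<Rightarrow> real ^ 'N"
  assumes I: "finite I" and f: "\<And>i. i \<in> I \<Longrightarrow> orthogonal_transformation (f i)"
  shows "distr (Pi\<^sub>M I (\<lambda>_. sphere_uniform)) (Pi\<^sub>M I (\<lambda>_. borel)) (\<lambda>\<sigma>. \<lambda>i\<in>I. f i (\<sigma> i)) = Pi\<^sub>M I (\<lambda>_. sphere_uniform)"
proof -
  interpret product_sigma_finite "\<lambda>_::'i. sphere_uniform :: (real ^ 'N) measure"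
    by (rule product_sigma_finite_spheres)
  note fm = orthogonal_transformation_measurable[OF f]
  have Psi: "(\<lambda>\<sigma>. \<lambda>i\<in>I. f i (\<sigma> i)) \<in> measurable (Pi\<^sub>M I (\<lambda>_. sphere_uniform)) (Pi\<^sub>M I (\<lambda>_. borel))"
    unfolding measurable_cong_sets[OF sets_PiM_sphere_uniform refl]
    by (intro measurable_restrict measurable_compose[OF measurable_component_singleton] fm)
  show ?thesis
  proof (rule PiM_eqI[OF I])
    show "sets (distr (Pi\<^sub>M I (\<lambda>_. sphere_uniform)) (Pi\<^sub>M I (\<lambda>_. borel)) (\<lambda>\<sigma>. \<lambda>i\<in>I. f i (\<sigma> i)))
       = sets (Pi\<^sub>M I (\<lambda>_. sphere_uniform))"
      by (simp add: sets_PiM_sphere_uniform)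
    fix A :: "'i \<Rightarrow> (real ^ 'N) set" assume A: "\<And>i. i \<in> I \<Longrightarrow> A i \<in> sets sphere_uniform"
    then have A': "Pi\<^sub>E I A \<in> sets (Pi\<^sub>M I (\<lambda>_. borel))"
      using I by (intro sets_PiM_I_finite) auto
    have pre: "f i -` A i \<in> sets sphere_uniform" if "i \<in> I" for i
      using A[OF that] measurable_sets_borel[OF fm[OF that]] by simp
    have "emeasure (distr (Pi\<^sub>M I (\<lambda>_. sphere_uniform)) (Pi\<^sub>M I (\<lambda>_. borel)) (\<lambda>\<sigma>. \<lambda>i\<in>I. f i (\<sigma> i))) (Pi\<^sub>E I A)
        = emeasure (Pi\<^sub>M I (\<lambda>_. sphere_uniform)) (\<Pi>\<^sub>E i\<in>I. f i -` A i)"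
      by (subst emeasure_distr[OF Psi A'])
         (auto intro!: arg_cong[where f="emeasure _"] simp: space_PiM PiE_iff sets_eq_imp_space_eq[OF sets_sphere_uniform])
    also have "\<dots> = (\<Prod>i\<in>I. emeasure sphere_uniform (f i -` A i))"
      using pre by (intro emeasure_PiM I)
    also have "\<dots> = (\<Prod>i\<in>I. emeasure sphere_uniform (A i))"
    proof (intro prod.cong refl)
      fix i assume i: "i \<in> I"
      have "emeasure sphere_uniform (A i) = emeasure (distr sphere_uniform borel (f i)) (A i)"
        by (simp add: distr_sphere_uniform_orthogonal[OF f[OF i]])
      also have "\<dots> = emeasure sphere_uniform (f i -` A i)"
        using A[OF i] fm[OF i]
        by (subst emeasure_distr) (auto simp: sets_eq_imp_space_eq[OF sets_sphere_uniform] cong: measurable_cong_sets)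
      finally show "emeasure sphere_uniform (f i -` A i) = emeasure sphere_uniform (A i)" by simp
    qed
    finally show "emeasure (distr (Pi\<^sub>M I (\<lambda>_. sphere_uniform)) (Pi\<^sub>M I (\<lambda>_. borel)) (\<lambda>\<sigma>. \<lambda>i\<in>I. f i (\<sigma> i))) (Pi\<^sub>E I A)
        = (\<Prod>i\<in>I. emeasure sphere_uniform (A i))" .
  qed
qed

text \<open>The axis of the reflection is itself random. Once \<open>\<sigma> y = b\<close> is
  fixed, the spin at \<open>y\<close> does not move and all others undergo one fixed orthogonal map,
  so invariance holds for each \<open>b\<close> and then after integrating over
  \<open>b\<close>.\<close>

lemma distr_spheres_line_reflection:
  assumes I: "finite I" and y: "y \<in> I"
  shows "distr (Pi\<^sub>M I (\<lambda>_. sphere_uniform :: (real ^ 'N) measure)) (Pi\<^sub>M I (\<lambda>_. borel))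
           (\<lambda>\<sigma>. \<lambda>i\<in>I. line_reflection (\<sigma> y) (\<sigma> i)) = Pi\<^sub>M I (\<lambda>_. sphere_uniform)"
    (is "distr _ _ ?\<Psi> = _")
proof (rule measure_eqI)
  interpret product_sigma_finite "\<lambda>_::'a. sphere_uniform :: (real ^ 'N) measure"
    by (rule product_sigma_finite_spheres)
  define J where "J = I - {y}"
  have J: "finite J" "y \<notin> J" "insert y J = I" using I y by (auto simp: J_def)
  have Psi: "?\<Psi> \<in> measurable (Pi\<^sub>M I (\<lambda>_. sphere_uniform)) (Pi\<^sub>M I (\<lambda>_. borel))"
    unfolding measurable_cong_sets[OF sets_PiM_sphere_uniform refl] using y
    by (intro measurable_restrict line_reflection_measurable measurable_component_singleton)
  fix X assume "X \<in> sets (distr (Pi\<^sub>M I (\<lambda>_. sphere_uniform :: (real ^ 'N) measure)) (Pi\<^sub>M I (\<lambda>_. borel)) ?\<Psi>)"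
  then have X: "X \<in> sets (Pi\<^sub>M I (\<lambda>_. borel))" by simp
  then have X': "X \<in> sets (Pi\<^sub>M I (\<lambda>_. sphere_uniform))" by (simp add: sets_PiM_sphere_uniform)
  have "emeasure (distr (Pi\<^sub>M I (\<lambda>_. sphere_uniform :: (real ^ 'N) measure)) (Pi\<^sub>M I (\<lambda>_. borel)) ?\<Psi>) X
      = (\<integral>\<^sup>+\<sigma>. indicator X (?\<Psi> \<sigma>) \<partial>Pi\<^sub>M I (\<lambda>_. sphere_uniform))"
    using X by (subst nn_integral_indicator[symmetric], simp, subst nn_integral_distr[OF Psi]) auto
  also have "\<dots> = (\<integral>\<^sup>+b. (\<integral>\<^sup>+\<tau>. indicator X (?\<Psi> (\<tau>(y := b))) \<partial>Pi\<^sub>M J (\<lambda>_. sphere_uniform)) \<partial>sphere_uniform)"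
    using product_nn_integral_insert_rev[OF J(1,2), of "\<lambda>\<sigma>. indicator X (?\<Psi> \<sigma>)"]
      measurable_compose[OF Psi borel_measurable_indicator[OF X]] unfolding J(3) by simp
  also have "\<dots> = (\<integral>\<^sup>+b. (\<integral>\<^sup>+\<tau>. indicator X (\<tau>(y := b)) \<partial>Pi\<^sub>M J (\<lambda>_. sphere_uniform)) \<partial>sphere_uniform)"
  proof (rule nn_integral_cong)
    fix b :: "real ^ 'N"
    let ?f = "\<lambda>\<tau>. \<lambda>i\<in>J. line_reflection b (\<tau> i)"
    have f: "?f \<in> measurable (Pi\<^sub>M J (\<lambda>_. sphere_uniform)) (Pi\<^sub>M J (\<lambda>_. borel))"
      unfolding measurable_cong_sets[OF sets_PiM_sphere_uniform refl]
      by (intro measurable_restrict line_reflection_measurable borel_measurable_const measurable_component_singleton)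
    have upd: "(\<lambda>\<tau>. indicator X (\<tau>(y := b)) :: ennreal) \<in> borel_measurable (Pi\<^sub>M J (\<lambda>_. borel))"
      using X unfolding J(3)[symmetric] by measurable
    have "?\<Psi> (\<tau>(y := b)) = (?f \<tau>)(y := b)" for \<tau>
      using J by (auto simp: fun_eq_iff)
    then have "(\<integral>\<^sup>+\<tau>. indicator X (?\<Psi> (\<tau>(y := b))) \<partial>Pi\<^sub>M J (\<lambda>_. sphere_uniform))
        = (\<integral>\<^sup>+\<tau>. indicator X (\<tau>(y := b)) \<partial>distr (Pi\<^sub>M J (\<lambda>_. sphere_uniform)) (Pi\<^sub>M J (\<lambda>_. borel)) ?f)"
      using upd by (subst nn_integral_distr[OF f]) auto
    then show "(\<integral>\<^sup>+\<tau>. indicator X (?\<Psi> (\<tau>(y := b))) \<partial>Pi\<^sub>M J (\<lambda>_. sphere_uniform))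
        = (\<integral>\<^sup>+\<tau>. indicator X (\<tau>(y := b)) \<partial>Pi\<^sub>M J (\<lambda>_. sphere_uniform))"
      by (simp add: distr_spheres_orthogonal[OF J(1) orthogonal_line_reflection])
  qed
  also have "\<dots> = (\<integral>\<^sup>+\<sigma>. indicator X \<sigma> \<partial>Pi\<^sub>M I (\<lambda>_. sphere_uniform))"
    using product_nn_integral_insert_rev[OF J(1,2), of "indicator X"] X' unfolding J(3) by simp
  also have "\<dots> = emeasure (Pi\<^sub>M I (\<lambda>_. sphere_uniform)) X"
    using X' by simp
  finally show "emeasure (distr (Pi\<^sub>M I (\<lambda>_. sphere_uniform :: (real ^ 'N) measure)) (Pi\<^sub>M I (\<lambda>_. borel)) ?\<Psi>) X
      = emeasure (Pi\<^sub>M I (\<lambda>_. sphere_uniform)) X" .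
qed (simp add: sets_PiM_sphere_uniform)

section \<open>Flipping a cluster\<close>

text \<open>At most one side of 0 contributes, and only if both ends lie on it; a formula in the
  product \<open>s * t\<close> then covers both sides.\<close>

lemma edge_survival_0: "edge_survival 0 s t = 1 - exp (- (2 * max (s * t) 0))"
proof (cases "s > 0 \<longleftrightarrow> t > 0")
  case True
  then show ?thesis
    by (auto simp: edge_survival_def survival_def max_def mult_le_0_iff not_less)
next
  case False
  then have "s * t \<le> 0" by (auto simp: mult_le_0_iff)
  with False show ?thesis
    by (auto simp: edge_survival_def survival_def max_def)
qed

text \<open>Reflection in the hyperplane orthogonal to axis \<open>k\<close>, written as minus a
  line reflection so that orthogonality is inherited.\<close>

definition coord_flip :: "'N \<Rightarrow> real ^ 'N \<Rightarrow> real ^ 'N" where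
  "coord_flip k a = - line_reflection (axis k 1) a"

lemma orthogonal_coord_flip: "orthogonal_transformation (coord_flip k)"
  unfolding coord_flip_def[abs_def] by (subst orthogonal_transformation_neg) (rule orthogonal_line_reflection)

lemma coord_flip_eq: "coord_flip k a = a - (2 * a $ k) *\<^sub>R axis k 1"
  by (simp add: coord_flip_def line_reflection_def inner_axis inner_axis' axis_eq_axis)

lemma coord_flip_nth [simp]: "coord_flip k a $ k = - a $ k"
  by (simp add: coord_flip_eq)

lemma inner_coord_flip: "coord_flip k a \<bullet> b = a \<bullet> b - 2 * (a $ k * b $ k)" "a \<bullet> coord_flip k b = a \<bullet> b - 2 * (a $ k * b $ k)"
  by (simp_all add: coord_flip_eq inner_diff_left inner_diff_right inner_axis inner_axis')

text \<open>Together with \<open>closed_factor\<close>, a splitting of the Gibbs weight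
  \<open>exp (\<beta> * (a \<bullet> b))\<close> of an edge according to whether its bridge avoids 0
  in coordinate \<open>k\<close>.\<close>

definition open_factor :: "real \<Rightarrow> 'N \<Rightarrow> real ^ 'N \<Rightarrow> real ^ 'N \<Rightarrow> real" where
  "open_factor \<beta> k a b = exp (\<beta> * (a \<bullet> b)) * edge_survival 0 (sqrt \<beta> * a $ k) (sqrt \<beta> * b $ k)"

definition closed_factor :: "real \<Rightarrow> 'N \<Rightarrow> real ^ 'N \<Rightarrow> real ^ 'N \<Rightarrow> real" where
  "closed_factor \<beta> k a b = exp (\<beta> * (a \<bullet> b)) * (1 - edge_survival 0 (sqrt \<beta> * a $ k) (sqrt \<beta> * b $ k))"

lemma open_factor_flip: "open_factor \<beta> k (coord_flip k a) (coord_flip k b) = open_factor \<beta> k a b"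
  by (simp add: open_factor_def edge_survival_0 inner_coord_flip)

text \<open>The reflection principle: the weight of an edge on which coordinate \<open>k\<close> vanishes somewhere
  depends on \<open>a $ k\<close> and \<open>b $ k\<close> only through their absolute values.\<close>

lemma closed_factor_eq:
  assumes "\<beta> \<ge> 0"
  shows "closed_factor \<beta> k a b = exp (\<beta> * (a \<bullet> b - a $ k * b $ k) - \<beta> * \<bar>a $ k * b $ k\<bar>)"
proof -
  have "sqrt \<beta> * a $ k * (sqrt \<beta> * b $ k) = (sqrt \<beta> * sqrt \<beta>) * (a $ k * b $ k)"
    by (simp only: mult_ac)
  then have prod: "sqrt \<beta> * a $ k * (sqrt \<beta> * b $ k) = \<beta> * (a $ k * b $ k)"
    using assms by simp
  \<comment> \<open>Uses 2 max (t, 0) = t + |t|.\<close>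
  have max: "\<beta> * (a \<bullet> b) + - (2 * max (\<beta> * (a $ k * b $ k)) 0)
      = \<beta> * (a \<bullet> b - a $ k * b $ k) - \<beta> * \<bar>a $ k * b $ k\<bar>"
    using assms by (cases "a $ k * b $ k \<ge> 0")
      (auto simp: max_def algebra_simps mult_le_0_iff zero_le_mult_iff mult_nonneg_nonpos)
  have "closed_factor \<beta> k a b = exp (\<beta> * (a \<bullet> b)) * exp (- (2 * max (sqrt \<beta> * a $ k * (sqrt \<beta> * b $ k)) 0))"
    by (simp add: closed_factor_def edge_survival_0)
  then show ?thesis
    by (simp only: prod mult_exp_exp max)
qed

text \<open>Flipping one end changes the sign of \<open>a $ k * b $ k\<close> but neither its
  absolute value nor the contribution of the other coordinates to the inner product.\<close>

lemma closed_factor_flip: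
  assumes "\<beta> \<ge> 0"
  shows "closed_factor \<beta> k (coord_flip k a) b = closed_factor \<beta> k a b"
    and "closed_factor \<beta> k a (coord_flip k b) = closed_factor \<beta> k a b"
  using assms by (simp_all add: closed_factor_eq inner_coord_flip)

section \<open>Changes of variables in the spin measure\<close>

context cable_spin
begin

abbreviation "\<rho> \<equiv> Pi\<^sub>M V (\<lambda>_. sphere_uniform :: (real ^ 'N) measure)"

lemma spin_weight_measurable [measurable]: "spin_weight \<beta> n \<in> borel_measurable (spin_space n)"
  unfolding spin_weight_def[abs_def] split_beta'
  by (intro measurable_compose[OF _ borel_measurable_exp] borel_measurable_times borel_measurable_const
      borel_measurable_sum borel_measurable_inner spin_component_measurable edge_vertices)

lemma integral_\<mu>:
  fixes h :: "(real \<times> real \<Rightarrow> real ^ 'N) \<Rightarrow> real"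
  assumes [measurable]: "h \<in> borel_measurable (spin_space n)"
  shows "(\<integral>\<sigma>. h \<sigma> \<partial>\<mu>) = (\<integral>\<sigma>. spin_weight \<beta> n \<sigma> * h \<sigma> \<partial>\<rho>) / (\<integral>\<sigma>. spin_weight \<beta> n \<sigma> \<partial>\<rho>)"
proof -
  define Z where "Z = (\<integral>\<sigma>. spin_weight \<beta> n \<sigma> \<partial>\<rho>)"
  have "Z \<ge> 0" unfolding Z_def by (intro integral_nonneg_AE AE_I2) (simp add: spin_weight_def)
  have [measurable]: "spin_weight \<beta> n \<in> borel_measurable \<rho>" "h \<in> borel_measurable \<rho>"
    unfolding measurable_cong_sets[OF sets_PiM_sphere_uniform refl] by measurable
  have "(\<integral>\<sigma>. h \<sigma> \<partial>\<mu>) = (\<integral>\<sigma>. (spin_weight \<beta> n \<sigma> / Z) *\<^sub>R h \<sigma> \<partial>\<rho>)"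
    unfolding spin_O_model_def Let_def Z_def[symmetric]
  proof (rule integral_density)
    show "AE \<sigma> in \<rho>. 0 \<le> spin_weight \<beta> n \<sigma> / Z"
      using \<open>Z \<ge> 0\<close> by (intro AE_I2) (simp add: spin_weight_def)
  qed measurable
  then show ?thesis by (simp add: Z_def)
qed

text \<open>Invariance is required of the weighted integrand and not of \<open>spin_weight\<close>
  alone, because flipping a single cluster changes the Gibbs weight of the edges on its
  boundary.\<close>

lemma integral_\<mu>_transform:
  fixes h h' :: "(real \<times> real \<Rightarrow> real ^ 'N) \<Rightarrow> real"
  assumes h: "h \<in> borel_measurable (spin_space n)" "h' \<in> borel_measurable (spin_space n)"
    and Psi: "\<Psi> \<in> measurable (spin_space n) (spin_space n)" "distr \<rho> (spin_space n) \<Psi> = \<rho>"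
    and eq: "\<And>\<sigma>. spin_weight \<beta> n (\<Psi> \<sigma>) * h (\<Psi> \<sigma>) = spin_weight \<beta> n \<sigma> * h' \<sigma>"
  shows "(\<integral>\<sigma>. h \<sigma> \<partial>\<mu>) = (\<integral>\<sigma>. h' \<sigma> \<partial>\<mu>)"
proof -
  note [measurable] = h(1)
  have "(\<integral>\<sigma>. spin_weight \<beta> n \<sigma> * h \<sigma> \<partial>\<rho>) = (\<integral>\<sigma>. spin_weight \<beta> n \<sigma> * h \<sigma> \<partial>distr \<rho> (spin_space n) \<Psi>)"
    by (simp add: Psi)
  also have "\<dots> = (\<integral>\<sigma>. spin_weight \<beta> n (\<Psi> \<sigma>) * h (\<Psi> \<sigma>) \<partial>\<rho>)"
    using Psi(1) by (intro integral_distr) (simp_all add: measurable_cong_sets[OF sets_PiM_sphere_uniform refl])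
  finally show ?thesis
    by (simp add: integral_\<mu> h eq)
qed

lemma spin_weight_orthogonal:
  fixes f :: "real ^ 'N \<Rightarrow> real ^ 'N"
  assumes "orthogonal_transformation f"
  shows "spin_weight \<beta> n (\<lambda>v\<in>V. f (\<sigma> v)) = spin_weight \<beta> n \<sigma>"
proof -
  have "(\<Sum>(u, v)\<in>E. (\<lambda>v\<in>V. f (\<sigma> v)) u \<bullet> (\<lambda>v\<in>V. f (\<sigma> v)) v) = (\<Sum>(u, v)\<in>E. \<sigma> u \<bullet> \<sigma> v)"
    using assms box_edges_subset[of n]
    by (intro sum.cong) (auto simp: orthogonal_transformation_def)
  then show ?thesis by (simp add: spin_weight_def)
qed

lemma integral_\<mu>_orthogonal:
  fixes h :: "(real \<times> real \<Rightarrow> real ^ 'N) \<Rightarrow> real"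
  assumes h: "h \<in> borel_measurable (spin_space n)" and f: "orthogonal_transformation f"
  shows "(\<integral>\<sigma>. h (\<lambda>v\<in>V. f (\<sigma> v)) \<partial>\<mu>) = (\<integral>\<sigma>. h \<sigma> \<partial>\<mu>)"
proof (rule integral_\<mu>_transform[symmetric])
  show "(\<lambda>\<sigma>. \<lambda>v\<in>V. f (\<sigma> v)) \<in> measurable (spin_space n) (spin_space n)"
    using orthogonal_transformation_measurable[OF f]
    by (intro measurable_restrict measurable_compose[OF measurable_component_singleton]) auto
  then show "(\<lambda>\<sigma>. h (\<lambda>v\<in>V. f (\<sigma> v))) \<in> borel_measurable (spin_space n)"
    using h by (rule measurable_compose)
qed (use h f in \<open>auto simp: spin_weight_orthogonal finite_lattice_box intro!: distr_spheres_orthogonal\<close>)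

lemma integral_\<mu>_line_reflection:
  fixes h :: "(real \<times> real \<Rightarrow> real ^ 'N) \<Rightarrow> real"
  assumes h: "h \<in> borel_measurable (spin_space n)" and y: "y \<in> V"
  shows "(\<integral>\<sigma>. h (\<lambda>v\<in>V. line_reflection (\<sigma> y) (\<sigma> v)) \<partial>\<mu>) = (\<integral>\<sigma>. h \<sigma> \<partial>\<mu>)"
proof (rule integral_\<mu>_transform[symmetric])
  show "(\<lambda>\<sigma>. \<lambda>v\<in>V. line_reflection (\<sigma> y) (\<sigma> v)) \<in> measurable (spin_space n) (spin_space n)"
    using y by (intro measurable_restrict line_reflection_measurable spin_component_measurable)
  then show "(\<lambda>\<sigma>. h (\<lambda>v\<in>V. line_reflection (\<sigma> y) (\<sigma> v))) \<in> borel_measurable (spin_space n)"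
    using h by (rule measurable_compose)
qed (use h y in \<open>auto simp: spin_weight_orthogonal orthogonal_line_reflection finite_lattice_box
       intro!: distr_spheres_line_reflection\<close>)

lemma integral_spins:
  fixes h :: "(real \<times> real \<Rightarrow> real ^ 'N) \<Rightarrow> real"
  assumes "h \<in> borel_measurable (spin_space n)"
  shows "(\<integral>\<omega>. h (spins \<omega>) \<partial>M) = (\<integral>\<sigma>. h \<sigma> \<partial>\<mu>)"
  unfolding distr_spins[symmetric] using assms by (subst integral_distr) auto

lemma AE_spin:
  assumes P: "AE x in (sphere_uniform :: (real ^ 'N) measure). P x" and v: "v \<in> V"
  shows "AE \<sigma> in \<mu>. P (\<sigma> v)" and "AE \<omega> in M. P (\<theta> \<omega> v)"
proof -
  have "AE \<sigma> in \<rho>. P (\<sigma> v)"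
    using P v by (intro AE_PiM_component) (auto simp: prob_space_sphere_uniform)
  then show *: "AE \<sigma> in \<mu>. P (\<sigma> v)"
    unfolding spin_O_model_def Let_def
    by (subst AE_density) (auto simp: measurable_cong_sets[OF sets_PiM_sphere_uniform refl])
  then have "AE \<omega> in M. P (spins \<omega> v)"
    unfolding distr_spins[symmetric] by (intro AE_distrD[OF spins_measurable])
  then show "AE \<omega> in M. P (\<theta> \<omega> v)"
    using v by (simp add: spins_def)
qed

text \<open>Conditional probability, given the spins \<open>\<sigma>\<close>, that all edges of
  \<open>F\<close> are open and all edges of \<open>G\<close> closed.\<close>

definition cluster_weight :: "'N \<Rightarrow> ((real \<times> real) \<times> (real \<times> real)) set \<Rightarrow> ((real \<times> real) \<times> (real \<times> real)) set \<Rightarrow> (real \<times> real \<Rightarrow> real ^ 'N) \<Rightarrow> real" where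
  "cluster_weight k F G \<sigma> = (\<Prod>e\<in>F. spin_survival k 0 \<sigma> e) * (\<Prod>e\<in>G. 1 - spin_survival k 0 \<sigma> e)"

lemma cluster_weight_measurable [measurable]:
  assumes "F \<subseteq> E" "G \<subseteq> E"
  shows "cluster_weight k F G \<in> borel_measurable (spin_space n)"
  unfolding cluster_weight_def[abs_def] using assms
  by (intro borel_measurable_times borel_measurable_prod borel_measurable_diff borel_measurable_const
      spin_survival_measurable) auto

lemma cluster_weight_bounds: "0 \<le> cluster_weight k F G \<sigma>" "cluster_weight k F G \<sigma> \<le> 1"
  unfolding cluster_weight_def
  by (auto intro!: mult_nonneg_nonneg prod_nonneg mult_le_one prod_le_1 simp: edge_survival_bounds)

text \<open>Inclusion-exclusion, one closed edge at a time: "\<open>e\<close> closed" is the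
  difference of no condition on \<open>e\<close> and "\<open>e\<close> open". In the second term
  \<open>e\<close> joins \<open>F\<close>, hence the induction for arbitrary
  \<open>F\<close>.\<close>

lemma prob_open_closed:
  assumes "finite G" "F \<subseteq> E" "G \<subseteq> E" "F \<inter> G = {}" and A: "A \<in> sets (spin_space n)"
  shows "prob {\<omega> \<in> space M. spins \<omega> \<in> A \<and> (\<forall>e\<in>F. edge_open k \<omega> e) \<and> (\<forall>e\<in>G. \<not> edge_open k \<omega> e)}
       = (\<integral>\<sigma>. indicator A \<sigma> * cluster_weight k F G \<sigma> \<partial>\<mu>)"
  using assms(1-4)
proof (induction G arbitrary: F rule: finite_induct)
  case empty
  note [measurable] = A
  interpret \<mu>: prob_space \<mu> by (rule prob_space_\<mu>)
  have [measurable]: "cluster_weight k F {} \<in> borel_measurable \<mu>" "A \<in> sets \<mu>"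
    using empty A by (auto simp: measurable_cong_sets[OF sets_spin_O_model refl] sets_spin_O_model)
  have "emeasure M {\<omega> \<in> space M. spins \<omega> \<in> A \<and> (\<forall>e\<in>F. edge_open k \<omega> e)}
      = (\<integral>\<^sup>+\<sigma>. ennreal (indicator A \<sigma> * cluster_weight k F {} \<sigma>) \<partial>\<mu>)"
    using empty A
    by (subst emeasure_open_edges)
       (auto simp: cluster_weight_def indicator_def intro!: nn_integral_cong)
  also have "\<dots> = ennreal (\<integral>\<sigma>. indicator A \<sigma> * cluster_weight k F {} \<sigma> \<partial>\<mu>)"
    by (intro nn_integral_eq_integral \<mu>.integrable_const_bound[of _ 1] AE_I2)
       (auto simp: cluster_weight_bounds indicator_def)
  finally have "ennreal (prob {\<omega> \<in> space M. spins \<omega> \<in> A \<and> (\<forall>e\<in>F. edge_open k \<omega> e)}) = \<dots>"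
    by (simp add: emeasure_eq_measure)
  then show ?case
    by (subst (asm) ennreal_inj) (auto intro!: integral_nonneg_AE simp: cluster_weight_bounds)
next
  case (insert e G)
  note [measurable] = A
  interpret \<mu>: prob_space \<mu> by (rule prob_space_\<mu>)
  have pred[measurable]: "Measurable.pred M (\<lambda>\<omega>. \<forall>e\<in>H. edge_open k \<omega> e)"
     "Measurable.pred M (\<lambda>\<omega>. \<forall>e\<in>H. \<not> edge_open k \<omega> e)" if "H \<subseteq> E" for H
    using that finite_subset[OF that finite_box_edges]
    by (auto intro!: pred_intros_finite pred_intros_logic edge_open_measurable)
  let ?P = "\<lambda>F G. {\<omega> \<in> space M. spins \<omega> \<in> A \<and> (\<forall>e\<in>F. edge_open k \<omega> e) \<and> (\<forall>e\<in>G. \<not> edge_open k \<omega> e)}"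
  have P: "?P F' G' \<in> sets M" if "F' \<subseteq> E" "G' \<subseteq> E" for F' G'
    using that by measurable
  have [measurable]: "cluster_weight k F' G' \<in> borel_measurable \<mu>" "A \<in> sets \<mu>" if "F' \<subseteq> E" "G' \<subseteq> E" for F' G'
    using that A by (auto simp: measurable_cong_sets[OF sets_spin_O_model refl] sets_spin_O_model)
  have int: "integrable \<mu> (\<lambda>\<sigma>. indicator A \<sigma> * cluster_weight k F' G' \<sigma>)" if "F' \<subseteq> E" "G' \<subseteq> E" for F' G'
    using that by (intro \<mu>.integrable_const_bound[of _ 1] AE_I2)
       (auto simp: cluster_weight_bounds indicator_def)
  have sub: "e \<in> E" "F \<subseteq> E" "G \<subseteq> E" "insert e F \<subseteq> E" using insert.prems by auto
  have "e \<notin> F" "finite F" using insert.prems finite_subset[OF sub(2) finite_box_edges] by auto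
  then have cw: "cluster_weight k F (insert e G) \<sigma> = cluster_weight k F G \<sigma> - cluster_weight k (insert e F) G \<sigma>" for \<sigma>
    using insert.hyps by (simp add: cluster_weight_def algebra_simps)
  have "?P F (insert e G) = ?P F G - ?P (insert e F) G" by auto
  then have "prob (?P F (insert e G)) = prob (?P F G) - prob (?P (insert e F) G)"
    using sub by (subst finite_measure_Diff[symmetric]) (auto intro!: P)
  also have "\<dots> = (\<integral>\<sigma>. indicator A \<sigma> * cluster_weight k F G \<sigma> \<partial>\<mu>) - (\<integral>\<sigma>. indicator A \<sigma> * cluster_weight k (insert e F) G \<sigma> \<partial>\<mu>)"
    using insert.IH[of F] insert.IH[of "insert e F"] insert.prems insert.hyps by simp
  also have "\<dots> = (\<integral>\<sigma>. indicator A \<sigma> * cluster_weight k F (insert e G) \<sigma> \<partial>\<mu>)"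
    using sub by (subst Bochner_Integration.integral_diff[symmetric]) (auto intro!: int simp: cw algebra_simps)
  finally show ?case .
qed

definition open_edges :: "'N \<Rightarrow> '\<omega> \<Rightarrow> ((real \<times> real) \<times> (real \<times> real)) set" where
  "open_edges k \<omega> = {e \<in> E. edge_open k \<omega> e}"

text \<open>The set of open edges takes finitely many values, so \<open>P\<close> may be any
  predicate.\<close>

lemma open_edges_measurable [measurable]:
  "Measurable.pred M (\<lambda>\<omega>. P (open_edges k \<omega>))"
proof -
  have eq: "Measurable.pred M (\<lambda>\<omega>. open_edges k \<omega> = F)" for F
  proof (cases "F \<subseteq> E")
    case True
    have "Measurable.pred M (\<lambda>\<omega>. \<forall>e\<in>E. edge_open k \<omega> e \<longleftrightarrow> e \<in> F)"
      using finite_box_edges[of n] by (intro pred_intros_finite pred_intros_logic edge_open_measurable) auto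
    also have "(\<lambda>\<omega>. \<forall>e\<in>E. edge_open k \<omega> e \<longleftrightarrow> e \<in> F) = (\<lambda>\<omega>. open_edges k \<omega> = F)"
      using True by (auto simp: open_edges_def fun_eq_iff)
    finally show ?thesis .
  next
    case False
    then have "(\<lambda>\<omega>. open_edges k \<omega> = F) = (\<lambda>_. False)" by (auto simp: open_edges_def fun_eq_iff)
    then show ?thesis by simp
  qed
  have "Measurable.pred M (\<lambda>\<omega>. \<exists>F\<in>{F. F \<subseteq> E \<and> P F}. open_edges k \<omega> = F)"
    using finite_box_edges[of n] by (intro pred_intros_finite eq) simp
  also have "(\<lambda>\<omega>. \<exists>F\<in>{F. F \<subseteq> E \<and> P F}. open_edges k \<omega> = F) = (\<lambda>\<omega>. P (open_edges k \<omega>))"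
    by (auto simp: open_edges_def fun_eq_iff)
  finally show ?thesis .
qed

text \<open>Disintegration over the spins. Comparing the two measures on sets \<open>A\<close>
  reduces it to \<open>prob_open_closed\<close>, and equality of measures extends to the integral of
  \<open>h\<close>.\<close>

lemma integral_open_edges:
  fixes h :: "(real \<times> real \<Rightarrow> real ^ 'N) \<Rightarrow> real"
  assumes F: "F \<subseteq> E" and h[measurable]: "h \<in> borel_measurable (spin_space n)"
  shows "(\<integral>\<omega>. indicator {\<omega>. open_edges k \<omega> = F} \<omega> * h (spins \<omega>) \<partial>M) = (\<integral>\<sigma>. cluster_weight k F (E - F) \<sigma> * h \<sigma> \<partial>\<mu>)"
proof -
  interpret \<mu>: prob_space \<mu> by (rule prob_space_\<mu>)
  let ?W = "cluster_weight k F (E - F)"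
  have W_spin[measurable]: "?W \<in> borel_measurable (spin_space n)"
    using F by (intro cluster_weight_measurable) auto
  have [measurable]: "?W \<in> borel_measurable \<mu>" "h \<in> borel_measurable \<mu>"
    by (auto simp: measurable_cong_sets[OF sets_spin_O_model refl])
  have ind[measurable]: "(indicator {\<omega>. open_edges k \<omega> = F} :: '\<omega> \<Rightarrow> real) \<in> borel_measurable M"
     "(indicator {\<omega>. open_edges k \<omega> = F} :: '\<omega> \<Rightarrow> ennreal) \<in> borel_measurable M"
    unfolding indicator_def[abs_def] mem_Collect_eq by measurable
  have "distr (density M (indicator {\<omega>. open_edges k \<omega> = F})) (spin_space n) spins = density \<mu> ?W"
  proof (rule measure_eqI)
    fix A assume "A \<in> sets (distr (density M (indicator {\<omega>. open_edges k \<omega> = F})) (spin_space n) spins)"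
    then have A[measurable]: "A \<in> sets (spin_space n)" by simp
    have A\<mu>[measurable]: "A \<in> sets \<mu>" using A by (simp add: sets_spin_O_model)
    have "emeasure (distr (density M (indicator {\<omega>. open_edges k \<omega> = F})) (spin_space n) spins) A
        = emeasure (density M (indicator {\<omega>. open_edges k \<omega> = F})) (spins -` A \<inter> space M)"
      by (subst emeasure_distr) auto
    also have "\<dots> = (\<integral>\<^sup>+\<omega>. indicator {\<omega>. open_edges k \<omega> = F} \<omega> * indicator (spins -` A \<inter> space M) \<omega> \<partial>M)"
      by (intro emeasure_density ind) measurable
    also have "\<dots> = (\<integral>\<^sup>+\<omega>. indicator {\<omega> \<in> space M. spins \<omega> \<in> A \<and> (\<forall>e\<in>F. edge_open k \<omega> e) \<and> (\<forall>e\<in>E - F. \<not> edge_open k \<omega> e)} \<omega> \<partial>M)"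
      using F by (intro nn_integral_cong) (auto simp: indicator_def open_edges_def)
    also have "\<dots> = emeasure M {\<omega> \<in> space M. spins \<omega> \<in> A \<and> (\<forall>e\<in>F. edge_open k \<omega> e) \<and> (\<forall>e\<in>E - F. \<not> edge_open k \<omega> e)}"
    proof (rule nn_integral_indicator)
      have "{\<omega> \<in> space M. spins \<omega> \<in> A \<and> (\<forall>e\<in>F. edge_open k \<omega> e) \<and> (\<forall>e\<in>E - F. \<not> edge_open k \<omega> e)}
          = {\<omega> \<in> space M. spins \<omega> \<in> A \<and> open_edges k \<omega> = F}"
        using F by (auto simp: open_edges_def)
      also have "\<dots> \<in> sets M" by measurable
      finally show "{\<omega> \<in> space M. spins \<omega> \<in> A \<and> (\<forall>e\<in>F. edge_open k \<omega> e) \<and> (\<forall>e\<in>E - F. \<not> edge_open k \<omega> e)} \<in> sets M" .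
    qed
    also have "\<dots> = ennreal (\<integral>\<sigma>. indicator A \<sigma> * ?W \<sigma> \<partial>\<mu>)"
      using F A finite_box_edges[of n] by (subst emeasure_eq_measure, subst prob_open_closed) auto
    also have "\<dots> = (\<integral>\<^sup>+\<sigma>. ennreal (indicator A \<sigma> * ?W \<sigma>) \<partial>\<mu>)"
      by (intro nn_integral_eq_integral[symmetric] \<mu>.integrable_const_bound[of _ 1] AE_I2)
         (auto simp: cluster_weight_bounds indicator_def)
    also have "\<dots> = emeasure (density \<mu> ?W) A"
      by (subst emeasure_density) (auto intro!: nn_integral_cong simp: indicator_def)
    finally show "emeasure (distr (density M (indicator {\<omega>. open_edges k \<omega> = F})) (spin_space n) spins) A
       = emeasure (density \<mu> ?W) A" .
  qed (simp add: sets_spin_O_model)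
  then have "(\<integral>\<sigma>. h \<sigma> \<partial>distr (density M (indicator {\<omega>. open_edges k \<omega> = F})) (spin_space n) spins)
      = (\<integral>\<sigma>. h \<sigma> \<partial>density \<mu> ?W)" by simp
  also have "\<dots> = (\<integral>\<sigma>. ?W \<sigma> * h \<sigma> \<partial>\<mu>)"
    by (subst integral_density) (auto simp: cluster_weight_bounds)
  also have "(\<integral>\<sigma>. h \<sigma> \<partial>distr (density M (indicator {\<omega>. open_edges k \<omega> = F})) (spin_space n) spins)
      = (\<integral>\<omega>. h (spins \<omega>) \<partial>density M (\<lambda>\<omega>. ennreal (indicator {\<omega>. open_edges k \<omega> = F} \<omega>)))"
    by (subst integral_distr) (auto simp: ennreal_indicator)
  also have "\<dots> = (\<integral>\<omega>. indicator {\<omega>. open_edges k \<omega> = F} \<omega> * h (spins \<omega>) \<partial>M)"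
    by (subst integral_density) auto
  finally show ?thesis .
qed

text \<open>Flip coordinate \<open>k\<close> on \<open>S\<close>. An edge of \<open>F\<close> has
  both ends flipped or neither, and a closed edge tolerates any flip, so the total weight is
  unchanged while the integrand changes sign: the integral equals its own negative.\<close>

lemma integral_cluster_flip:
  fixes f g :: "real ^ 'N \<Rightarrow> real"
  assumes F: "F \<subseteq> E" and S: "\<And>u v. (u, v) \<in> F \<Longrightarrow> u \<in> S \<longleftrightarrow> v \<in> S"
    and xy: "x \<in> V" "y \<in> V" "x \<in> S" "y \<notin> S"
    and [measurable]: "f \<in> borel_measurable borel" "g \<in> borel_measurable borel"
    and odd: "\<And>a. f (coord_flip k a) = - f a"
  shows "(\<integral>\<sigma>. cluster_weight k F (E - F) \<sigma> * (f (\<sigma> x) * g (\<sigma> y)) \<partial>\<mu>) = 0"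
proof -
  let ?f = "\<lambda>v. if v \<in> S then coord_flip k else (\<lambda>a. a)"
  let ?\<Psi> = "\<lambda>\<sigma>. \<lambda>v\<in>V. ?f v (\<sigma> v)"
  let ?h = "\<lambda>\<sigma>. cluster_weight k F (E - F) \<sigma> * (f (\<sigma> x) * g (\<sigma> y))"
  have orth: "orthogonal_transformation (?f v)" for v
    by (auto intro: orthogonal_coord_flip)
  have [measurable]: "cluster_weight k F (E - F) \<in> borel_measurable (spin_space n)"
    using F by (intro cluster_weight_measurable) auto
  have finF: "finite F" using F finite_box_edges finite_subset by blast
  \<comment> \<open>Gibbs weight and conditional probability combine into one factor per edge; only
    these combined factors are invariant under the flip.\<close>
  have split: "spin_weight \<beta> n \<sigma> * cluster_weight k F (E - F) \<sigma>
      = (\<Prod>e\<in>F. open_factor \<beta> k (\<sigma> (fst e)) (\<sigma> (snd e))) * (\<Prod>e\<in>E - F. closed_factor \<beta> k (\<sigma> (fst e)) (\<sigma> (snd e)))" for \<sigma>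
  proof -
    have "spin_weight \<beta> n \<sigma> = (\<Prod>e\<in>E. exp (\<beta> * (\<sigma> (fst e) \<bullet> \<sigma> (snd e))))"
      using finite_box_edges[of n] by (simp add: spin_weight_def split_beta' sum_distrib_left exp_sum)
    also have "\<dots> = (\<Prod>e\<in>E - F. exp (\<beta> * (\<sigma> (fst e) \<bullet> \<sigma> (snd e)))) * (\<Prod>e\<in>F. exp (\<beta> * (\<sigma> (fst e) \<bullet> \<sigma> (snd e))))"
      by (rule prod.subset_diff[OF F finite_box_edges])
    finally show ?thesis
      by (simp add: cluster_weight_def open_factor_def closed_factor_def prod.distrib)
  qed
  have "(\<integral>\<sigma>. ?h \<sigma> \<partial>\<mu>) = (\<integral>\<sigma>. - ?h \<sigma> \<partial>\<mu>)"
  proof (rule integral_\<mu>_transform)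
    show "?\<Psi> \<in> measurable (spin_space n) (spin_space n)"
      by (intro measurable_restrict measurable_compose[OF measurable_component_singleton]
          orthogonal_transformation_measurable orth)
    show "distr \<rho> (spin_space n) ?\<Psi> = \<rho>"
      by (intro distr_spheres_orthogonal finite_lattice_box orth)
    show "?h \<in> borel_measurable (spin_space n)" using xy by measurable
    show "(\<lambda>\<sigma>. - ?h \<sigma>) \<in> borel_measurable (spin_space n)" using xy by measurable
    fix \<sigma> :: "real \<times> real \<Rightarrow> real ^ 'N"
    have "(\<Prod>e\<in>F. open_factor \<beta> k (?\<Psi> \<sigma> (fst e)) (?\<Psi> \<sigma> (snd e))) = (\<Prod>e\<in>F. open_factor \<beta> k (\<sigma> (fst e)) (\<sigma> (snd e)))"
      using F S edge_vertices by (intro prod.cong) (auto simp: open_factor_flip)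
    moreover have "(\<Prod>e\<in>E - F. closed_factor \<beta> k (?\<Psi> \<sigma> (fst e)) (?\<Psi> \<sigma> (snd e))) = (\<Prod>e\<in>E - F. closed_factor \<beta> k (\<sigma> (fst e)) (\<sigma> (snd e)))"
      using \<beta> edge_vertices by (intro prod.cong) (auto simp: closed_factor_flip)
    ultimately have "spin_weight \<beta> n (?\<Psi> \<sigma>) * cluster_weight k F (E - F) (?\<Psi> \<sigma>) = spin_weight \<beta> n \<sigma> * cluster_weight k F (E - F) \<sigma>"
      unfolding split by simp
    moreover have "f (?\<Psi> \<sigma> x) = - f (\<sigma> x)" "g (?\<Psi> \<sigma> y) = g (\<sigma> y)"
      using xy odd by auto
    ultimately show "spin_weight \<beta> n (?\<Psi> \<sigma>) * ?h (?\<Psi> \<sigma>) = spin_weight \<beta> n \<sigma> * - ?h \<sigma>"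
      by (simp add: mult.assoc[symmetric])
  qed
  then show ?thesis by simp
qed

definition open_connected :: "'N \<Rightarrow> '\<omega> \<Rightarrow> real \<times> real \<Rightarrow> real \<times> real \<Rightarrow> bool" where
  "open_connected k \<omega> x y \<longleftrightarrow> (x, y) \<in> (open_edges k \<omega> \<union> (open_edges k \<omega>)\<inverse>)\<^sup>*"

lemma open_connected_measurable [measurable]: "Measurable.pred M (\<lambda>\<omega>. open_connected k \<omega> x y)"
  unfolding open_connected_def by (rule open_edges_measurable)

text \<open>An open edge carries no zero, so the coordinate keeps its sign along it. The case
  \<open>x = y\<close> is separate because the empty path gives no information about the
  sign.\<close>

lemma open_connected_sign:
  assumes "open_connected k \<omega> x y" "\<omega> \<in> space M" "x \<in> V"
  shows "x = y \<or> 0 < \<theta> \<omega> x $ k * \<theta> \<omega> y $ k"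
  using assms(1) unfolding open_connected_def
proof (induction rule: rtrancl_induct)
  case base
  then show ?case by simp
next
  case (step v w)
  have edge: "0 < \<theta> \<omega> (fst e) $ k * \<theta> \<omega> (snd e) $ k" if "e \<in> open_edges k \<omega>" for e
  proof -
    have e: "e \<in> E" and nz: "\<And>s. s \<in> {0..1} \<Longrightarrow> edge_path k e \<omega> s \<noteq> 0"
      using that by (auto simp: open_edges_def edge_open_def)
    obtain \<tau> \<delta> where \<tau>: "\<tau> \<in> {-1, 1}" and \<delta>: "\<delta> > 0" "\<And>s. s \<in> {0..1} \<Longrightarrow> \<delta> \<le> \<tau> * edge_path k e \<omega> s"
      using nonzero_continuous_bounded_away[OF edge_path_continuous[OF e assms(2), of k] nz] by blast
    have "0 < \<tau> * edge_path k e \<omega> 0" "0 < \<tau> * edge_path k e \<omega> 1"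
      using \<delta>(1) \<delta>(2)[of 0] \<delta>(2)[of 1] by auto
    then have "0 < \<tau> * \<theta> \<omega> (fst e) $ k" "0 < \<tau> * \<theta> \<omega> (snd e) $ k"
      using \<tau> \<beta> edge_vertices[OF e]
      by (auto simp: edge_path_endpoints[OF e assms(2)] spins_def zero_less_mult_iff mult_less_0_iff)
    then show ?thesis using \<tau> by (auto simp: zero_less_mult_iff)
  qed
  have "0 < \<theta> \<omega> v $ k * \<theta> \<omega> w $ k"
    using step.hyps(2) edge[of "(v, w)"] edge[of "(w, v)"] by (auto simp: mult.commute)
  then show ?case using step.IH by (auto simp: zero_less_mult_iff)
qed

lemma AE_norm_spin: "v \<in> V \<Longrightarrow> AE \<omega> in M. norm (\<theta> \<omega> v) = 1" "v \<in> V \<Longrightarrow> AE \<sigma> in \<mu>. norm (\<sigma> v) = 1"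
  using AE_spin[OF AE_sphere_uniform_norm] by auto

text \<open>Flipping coordinate \<open>k\<close> on the open cluster of \<open>x\<close> cancels the contribution of the
  configurations in which \<open>y\<close> lies outside this cluster.\<close>

lemma integral_odd_connected:
  fixes f g :: "real ^ 'N \<Rightarrow> real"
  assumes xy: "x \<in> V" "y \<in> V"
    and f[measurable]: "f \<in> borel_measurable borel" and g[measurable]: "g \<in> borel_measurable borel"
    and odd: "\<And>a. f (coord_flip k a) = - f a"
    and bounds: "\<And>a. norm a = 1 \<Longrightarrow> \<bar>f a\<bar> \<le> B" "\<And>a. norm a = 1 \<Longrightarrow> \<bar>g a\<bar> \<le> C"
  shows "(\<integral>\<omega>. f (\<theta> \<omega> x) * g (\<theta> \<omega> y) \<partial>M)
       = (\<integral>\<omega>. indicator {\<omega>. open_connected k \<omega> x y} \<omega> * (f (\<theta> \<omega> x) * g (\<theta> \<omega> y)) \<partial>M)"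
proof -
  let ?h = "\<lambda>\<omega>. f (\<theta> \<omega> x) * g (\<theta> \<omega> y)"
  let ?D = "{F. F \<subseteq> E \<and> (x, y) \<notin> (F \<union> F\<inverse>)\<^sup>*}"
  have fin: "finite ?D" using finite_box_edges[of n] by simp
  have [measurable]: "(\<lambda>\<omega>. f (\<theta> \<omega> x)) \<in> borel_measurable M" "(\<lambda>\<omega>. g (\<theta> \<omega> y)) \<in> borel_measurable M"
    using xy by auto
  have bound: "AE \<omega> in M. norm (?h \<omega>) \<le> B * C"
    using AE_norm_spin(1)[OF xy(1)] AE_norm_spin(1)[OF xy(2)]
  proof eventually_elim
    case (elim \<omega>)
    then show ?case
      using bounds(1)[of "\<theta> \<omega> x"] bounds(2)[of "\<theta> \<omega> y"]
      by (auto simp: abs_mult intro!: mult_mono order_trans[OF abs_ge_zero])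
  qed
  have int: "integrable M (\<lambda>\<omega>. indicator {\<omega>. P \<omega>} \<omega> * ?h \<omega>)" if [measurable]: "Measurable.pred M P" for P
  proof (rule integrable_const_bound)
    show "AE \<omega> in M. norm (indicator {\<omega>. P \<omega>} \<omega> * ?h \<omega>) \<le> B * C"
      using bound by eventually_elim (auto simp: indicator_def)
    show "(\<lambda>\<omega>. indicator {\<omega>. P \<omega>} \<omega> * ?h \<omega>) \<in> borel_measurable M"
      unfolding indicator_def[abs_def] mem_Collect_eq by measurable
  qed
  \<comment> \<open>The flipped set must not depend on \<open>\<omega>\<close>, so the event is
    split over the finitely many sets \<open>F\<close> of open edges.\<close>
  have "(\<integral>\<omega>. indicator {\<omega>. \<not> open_connected k \<omega> x y} \<omega> * ?h \<omega> \<partial>M)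
      = (\<integral>\<omega>. (\<Sum>F\<in>?D. indicator {\<omega>. open_edges k \<omega> = F} \<omega> * ?h \<omega>) \<partial>M)"
  proof (intro Bochner_Integration.integral_cong refl)
    fix \<omega>
    have "(\<Sum>F\<in>?D. indicator {\<omega>. open_edges k \<omega> = F} \<omega> * ?h \<omega>) = (\<Sum>F\<in>?D. if F = open_edges k \<omega> then ?h \<omega> else 0)"
      by (intro sum.cong) (auto simp: indicator_def)
    then show "indicator {\<omega>. \<not> open_connected k \<omega> x y} \<omega> * ?h \<omega> = (\<Sum>F\<in>?D. indicator {\<omega>. open_edges k \<omega> = F} \<omega> * ?h \<omega>)"
      using fin by (auto simp: indicator_def open_connected_def open_edges_def)
  qed
  also have "\<dots> = (\<Sum>F\<in>?D. \<integral>\<omega>. indicator {\<omega>. open_edges k \<omega> = F} \<omega> * ?h \<omega> \<partial>M)"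
    by (intro Bochner_Integration.integral_sum int) measurable
  also have "\<dots> = 0"
  proof (intro sum.neutral ballI)
    fix F assume F: "F \<in> ?D"
    have "(\<integral>\<omega>. indicator {\<omega>. open_edges k \<omega> = F} \<omega> * ?h \<omega> \<partial>M)
        = (\<integral>\<omega>. indicator {\<omega>. open_edges k \<omega> = F} \<omega> * (\<lambda>\<sigma>. f (\<sigma> x) * g (\<sigma> y)) (spins \<omega>) \<partial>M)"
      using xy by (simp add: spins_def)
    also have "\<dots> = (\<integral>\<sigma>. cluster_weight k F (E - F) \<sigma> * (f (\<sigma> x) * g (\<sigma> y)) \<partial>\<mu>)"
      using F xy by (intro integral_open_edges) auto
    also have "\<dots> = 0"
    \<comment> \<open>The flipped set is the cluster of \<open>x\<close> in \<open>F\<close>, which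
      does not contain \<open>y\<close>.\<close>
    proof (rule integral_cluster_flip[where S="(F \<union> F\<inverse>)\<^sup>* `` {x}"])
      fix u v assume "(u, v) \<in> F"
      then show "u \<in> (F \<union> F\<inverse>)\<^sup>* `` {x} \<longleftrightarrow> v \<in> (F \<union> F\<inverse>)\<^sup>* `` {x}"
        by (auto intro: rtrancl_into_rtrancl)
    qed (use F xy odd in auto)
    finally show "(\<integral>\<omega>. indicator {\<omega>. open_edges k \<omega> = F} \<omega> * ?h \<omega> \<partial>M) = 0" .
  qed
  finally have 0: "(\<integral>\<omega>. indicator {\<omega>. \<not> open_connected k \<omega> x y} \<omega> * ?h \<omega> \<partial>M) = 0" .
  have "(\<integral>\<omega>. ?h \<omega> \<partial>M) = (\<integral>\<omega>. indicator {\<omega>. open_connected k \<omega> x y} \<omega> * ?h \<omega>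
      + indicator {\<omega>. \<not> open_connected k \<omega> x y} \<omega> * ?h \<omega> \<partial>M)"
    by (intro Bochner_Integration.integral_cong) (auto simp: indicator_def)
  also have "\<dots> = (\<integral>\<omega>. indicator {\<omega>. open_connected k \<omega> x y} \<omega> * ?h \<omega> \<partial>M)"
    by (subst Bochner_Integration.integral_add) (auto intro!: int simp: 0)
  finally show ?thesis .
qed

end

section \<open>Connectivity on the cable graph\<close>

text \<open>Recovers the edge through a point of the cable graph that is not a vertex: exactly one
  coordinate is then not an integer, and its floor gives the initial vertex.\<close>

definition carrier_edge :: "real \<times> real \<Rightarrow> (real \<times> real) \<times> (real \<times> real)" where
  "carrier_edge p = (if snd p \<in> \<int> then ((of_int \<lfloor>fst p\<rfloor>, snd p), (of_int \<lfloor>fst p\<rfloor> + 1, snd p))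
                     else ((fst p, of_int \<lfloor>snd p\<rfloor>), (fst p, of_int \<lfloor>snd p\<rfloor> + 1)))"

lemma between_integers:
  assumes "a \<in> \<int>" "0 < s" "s < (1::real)"
  shows "a + s \<notin> \<int>" "of_int \<lfloor>a + s\<rfloor> = a"
proof -
  obtain i where i: "a = of_int i" using assms(1) by (auto elim: Ints_cases)
  have "\<lfloor>a + s\<rfloor> = i" using assms i by (simp add: floor_eq_iff)
  then show "of_int \<lfloor>a + s\<rfloor> = a" using i by simp
  then show "a + s \<notin> \<int>" using assms(2) by (auto simp: of_int_floor_cancel[symmetric])
qed

lemma box_edge_point:
  assumes e: "(u, v) \<in> box_edges n" and p: "p \<in> closed_segment u v"
  shows "p = u \<or> p = v \<or> (p \<notin> lattice_box n \<and> (u, v) = carrier_edge p)"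
proof -
  have u: "fst u \<in> \<int>" "snd u \<in> \<int>" using e by (auto simp: box_edges_def lattice_box_def)
  from p obtain s where s: "0 \<le> s" "s \<le> 1" "p = (1 - s) *\<^sub>R u + s *\<^sub>R v"
    by (auto simp: in_segment)
  consider "s = 0" | "s = 1" | "0 < s" "s < 1" using s by linarith
  then show ?thesis
  proof cases
    case 3
    from e consider "v = u + (1, 0)" | "v = u + (0, 1)" by (auto simp: box_edges_def)
    then show ?thesis
    proof cases
      case 1
      then have "p = (fst u + s, snd u)" "v = (fst u + 1, snd u)"
        using s(3) by (auto simp: prod_eq_iff algebra_simps)
      then show ?thesis
        using between_integers[OF u(1) 3] u by (auto simp: carrier_edge_def lattice_box_def)
    next
      case 2
      then have "p = (fst u, snd u + s)" "v = (fst u, snd u + 1)"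
        using s(3) by (auto simp: prod_eq_iff algebra_simps)
      then show ?thesis
        using between_integers[OF u(2) 3] u by (auto simp: carrier_edge_def lattice_box_def)
    qed
  qed (use s in auto)
qed

text \<open>A common point that is not a vertex would make both edges equal to its
  \<open>carrier_edge\<close>.\<close>

lemma box_edges_meet:
  assumes "e \<in> box_edges n" "e' \<in> box_edges n" "e \<noteq> e'"
    and "p \<in> closed_segment (fst e) (snd e)" "p \<in> closed_segment (fst e') (snd e')"
  shows "p \<in> {fst e, snd e}" "p \<in> {fst e', snd e'}"
proof -
  have "p = fst e \<or> p = snd e \<or> (p \<notin> lattice_box n \<and> e = carrier_edge p)"
    "p = fst e' \<or> p = snd e' \<or> (p \<notin> lattice_box n \<and> e' = carrier_edge p)"
    using box_edge_point[of "fst e" "snd e" n p] box_edge_point[of "fst e'" "snd e'" n p] assms by auto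
  moreover have "{fst e, snd e, fst e', snd e'} \<subseteq> lattice_box n"
    using assms(1,2) box_edges_subset[of n] by auto
  ultimately show "p \<in> {fst e, snd e}" "p \<in> {fst e', snd e'}"
    using assms(3) by auto
qed

lemma vertex_on_edge:
  assumes "n \<ge> 1" "x \<in> lattice_box n"
  obtains e where "e \<in> box_edges n" "x = fst e \<or> x = snd e"
proof -
  have x: "fst x \<in> \<int>" "snd x \<in> \<int>" "- real n \<le> fst x" "fst x \<le> real n" "- real n \<le> snd x" "snd x \<le> real n"
    using assms(2) by (auto simp: lattice_box_def)
  show ?thesis
  proof (cases "fst x < real n")
    case True
    obtain i where i: "fst x = of_int i" using x(1) by (auto elim: Ints_cases)
    with True have "of_int i < (of_int (int n) :: real)" by simp
    then have "i + 1 \<le> int n" by simp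
    then have "of_int (i + 1) \<le> (of_int (int n) :: real)" by (subst of_int_le_iff)
    then have "fst x + 1 \<le> real n" using i by simp
    then have "(x, x + (1, 0)) \<in> box_edges n"
      using x assms(2) by (auto simp: box_edges_def lattice_box_def)
    then show ?thesis by (rule that) simp
  next
    case False
    then have "fst x = real n" using x by simp
    then have "(x - (1, 0), x) \<in> box_edges n"
      using x assms by (auto simp: box_edges_def lattice_box_def)
    then show ?thesis by (rule that) simp
  qed
qed

lemma lattice_box_subset_cable_graph:
  assumes "n \<ge> 1"
  shows "lattice_box n \<subseteq> cable_graph n"
proof
  fix x assume "x \<in> lattice_box n"
  with assms obtain e where "e \<in> box_edges n" "x = fst e \<or> x = snd e" by (rule vertex_on_edge)
  then show "x \<in> cable_graph n"
    by (cases e) (auto simp: cable_graph_def intro!: bexI[of _ e])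
qed

text \<open>The piece of \<open>e\<close> assigned to the vertex set \<open>S\<close> when
  \<open>e\<close> is cut at \<open>z\<close>. Pieces are closed and both contain the cut point, so
  that the cable graph becomes a union of two closed sets, one for \<open>S\<close> and one for
  \<open>- S\<close>.\<close>

definition edge_part :: "(real \<times> real) set \<Rightarrow> real \<times> real \<Rightarrow> (real \<times> real) \<times> (real \<times> real) \<Rightarrow> (real \<times> real) set" where
  "edge_part S z e =
     (if fst e \<in> S \<and> snd e \<in> S then closed_segment (fst e) (snd e)
      else if fst e \<in> S then closed_segment (fst e) z
      else if snd e \<in> S then closed_segment z (snd e) else {})"

lemma closed_edge_part: "closed (edge_part S z e)"
  by (simp add: edge_part_def)

lemma edge_part_subset:
  assumes "z \<in> closed_segment (fst e) (snd e)"
  shows "edge_part S z e \<subseteq> closed_segment (fst e) (snd e)"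
  using assms Un_closed_segment[OF assms] by (auto simp: edge_part_def)

lemma edge_part_Un:
  assumes "z \<in> closed_segment (fst e) (snd e)"
  shows "edge_part S z e \<union> edge_part (- S) z e = closed_segment (fst e) (snd e)"
  using Un_closed_segment[OF assms] by (auto simp: edge_part_def)

lemma edge_part_Int:
  assumes "z \<in> closed_segment (fst e) (snd e)"
  shows "edge_part S z e \<inter> edge_part (- S) z e \<subseteq> {z}"
  using Int_closed_segment[of z "fst e" "snd e"] assms by (auto simp: edge_part_def)

lemma edge_part_endpoint:
  assumes "z \<in> closed_segment (fst e) (snd e)" "p \<in> edge_part S z e" "p \<in> {fst e, snd e}" "p \<noteq> z"
  shows "p \<in> S"
proof -
  have "closed_segment (fst e) z \<inter> closed_segment z (snd e) = {z}"
    using assms(1) by (intro Int_closed_segment) auto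
  moreover have "fst e \<in> closed_segment (fst e) z" "snd e \<in> closed_segment z (snd e)" by auto
  ultimately show ?thesis
    using assms(2-4) by (auto simp: edge_part_def split: if_splits)
qed

lemma endpoint_in_edge_part: "p \<in> {fst e, snd e} \<Longrightarrow> p \<in> S \<Longrightarrow> p \<in> edge_part S z e"
  by (auto simp: edge_part_def)

context cable_spin
begin

lemma edge_open_segment:
  "edge_open k \<omega> e \<longleftrightarrow> (\<forall>z\<in>closed_segment (fst e) (snd e). \<Phi> \<omega> z $ k \<noteq> 0)"
  by (auto simp: edge_open_def edge_path_def simp flip: linepath_image_01)

text \<open>If \<open>y\<close> is outside the cluster \<open>S\<close> of \<open>x\<close>, cut
  every closed edge at a zero of the coordinate. The parts of the cable graph belonging to
  \<open>S\<close> and \<open>- S\<close> are closed and meet only at zeros, so they would separate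
  a connected set on which the coordinate does not vanish.\<close>

lemma label_connected_imp_open_connected:
  assumes xy: "x \<in> V" "y \<in> V" and lc: "label_connected n k (\<Phi> \<omega>) x y"
  shows "open_connected k \<omega> x y"
proof (rule ccontr)
  assume not: "\<not> open_connected k \<omega> x y"
  let ?F = "open_edges k \<omega>"
  define S where "S = (?F \<union> ?F\<inverse>)\<^sup>* `` {x}"
  have "x \<in> S" "y \<notin> S" using not by (auto simp: S_def open_connected_def)
  have step: "fst e \<in> S \<longleftrightarrow> snd e \<in> S" if "e \<in> ?F" for e
    using that unfolding S_def by (cases e) (auto intro: rtrancl_into_rtrancl)
  from lc obtain T where T: "connected T" "T \<subseteq> {z \<in> cable_graph n. label_field k (\<Phi> \<omega>) z > 0}" "x \<in> T" "y \<in> T"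
    by (auto simp: label_connected_def connected_component_def)
  have T0: "\<Phi> \<omega> p $ k \<noteq> 0" if "p \<in> T" for p
    using T(2) that by (auto simp: label_field_def)
  \<comment> \<open>On an open edge the cut point is arbitrary: its ends are both in
    \<open>S\<close> or both outside.\<close>
  have "\<forall>e\<in>E. \<exists>z. z \<in> closed_segment (fst e) (snd e) \<and> (e \<in> ?F \<or> \<Phi> \<omega> z $ k = 0)"
    unfolding open_edges_def edge_open_segment by blast
  then obtain z where z: "\<And>e. e \<in> E \<Longrightarrow> z e \<in> closed_segment (fst e) (snd e)"
    "\<And>e. e \<in> E \<Longrightarrow> e \<in> ?F \<or> \<Phi> \<omega> (z e) $ k = 0"
    by (subst (asm) bchoice_iff) blast
  define A where "A S = (\<Union>e\<in>E. edge_part S (z e) e)" for S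
  have closed: "closed (A S)" for S
    unfolding A_def using finite_box_edges by (intro closed_UN) (auto simp: closed_edge_part)
  have "T \<subseteq> A S \<union> A (- S)"
  proof
    fix p assume "p \<in> T"
    then obtain e where e: "e \<in> E" "p \<in> closed_segment (fst e) (snd e)"
      using T(2) by (auto simp: cable_graph_def)
    then show "p \<in> A S \<union> A (- S)"
      using edge_part_Un[OF z(1)[OF e(1)], of S] by (auto simp: A_def)
  qed
  moreover have "A S \<inter> A (- S) \<inter> T = {}"
  proof (rule ccontr)
    assume "A S \<inter> A (- S) \<inter> T \<noteq> {}"
    then obtain p e e' where p: "p \<in> T" and e: "e \<in> E" "p \<in> edge_part S (z e) e"
      and e': "e' \<in> E" "p \<in> edge_part (- S) (z e') e'"
      by (auto simp: A_def)
    \<comment> \<open>Stated for a general \<open>S'\<close>, to be used with \<open>S\<close> and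
      with \<open>- S\<close>.\<close>
    have S_endpoint: "p \<in> S'" if "e \<in> E" "p \<in> edge_part S' (z e) e" "p \<in> {fst e, snd e}"
      "\<And>e. e \<in> ?F \<Longrightarrow> fst e \<in> S' \<longleftrightarrow> snd e \<in> S'" for e S'
    proof (cases "e \<in> ?F")
      case True
      then show ?thesis using that(2,3) that(4)[OF True] by (auto simp: edge_part_def split: if_splits)
    next
      case False
      then have "p \<noteq> z e" using z(2)[OF that(1)] T0[OF p] by auto
      then show ?thesis using edge_part_endpoint[OF z(1)[OF that(1)] that(2,3)] by simp
    qed
    show False
    proof (cases "e = e'")
      case True
      show False
      proof (cases "e \<in> ?F")
        case True
        then show False using step[OF True] e e' \<open>e = e'\<close> by (auto simp: edge_part_def split: if_splits)
      next
        case False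
        then show False
          using edge_part_Int[OF z(1)[OF e(1)], of S] e e' \<open>e = e'\<close> z(2)[OF e(1)] T0[OF p] by auto
      qed
    next
      case False
      have "p \<in> closed_segment (fst e) (snd e)" "p \<in> closed_segment (fst e') (snd e')"
        using edge_part_subset z(1) e e' by blast+
      then have "p \<in> {fst e, snd e}" "p \<in> {fst e', snd e'}"
        using box_edges_meet[OF e(1) e'(1) False] by auto
      then have "p \<in> S" "p \<in> - S"
        using S_endpoint[OF e] S_endpoint[OF e'] step by auto
      then show False by simp
    qed
  qed
  moreover have "A S \<inter> T \<noteq> {}" "A (- S) \<inter> T \<noteq> {}"
  proof -
    obtain e where "e \<in> E" "x = fst e \<or> x = snd e" using vertex_on_edge[OF n xy(1)] by blast
    then have "x \<in> A S" using \<open>x \<in> S\<close> endpoint_in_edge_part[of x e S "z e"] by (auto simp: A_def)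
    then show "A S \<inter> T \<noteq> {}" using T(3) by blast
    obtain e where "e \<in> E" "y = fst e \<or> y = snd e" using vertex_on_edge[OF n xy(2)] by blast
    then have "y \<in> A (- S)" using \<open>y \<notin> S\<close> endpoint_in_edge_part[of y e "- S" "z e"] by (auto simp: A_def)
    then show "A (- S) \<inter> T \<noteq> {}" using T(4) by blast
  qed
  ultimately show False
    using T(1) closed[of S] closed[of "- S"] unfolding connected_closed by blast
qed

lemma open_connected_imp_label_connected:
  assumes oc: "open_connected k \<omega> x y" and x: "x \<in> V" "\<Phi> \<omega> x $ k \<noteq> 0"
  shows "label_connected n k (\<Phi> \<omega>) x y"
  using oc unfolding open_connected_def label_connected_def
proof (induction rule: rtrancl_induct)
  case base
  then show ?case
    using x lattice_box_subset_cable_graph[OF n] by (auto simp: label_field_def)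
next
  case (step v w)
  let ?O = "{z \<in> cable_graph n. 0 < label_field k (\<Phi> \<omega>) z}"
  have "connected_component ?O (fst e) (snd e)" if "e \<in> open_edges k \<omega>" for e
    unfolding connected_component_def
  proof (intro exI conjI)
    show "closed_segment (fst e) (snd e) \<subseteq> ?O"
      using that unfolding open_edges_def edge_open_segment
      by (cases e) (auto simp: cable_graph_def label_field_def)
  qed auto
  from this[of "(v, w)"] this[of "(w, v)"] have "connected_component ?O v w"
    using step.hyps(2) by (auto intro: connected_component_sym)
  with step.IH show ?case by (rule connected_component_trans)
qed

text \<open>The two conditions on the spins account for \<open>x = y\<close>, where the empty path
  joins \<open>x\<close> to itself even if the coordinate vanishes there.\<close>

lemma label_connected_iff:
  assumes "\<omega> \<in> space M" "x \<in> V" "y \<in> V"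
  shows "label_connected n k (\<Phi> \<omega>) x y \<longleftrightarrow> open_connected k \<omega> x y \<and> \<theta> \<omega> x $ k \<noteq> 0 \<and> \<theta> \<omega> y $ k \<noteq> 0"
proof -
  have "\<Phi> \<omega> v $ k \<noteq> 0 \<longleftrightarrow> \<theta> \<omega> v $ k \<noteq> 0" if "v \<in> V" for v
    using \<Phi>_vertex[OF assms(1) that] \<beta> by simp
  moreover have "\<Phi> \<omega> x $ k \<noteq> 0" "\<Phi> \<omega> y $ k \<noteq> 0" if "label_connected n k (\<Phi> \<omega>) x y"
    using connected_component_in[OF that[unfolded label_connected_def]] by (auto simp: label_field_def)
  ultimately show ?thesis
    using label_connected_imp_open_connected open_connected_imp_label_connected assms by blast
qed

end

section \<open>The two inequalities\<close>

lemma AE_sphere_uniform_nth_nonzero: "AE x in (sphere_uniform :: (real ^ 'N) measure). x $ k \<noteq> 0"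
proof -
  have meas: "{x :: real ^ 'N. x $ k = 0} \<in> sets lborel"
  proof -
    have "closed {x :: real ^ 'N. x $ k = 0}"
      by (intro closed_Collect_eq continuous_intros)
    then show ?thesis by simp
  qed
  have "negligible {x :: real ^ 'N. axis k 1 \<bullet> x = 0}"
    by (rule negligible_hyperplane) (simp add: axis_eq_0_iff)
  then have "{x :: real ^ 'N. x $ k = 0} \<in> null_sets lborel"
    using meas by (simp add: inner_axis' negligible_iff_null_sets null_sets_completion_iff)
  from AE_not_in[OF this] have "AE x in lborel. (x :: real ^ 'N) $ k \<noteq> 0"
    by simp
  then have "AE x in uniform_measure lborel (ball (0::real ^ 'N) 1). x $ k \<noteq> 0"
    by (intro AE_uniform_measureI) auto
  then have "AE x in uniform_measure lborel (ball (0::real ^ 'N) 1). (x /\<^sub>R norm x) $ k \<noteq> 0"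
    by eventually_elim auto
  then show ?thesis
    unfolding sphere_uniform_def by (subst AE_distr_iff) auto
qed

text \<open>The reciprocal cut off at height \<open>j\<close>: odd, bounded, and 0 at 0 because
  \<open>sgn 0 = 0\<close>.\<close>

definition clipped_inverse :: "nat \<Rightarrow> real \<Rightarrow> real" where
  "clipped_inverse j s = sgn s * min (1 / \<bar>s\<bar>) (real j)"

lemma clipped_inverse_minus: "clipped_inverse j (- s) = - clipped_inverse j s"
  by (simp add: clipped_inverse_def sgn_minus)

lemma clipped_inverse_bound: "\<bar>clipped_inverse j s\<bar> \<le> real j"
  by (auto simp: clipped_inverse_def abs_mult abs_sgn_eq)

lemma clipped_inverse_measurable [measurable]: "clipped_inverse j \<in> borel_measurable borel"
  unfolding clipped_inverse_def[abs_def] sgn_real_def by measurable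

lemma clipped_inverse_times: "0 \<le> s * clipped_inverse j s" "s * clipped_inverse j s \<le> 1"
proof -
  have eq: "s * clipped_inverse j s = \<bar>s\<bar> * min (1 / \<bar>s\<bar>) (real j)"
    by (simp add: clipped_inverse_def sgn_real_def)
  then show "0 \<le> s * clipped_inverse j s" by simp
  have "\<bar>s\<bar> * min (1 / \<bar>s\<bar>) (real j) \<le> \<bar>s\<bar> * (1 / \<bar>s\<bar>)"
    by (intro mult_left_mono) auto
  also have "\<dots> \<le> 1" by simp
  finally show "s * clipped_inverse j s \<le> 1" unfolding eq .
qed

lemma clipped_inverse_eventually:
  assumes "s \<noteq> 0"
  shows "\<forall>\<^sub>F j in sequentially. clipped_inverse j s = 1 / s"
proof -
  have "\<forall>\<^sub>F j in sequentially. 1 / \<bar>s\<bar> \<le> real j"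
    using filterlim_real_sequentially by (simp add: filterlim_at_top)
  then show ?thesis
    by eventually_elim (use assms in \<open>auto simp: clipped_inverse_def min_def sgn_real_def abs_if\<close>)
qed

text \<open>The arithmetic-geometric mean inequality s / t + t / s >= 2 for numbers of equal sign,
  at a level \<open>j\<close> where the cut-off is not active.\<close>

lemma one_le_clipped_average:
  assumes "0 < s * t" "clipped_inverse j s = 1 / s" "clipped_inverse j t = 1 / t"
  shows "1 \<le> (s * clipped_inverse j t + clipped_inverse j s * t) / 2"
proof -
  have "2 * (s * t) \<le> s * s + t * t"
    using sum_squares_bound[of s t] by (simp add: power2_eq_square)
  then have "2 \<le> (s * s + t * t) / (s * t)"
    using assms(1) by (simp add: pos_le_divide_eq)
  also have "\<dots> = s / t + t / s"
    using assms(1) by (cases "s = 0 \<or> t = 0") (auto simp: field_simps)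
  finally show ?thesis using assms by simp
qed

context cable_spin
begin

lemma inner_spin_bound:
  "v \<in> V \<Longrightarrow> w \<in> V \<Longrightarrow> AE \<sigma> in \<mu>. \<bar>\<sigma> v \<bullet> \<sigma> w\<bar> \<le> 1" "v \<in> V \<Longrightarrow> AE \<sigma> in \<mu>. \<bar>\<sigma> v $ k\<bar> \<le> 1"
proof -
  assume v: "v \<in> V"
  show "AE \<sigma> in \<mu>. \<bar>\<sigma> v $ k\<bar> \<le> 1"
    using AE_norm_spin(2)[OF v] by eventually_elim (metis component_le_norm_cart)
  assume w: "w \<in> V"
  show "AE \<sigma> in \<mu>. \<bar>\<sigma> v \<bullet> \<sigma> w\<bar> \<le> 1"
    using AE_norm_spin(2)[OF v] AE_norm_spin(2)[OF w]
  proof eventually_elim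
    case (elim \<sigma>)
    then show ?case using Cauchy_Schwarz_ineq2[of "\<sigma> v" "\<sigma> w"] by simp
  qed
qed

text \<open>The inner product is a sum over coordinates, which all contribute equally by rotation
  invariance of the model.\<close>

lemma integral_inner_spins:
  assumes "x \<in> V" "y \<in> V"
  shows "(\<integral>\<sigma>. \<sigma> x \<bullet> \<sigma> y \<partial>\<mu>) = real CARD('N) * (\<integral>\<sigma>. \<sigma> x $ k * \<sigma> y $ k \<partial>\<mu>)"
proof -
  interpret \<mu>: prob_space \<mu> by (rule prob_space_\<mu>)
  have [measurable]: "(\<lambda>\<sigma>. \<sigma> x) \<in> borel_measurable \<mu>" "(\<lambda>\<sigma>. \<sigma> y) \<in> borel_measurable \<mu>"
    using assms by (auto simp: measurable_cong_sets[OF sets_spin_O_model refl])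
  have same: "(\<integral>\<sigma>. \<sigma> x $ j * \<sigma> y $ j \<partial>\<mu>) = (\<integral>\<sigma>. \<sigma> x $ k * \<sigma> y $ k \<partial>\<mu>)" for j
  proof (cases "j = k")
    case False
    \<comment> \<open>Reflection in the diagonal of the \<open>j\<close>, \<open>k\<close> plane: it
      swaps these two coordinates and negates the others.\<close>
    let ?f = "line_reflection (axis j 1 + axis k 1) :: real ^ 'N \<Rightarrow> _"
    have "axis j (1::real) $ k = 0" "axis k (1::real) $ k = 1" "axis k (1::real) $ j = 0"
      using False by (auto simp: axis_def)
    then have f: "?f a $ k = a $ j" for a
      using False by (simp add: line_reflection_def inner_add_left inner_add_right inner_axis_axis inner_axis' add_divide_distrib)
    have "(\<integral>\<sigma>. \<sigma> x $ k * \<sigma> y $ k \<partial>\<mu>) = (\<integral>\<sigma>. (\<lambda>v\<in>V. ?f (\<sigma> v)) x $ k * (\<lambda>v\<in>V. ?f (\<sigma> v)) y $ k \<partial>\<mu>)"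
      using assms by (intro integral_\<mu>_orthogonal[symmetric] orthogonal_line_reflection) measurable
    then show ?thesis using assms by (simp add: f)
  qed simp
  have "(\<integral>\<sigma>. \<sigma> x \<bullet> \<sigma> y \<partial>\<mu>) = (\<integral>\<sigma>. (\<Sum>j\<in>UNIV. \<sigma> x $ j * \<sigma> y $ j) \<partial>\<mu>)"
    by (simp add: inner_vec_def)
  also have "\<dots> = (\<Sum>j\<in>UNIV. \<integral>\<sigma>. \<sigma> x $ j * \<sigma> y $ j \<partial>\<mu>)"
  proof (rule Bochner_Integration.integral_sum)
    fix j
    show "integrable \<mu> (\<lambda>\<sigma>. \<sigma> x $ j * \<sigma> y $ j)"
    proof (rule \<mu>.integrable_const_bound)
      show "AE \<sigma> in \<mu>. norm (\<sigma> x $ j * \<sigma> y $ j) \<le> 1"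
        using inner_spin_bound(2)[OF assms(1), of j] inner_spin_bound(2)[OF assms(2), of j]
        by eventually_elim (simp add: abs_mult mult_le_one)
    qed measurable
  qed
  also have "\<dots> = (\<Sum>j\<in>(UNIV :: 'N set). \<integral>\<sigma>. \<sigma> x $ k * \<sigma> y $ k \<partial>\<mu>)"
    by (intro sum.cong refl same)
  also have "\<dots> = real CARD('N) * (\<integral>\<sigma>. \<sigma> x $ k * \<sigma> y $ k \<partial>\<mu>)"
    by simp
  finally show ?thesis .
qed

text \<open>Averaging \<open>\<sigma> x\<close> with its reflection in the line spanned by \<open>\<sigma> y\<close> replaces it by its
  projection \<open>(\<sigma> x \<bullet> \<sigma> y) *\<^sub>R \<sigma> y\<close>.\<close>

lemma integral_component_projection:
  fixes g :: "real ^ 'N \<Rightarrow> real"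
  assumes xy: "x \<in> V" "y \<in> V" and g[measurable]: "g \<in> borel_measurable borel"
    and bound: "\<And>a. \<bar>g a\<bar> \<le> B"
  shows "(\<integral>\<sigma>. \<sigma> x $ k * g (\<sigma> y) \<partial>\<mu>) = (\<integral>\<sigma>. (\<sigma> x \<bullet> \<sigma> y) * (\<sigma> y $ k * g (\<sigma> y)) \<partial>\<mu>)"
proof -
  interpret \<mu>: prob_space \<mu> by (rule prob_space_\<mu>)
  have [measurable]: "(\<lambda>\<sigma>. \<sigma> x) \<in> borel_measurable \<mu>" "(\<lambda>\<sigma>. \<sigma> y) \<in> borel_measurable \<mu>"
    using xy by (auto simp: measurable_cong_sets[OF sets_spin_O_model refl])
  have "B \<ge> 0" using bound[of 0] by simp
  have int1: "integrable \<mu> (\<lambda>\<sigma>. \<sigma> x $ k * g (\<sigma> y))"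
  proof (rule \<mu>.integrable_const_bound)
    show "AE \<sigma> in \<mu>. norm (\<sigma> x $ k * g (\<sigma> y)) \<le> 1 * B"
      using inner_spin_bound(2)[OF xy(1), of k]
      by eventually_elim (unfold real_norm_def abs_mult, intro mult_mono, auto simp: bound)
  qed measurable
  have int2: "integrable \<mu> (\<lambda>\<sigma>. (\<sigma> x \<bullet> \<sigma> y) * (\<sigma> y $ k * g (\<sigma> y)))"
  proof (rule \<mu>.integrable_const_bound)
    show "AE \<sigma> in \<mu>. norm ((\<sigma> x \<bullet> \<sigma> y) * (\<sigma> y $ k * g (\<sigma> y))) \<le> 1 * (1 * B)"
      using inner_spin_bound(2)[OF xy(2), of k] inner_spin_bound(1)[OF xy]
      by eventually_elim (unfold real_norm_def abs_mult, intro mult_mono, auto simp: bound)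
  qed measurable
  have "(\<integral>\<sigma>. \<sigma> x $ k * g (\<sigma> y) \<partial>\<mu>)
      = (\<integral>\<sigma>. (\<lambda>v\<in>V. line_reflection (\<sigma> y) (\<sigma> v)) x $ k * g ((\<lambda>v\<in>V. line_reflection (\<sigma> y) (\<sigma> v)) y) \<partial>\<mu>)"
    using xy by (intro integral_\<mu>_line_reflection[symmetric]) measurable
  also have "\<dots> = (\<integral>\<sigma>. line_reflection (\<sigma> y) (\<sigma> x) $ k * g (\<sigma> y) \<partial>\<mu>)"
    using xy by simp
  also have "\<dots> = (\<integral>\<sigma>. 2 * ((\<sigma> x \<bullet> \<sigma> y) * (\<sigma> y $ k * g (\<sigma> y))) - \<sigma> x $ k * g (\<sigma> y) \<partial>\<mu>)"
  proof (rule integral_cong_AE)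
    show "AE \<sigma> in \<mu>. line_reflection (\<sigma> y) (\<sigma> x) $ k * g (\<sigma> y)
        = 2 * ((\<sigma> x \<bullet> \<sigma> y) * (\<sigma> y $ k * g (\<sigma> y))) - \<sigma> x $ k * g (\<sigma> y)"
      using AE_norm_spin(2)[OF xy(2)]
    proof eventually_elim
      case (elim \<sigma>)
      then have "\<sigma> y \<bullet> \<sigma> y = 1" by (simp add: norm_eq_1)
      then have "line_reflection (\<sigma> y) (\<sigma> x) $ k = 2 * ((\<sigma> x \<bullet> \<sigma> y) * \<sigma> y $ k) - \<sigma> x $ k"
        by (simp add: line_reflection_def inner_commute)
      then show ?case
        by (simp add: left_diff_distrib mult.assoc)
    qed
  qed measurable
  \<comment> \<open>The unknown integral now stands on both sides, I = 2 J - I, hence I = J.\<close>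
  also have "\<dots> = 2 * (\<integral>\<sigma>. (\<sigma> x \<bullet> \<sigma> y) * (\<sigma> y $ k * g (\<sigma> y)) \<partial>\<mu>) - (\<integral>\<sigma>. \<sigma> x $ k * g (\<sigma> y) \<partial>\<mu>)"
    using int1 int2 by simp
  finally show ?thesis by simp
qed

lemma integral_clipped_tendsto:
  assumes "x \<in> V" "y \<in> V" "v \<in> V"
  shows "(\<lambda>j. \<integral>\<sigma>. (\<sigma> x \<bullet> \<sigma> y) * (\<sigma> v $ k * clipped_inverse j (\<sigma> v $ k)) \<partial>\<mu>) \<longlonglongrightarrow> (\<integral>\<sigma>. \<sigma> x \<bullet> \<sigma> y \<partial>\<mu>)"
proof (rule integral_dominated_convergence[where w="\<lambda>_. 1"])
  interpret \<mu>: prob_space \<mu> by (rule prob_space_\<mu>)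
  have [measurable]: "(\<lambda>\<sigma>. \<sigma> x) \<in> borel_measurable \<mu>" "(\<lambda>\<sigma>. \<sigma> y) \<in> borel_measurable \<mu>" "(\<lambda>\<sigma>. \<sigma> v) \<in> borel_measurable \<mu>"
    using assms by (auto simp: measurable_cong_sets[OF sets_spin_O_model refl])
  show "(\<lambda>\<sigma>. \<sigma> x \<bullet> \<sigma> y) \<in> borel_measurable \<mu>" by measurable
  show "(\<lambda>\<sigma>. (\<sigma> x \<bullet> \<sigma> y) * (\<sigma> v $ k * clipped_inverse j (\<sigma> v $ k))) \<in> borel_measurable \<mu>" for j
    by measurable
  show "integrable \<mu> (\<lambda>_. 1 :: real)" by simp
  show "AE \<sigma> in \<mu>. norm ((\<sigma> x \<bullet> \<sigma> y) * (\<sigma> v $ k * clipped_inverse j (\<sigma> v $ k))) \<le> 1" for j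
    using inner_spin_bound(1)[OF assms(1,2)]
  proof eventually_elim
    case (elim \<sigma>)
    have clip: "\<bar>\<sigma> v $ k * clipped_inverse j (\<sigma> v $ k)\<bar> \<le> 1"
      using clipped_inverse_times[of "\<sigma> v $ k" j] by simp
    show ?case
      using mult_le_one[OF elim abs_ge_zero clip] by (simp add: abs_mult)
  qed
  show "AE \<sigma> in \<mu>. (\<lambda>j. (\<sigma> x \<bullet> \<sigma> y) * (\<sigma> v $ k * clipped_inverse j (\<sigma> v $ k))) \<longlonglongrightarrow> \<sigma> x \<bullet> \<sigma> y"
    using AE_spin(1)[OF AE_sphere_uniform_nth_nonzero assms(3), of k]
  proof eventually_elim
    case (elim \<sigma>)
    have "\<forall>\<^sub>F j in sequentially. (\<sigma> x \<bullet> \<sigma> y) * (\<sigma> v $ k * clipped_inverse j (\<sigma> v $ k)) = \<sigma> x \<bullet> \<sigma> y"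
      using clipped_inverse_eventually[OF elim] by eventually_elim (use elim in simp)
    then show ?case by (rule tendsto_eventually)
  qed
qed

lemma label_connected_measurable:
  assumes "x \<in> V" "y \<in> V"
  shows "{\<omega> \<in> space M. label_connected n k (\<Phi> \<omega>) x y} \<in> sets M"
proof -
  have "{\<omega> \<in> space M. label_connected n k (\<Phi> \<omega>) x y}
      = {\<omega> \<in> space M. open_connected k \<omega> x y \<and> \<theta> \<omega> x $ k \<noteq> 0 \<and> \<theta> \<omega> y $ k \<noteq> 0}"
    using label_connected_iff[OF _ assms] by auto
  also have "\<dots> \<in> sets M" using assms by measurable
  finally show ?thesis .
qed

lemma integral_component_le_prob:
  assumes xy: "x \<in> V" "y \<in> V"
  shows "(\<integral>\<sigma>. \<sigma> x $ k * \<sigma> y $ k \<partial>\<mu>) \<le> \<P>(\<omega> in M. label_connected n k (\<Phi> \<omega>) x y)"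
proof -
  let ?L = "{\<omega> \<in> space M. label_connected n k (\<Phi> \<omega>) x y}"
  note [measurable] = label_connected_measurable[OF xy, of k]
  have "(\<integral>\<sigma>. \<sigma> x $ k * \<sigma> y $ k \<partial>\<mu>) = (\<integral>\<omega>. spins \<omega> x $ k * spins \<omega> y $ k \<partial>M)"
    using xy by (intro integral_spins[symmetric]) measurable
  also have "\<dots> = (\<integral>\<omega>. \<theta> \<omega> x $ k * \<theta> \<omega> y $ k \<partial>M)"
    using xy by (simp add: spins_def)
  also have "\<dots> = (\<integral>\<omega>. indicator {\<omega>. open_connected k \<omega> x y} \<omega> * (\<theta> \<omega> x $ k * \<theta> \<omega> y $ k) \<partial>M)"
    by (rule integral_odd_connected[OF xy, of "\<lambda>a. a $ k" "\<lambda>a. a $ k" _ 1 1])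
       (auto, (metis component_le_norm_cart)+)
  also have "\<dots> \<le> (\<integral>\<omega>. indicator ?L \<omega> \<partial>M)"
  proof (rule integral_mono_AE)
    have bound: "AE \<omega> in M. \<bar>\<theta> \<omega> x $ k * \<theta> \<omega> y $ k\<bar> \<le> 1"
      using AE_norm_spin(1)[OF xy(1)] AE_norm_spin(1)[OF xy(2)]
    proof eventually_elim
      case (elim \<omega>)
      then have "\<bar>\<theta> \<omega> x $ k\<bar> \<le> 1" "\<bar>\<theta> \<omega> y $ k\<bar> \<le> 1" by (metis component_le_norm_cart)+
      then show ?case by (simp add: abs_mult mult_le_one)
    qed
    show "integrable M (\<lambda>\<omega>. indicator {\<omega>. open_connected k \<omega> x y} \<omega> * (\<theta> \<omega> x $ k * \<theta> \<omega> y $ k))"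
    proof (rule integrable_const_bound)
      show "AE \<omega> in M. norm (indicator {\<omega>. open_connected k \<omega> x y} \<omega> * (\<theta> \<omega> x $ k * \<theta> \<omega> y $ k)) \<le> 1"
        using bound by eventually_elim (auto simp: indicator_def)
      show "(\<lambda>\<omega>. indicator {\<omega>. open_connected k \<omega> x y} \<omega> * (\<theta> \<omega> x $ k * \<theta> \<omega> y $ k)) \<in> borel_measurable M"
        unfolding indicator_def[abs_def] mem_Collect_eq using xy by measurable
    qed
    show "integrable M (indicator ?L :: '\<omega> \<Rightarrow> real)"
      by (rule integrable_const_bound[of _ 1]) auto
    \<comment> \<open>If \<open>x\<close> and \<open>y\<close> are open-connected but
      \<open>?L\<close> fails, a coordinate vanishes and the left side is 0.\<close>
    show "AE \<omega> in M. indicator {\<omega>. open_connected k \<omega> x y} \<omega> * (\<theta> \<omega> x $ k * \<theta> \<omega> y $ k) \<le> indicator ?L \<omega>"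
      using bound AE_space
    proof eventually_elim
      case (elim \<omega>)
      then show ?case using label_connected_iff[OF elim(2) xy, of k] by (auto simp: indicator_def)
    qed
  qed
  also have "\<dots> = prob ?L" by simp
  finally show ?thesis .
qed

text \<open>A Schur test: \<open>\<bar>\<sigma> y $ k\<bar>\<close> is a positive eigenfunction, with eigenvalue
  \<open>\<integral>\<sigma>. \<sigma> x \<bullet> \<sigma> y \<partial>\<mu>\<close>, of the kernel given by the joint law of the absolute values on the
  event of connection.\<close>

lemma prob_le_integral_inner:
  assumes xy: "x \<in> V" "y \<in> V"
  shows "\<P>(\<omega> in M. label_connected n k (\<Phi> \<omega>) x y) \<le> (\<integral>\<sigma>. \<sigma> x \<bullet> \<sigma> y \<partial>\<mu>)"
proof -
  let ?L = "{\<omega> \<in> space M. label_connected n k (\<Phi> \<omega>) x y}"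
  let ?C = "{\<omega>. open_connected k \<omega> x y}"
  note [measurable] = label_connected_measurable[OF xy, of k]
  have [measurable]: "(indicator ?C :: '\<omega> \<Rightarrow> real) \<in> borel_measurable M"
    unfolding indicator_def[abs_def] mem_Collect_eq by measurable
  have [measurable]: "(\<lambda>\<omega>. \<theta> \<omega> x) \<in> borel_measurable M" "(\<lambda>\<omega>. \<theta> \<omega> y) \<in> borel_measurable M"
    using xy by auto
  define a where "a j \<omega> = \<theta> \<omega> x $ k * clipped_inverse j (\<theta> \<omega> y $ k)" for j \<omega>
  define b where "b j \<omega> = clipped_inverse j (\<theta> \<omega> x $ k) * \<theta> \<omega> y $ k" for j \<omega>
  have [measurable]: "a j \<in> borel_measurable M" "b j \<in> borel_measurable M" for j
    unfolding a_def b_def by measurable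
  have nth_bound: "\<bar>c $ k\<bar> \<le> 1" if "norm c = 1" for c :: "real ^ 'N"
    using that by (metis component_le_norm_cart)
  have int_a: "(\<integral>\<omega>. indicator ?C \<omega> * a j \<omega> \<partial>M) = (\<integral>\<sigma>. (\<sigma> x \<bullet> \<sigma> y) * (\<sigma> y $ k * clipped_inverse j (\<sigma> y $ k)) \<partial>\<mu>)" for j
  proof -
    have "(\<integral>\<omega>. indicator ?C \<omega> * a j \<omega> \<partial>M) = (\<integral>\<omega>. \<theta> \<omega> x $ k * clipped_inverse j (\<theta> \<omega> y $ k) \<partial>M)"
      unfolding a_def
      by (rule integral_odd_connected[OF xy, of "\<lambda>a. a $ k" "\<lambda>a. clipped_inverse j (a $ k)" _ 1 "real j", symmetric])
         (auto simp: clipped_inverse_bound nth_bound)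
    also have "\<dots> = (\<integral>\<omega>. spins \<omega> x $ k * clipped_inverse j (spins \<omega> y $ k) \<partial>M)"
      using xy by (simp add: spins_def)
    also have "\<dots> = (\<integral>\<sigma>. \<sigma> x $ k * clipped_inverse j (\<sigma> y $ k) \<partial>\<mu>)"
      using xy by (intro integral_spins) measurable
    also have "\<dots> = (\<integral>\<sigma>. (\<sigma> x \<bullet> \<sigma> y) * (\<sigma> y $ k * clipped_inverse j (\<sigma> y $ k)) \<partial>\<mu>)"
      by (rule integral_component_projection[OF xy]) (auto intro: clipped_inverse_bound)
    finally show ?thesis .
  qed
  \<comment> \<open>The odd function is now the clipped reciprocal at \<open>x\<close>; the
    projection is then applied with \<open>x\<close> and \<open>y\<close> exchanged.\<close>
  have int_b: "(\<integral>\<omega>. indicator ?C \<omega> * b j \<omega> \<partial>M) = (\<integral>\<sigma>. (\<sigma> x \<bullet> \<sigma> y) * (\<sigma> x $ k * clipped_inverse j (\<sigma> x $ k)) \<partial>\<mu>)" for j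
  proof -
    have "(\<integral>\<omega>. indicator ?C \<omega> * b j \<omega> \<partial>M) = (\<integral>\<omega>. clipped_inverse j (\<theta> \<omega> x $ k) * \<theta> \<omega> y $ k \<partial>M)"
      unfolding b_def
      by (rule integral_odd_connected[OF xy, of "\<lambda>a. clipped_inverse j (a $ k)" "\<lambda>a. a $ k" _ "real j" 1, symmetric])
         (auto simp: clipped_inverse_bound nth_bound clipped_inverse_minus)
    also have "\<dots> = (\<integral>\<omega>. spins \<omega> y $ k * clipped_inverse j (spins \<omega> x $ k) \<partial>M)"
      using xy by (simp add: spins_def mult.commute)
    also have "\<dots> = (\<integral>\<sigma>. \<sigma> y $ k * clipped_inverse j (\<sigma> x $ k) \<partial>\<mu>)"
      using xy by (intro integral_spins) measurable
    also have "\<dots> = (\<integral>\<sigma>. (\<sigma> y \<bullet> \<sigma> x) * (\<sigma> x $ k * clipped_inverse j (\<sigma> x $ k)) \<partial>\<mu>)"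
      by (rule integral_component_projection[OF xy(2,1)]) (auto intro: clipped_inverse_bound)
    finally show ?thesis by (simp add: inner_commute)
  qed
  have integrable_ab: "integrable M (\<lambda>\<omega>. indicator ?C \<omega> * a j \<omega>)" "integrable M (\<lambda>\<omega>. indicator ?C \<omega> * b j \<omega>)" for j
  proof -
    have "AE \<omega> in M. norm (indicator ?C \<omega> * a j \<omega>) \<le> 1 * real j \<and> norm (indicator ?C \<omega> * b j \<omega>) \<le> real j * 1"
      using AE_norm_spin(1)[OF xy(1)] AE_norm_spin(1)[OF xy(2)]
    proof eventually_elim
      case (elim \<omega>)
      have "\<bar>a j \<omega>\<bar> \<le> 1 * real j" "\<bar>b j \<omega>\<bar> \<le> real j * 1"
        unfolding a_def b_def abs_mult using elim
        by (intro mult_mono nth_bound clipped_inverse_bound; simp)+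
      then show ?case by (auto simp: indicator_def)
    qed
    then show "integrable M (\<lambda>\<omega>. indicator ?C \<omega> * a j \<omega>)" "integrable M (\<lambda>\<omega>. indicator ?C \<omega> * b j \<omega>)"
      by (auto intro!: integrable_const_bound elim: eventually_mono)
  qed
  \<comment> \<open>The average of \<open>a j\<close> and \<open>b j\<close> has no bound uniform in
    \<open>j\<close>; the minimum with 1 makes dominated convergence possible and keeps the limit
    \<open>indicator ?L\<close>.\<close>
  define X where "X j \<omega> = indicator ?L \<omega> * min 1 ((a j \<omega> + b j \<omega>) / 2)" for j \<omega>
  have nonneg: "0 \<le> a j \<omega>" "0 \<le> b j \<omega>" if "open_connected k \<omega> x y" "\<omega> \<in> space M" for j \<omega>
  proof -
    have "x = y \<or> 0 < \<theta> \<omega> x $ k * \<theta> \<omega> y $ k" using open_connected_sign[OF that xy(1)] .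
    then have s: "0 \<le> \<theta> \<omega> x $ k * sgn (\<theta> \<omega> y $ k)" "0 \<le> sgn (\<theta> \<omega> x $ k) * \<theta> \<omega> y $ k"
      by (auto simp: sgn_real_def zero_less_mult_iff)
    have "a j \<omega> = (\<theta> \<omega> x $ k * sgn (\<theta> \<omega> y $ k)) * min (1 / \<bar>\<theta> \<omega> y $ k\<bar>) (real j)"
      "b j \<omega> = (sgn (\<theta> \<omega> x $ k) * \<theta> \<omega> y $ k) * min (1 / \<bar>\<theta> \<omega> x $ k\<bar>) (real j)"
      by (simp_all add: a_def b_def clipped_inverse_def mult_ac)
    with s show "0 \<le> a j \<omega>" "0 \<le> b j \<omega>" by simp_all
  qed
  have X_bound: "0 \<le> X j \<omega>" "X j \<omega> \<le> 1" "X j \<omega> \<le> (indicator ?C \<omega> * a j \<omega> + indicator ?C \<omega> * b j \<omega>) / 2"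
    if "\<omega> \<in> space M" for j \<omega>
  proof -
    have "0 \<le> X j \<omega> \<and> X j \<omega> \<le> 1 \<and> X j \<omega> \<le> (indicator ?C \<omega> * a j \<omega> + indicator ?C \<omega> * b j \<omega>) / 2"
      using nonneg[of \<omega> j] label_connected_iff[OF that xy, of k] that
        min.cobounded2[of 1 "(a j \<omega> + b j \<omega>) / 2"]
      by (auto simp: X_def indicator_def)
    then show "0 \<le> X j \<omega>" "X j \<omega> \<le> 1" "X j \<omega> \<le> (indicator ?C \<omega> * a j \<omega> + indicator ?C \<omega> * b j \<omega>) / 2"
      by auto
  qed
  have [measurable]: "X j \<in> borel_measurable M" for j
    unfolding X_def by measurable
  have "(\<lambda>j. \<integral>\<omega>. X j \<omega> \<partial>M) \<longlonglongrightarrow> (\<integral>\<omega>. indicator ?L \<omega> \<partial>M)"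
  proof (rule integral_dominated_convergence[where w="\<lambda>_. 1"])
    show "AE \<omega> in M. norm (X j \<omega>) \<le> 1" for j
      using X_bound by (intro AE_I2) auto
    show "AE \<omega> in M. (\<lambda>j. X j \<omega>) \<longlonglongrightarrow> indicator ?L \<omega>"
    proof (intro AE_I2)
      fix \<omega> assume \<omega>: "\<omega> \<in> space M"
      show "(\<lambda>j. X j \<omega>) \<longlonglongrightarrow> indicator ?L \<omega>"
      proof (cases "\<omega> \<in> ?L")
        case True
        then have nz: "\<theta> \<omega> x $ k \<noteq> 0" "\<theta> \<omega> y $ k \<noteq> 0" and "open_connected k \<omega> x y"
          using label_connected_iff[OF \<omega> xy, of k] by auto
        \<comment> \<open>For \<open>x = y\<close> positivity comes from \<open>nz\<close>,
          otherwise from the constant sign along the open path.\<close>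
        then have pos: "0 < \<theta> \<omega> x $ k * \<theta> \<omega> y $ k"
          using open_connected_sign[OF _ \<omega> xy(1), of k y] by (auto simp: zero_less_mult_iff)
        have "\<forall>\<^sub>F j in sequentially. X j \<omega> = 1"
          using clipped_inverse_eventually[OF nz(1)] clipped_inverse_eventually[OF nz(2)]
        proof eventually_elim
          case (elim j)
          then show ?case
            using one_le_clipped_average[OF pos elim] True by (simp add: X_def a_def b_def)
        qed
        with True show ?thesis by (simp add: tendsto_eventually)
      qed (simp add: X_def)
    qed
  qed auto
  then have lim: "(\<lambda>j. \<integral>\<omega>. X j \<omega> \<partial>M) \<longlonglongrightarrow> prob ?L" by simp
  have "(\<lambda>j. ((\<integral>\<sigma>. (\<sigma> x \<bullet> \<sigma> y) * (\<sigma> y $ k * clipped_inverse j (\<sigma> y $ k)) \<partial>\<mu>)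
      + (\<integral>\<sigma>. (\<sigma> x \<bullet> \<sigma> y) * (\<sigma> x $ k * clipped_inverse j (\<sigma> x $ k)) \<partial>\<mu>)) / 2)
      \<longlonglongrightarrow> ((\<integral>\<sigma>. \<sigma> x \<bullet> \<sigma> y \<partial>\<mu>) + (\<integral>\<sigma>. \<sigma> x \<bullet> \<sigma> y \<partial>\<mu>)) / 2"
    using xy by (intro tendsto_intros integral_clipped_tendsto) auto
  moreover have "(\<integral>\<omega>. X j \<omega> \<partial>M) \<le> ((\<integral>\<sigma>. (\<sigma> x \<bullet> \<sigma> y) * (\<sigma> y $ k * clipped_inverse j (\<sigma> y $ k)) \<partial>\<mu>)
      + (\<integral>\<sigma>. (\<sigma> x \<bullet> \<sigma> y) * (\<sigma> x $ k * clipped_inverse j (\<sigma> x $ k)) \<partial>\<mu>)) / 2" for j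
  proof -
    have "integrable M (X j)"
      using X_bound by (intro integrable_const_bound[of _ 1] AE_I2) auto
    then have "(\<integral>\<omega>. X j \<omega> \<partial>M) \<le> (\<integral>\<omega>. (indicator ?C \<omega> * a j \<omega> + indicator ?C \<omega> * b j \<omega>) / 2 \<partial>M)"
      using integrable_ab X_bound by (intro integral_mono) auto
    also have "\<dots> = ((\<integral>\<omega>. indicator ?C \<omega> * a j \<omega> \<partial>M) + (\<integral>\<omega>. indicator ?C \<omega> * b j \<omega> \<partial>M)) / 2"
      using integrable_ab by simp
    finally show ?thesis by (simp only: int_a int_b)
  qed
  ultimately show ?thesis
    using LIMSEQ_le[OF lim] by auto
qed

end

theorem theorem1p6:
  fixes M :: "'\<omega> measure"
    and \<theta> \<Phi> :: "'\<omega> \<Rightarrow> real \<times> real \<Rightarrow> real ^ 'N"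
    and \<beta> :: real and n :: nat and x y :: "real \<times> real" and k :: 'N
  assumes "\<beta> > 0" and "n \<ge> 1"
    and "x \<in> lattice_box n" and "y \<in> lattice_box n"
    and "cable_spin_field M \<beta> n \<theta> \<Phi>"
  shows "1 / real CARD('N) * \<P>(\<omega> in M. label_connected n k (\<Phi> \<omega>) x y)
           \<le> (\<integral>\<omega>. \<theta> \<omega> x \<bullet> \<theta> \<omega> y \<partial>M)
       \<and> (\<integral>\<omega>. \<theta> \<omega> x \<bullet> \<theta> \<omega> y \<partial>M)
           \<le> real CARD('N) * \<P>(\<omega> in M. label_connected n k (\<Phi> \<omega>) x y)"
proof -
  interpret cable_spin M \<beta> n \<theta> \<Phi>
    using assms by unfold_locales
  have xy: "x \<in> V" "y \<in> V" using assms by auto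
  let ?p = "\<P>(\<omega> in M. label_connected n k (\<Phi> \<omega>) x y)"
  have "(\<integral>\<omega>. \<theta> \<omega> x \<bullet> \<theta> \<omega> y \<partial>M) = (\<integral>\<omega>. spins \<omega> x \<bullet> spins \<omega> y \<partial>M)"
    using xy by (simp add: spins_def)
  also have "\<dots> = (\<integral>\<sigma>. \<sigma> x \<bullet> \<sigma> y \<partial>\<mu>)"
    using xy by (intro integral_spins) measurable
  finally have T: "(\<integral>\<omega>. \<theta> \<omega> x \<bullet> \<theta> \<omega> y \<partial>M) = (\<integral>\<sigma>. \<sigma> x \<bullet> \<sigma> y \<partial>\<mu>)" .
  have "1 / real CARD('N) * ?p \<le> 1 * ?p"
    by (intro mult_right_mono) (auto simp: Suc_le_eq)
  also have "\<dots> \<le> (\<integral>\<sigma>. \<sigma> x \<bullet> \<sigma> y \<partial>\<mu>)"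
    using prob_le_integral_inner[OF xy, of k] by simp
  finally have "1 / real CARD('N) * ?p \<le> (\<integral>\<sigma>. \<sigma> x \<bullet> \<sigma> y \<partial>\<mu>)" .
  moreover have "(\<integral>\<sigma>. \<sigma> x \<bullet> \<sigma> y \<partial>\<mu>) \<le> real CARD('N) * ?p"
    unfolding integral_inner_spins[OF xy, of k]
    by (intro mult_left_mono integral_component_le_prob xy) simp
  ultimately show ?thesis by (simp add: T)
qed

end
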